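(* Fix an integer $b\ge 2$. Let $P=P(t,q)=\frac{tq}{1-tq}$, let $C_b=C_b(t,q)$, $B_i=B_i(t,q)$ $(2\le i\le b-1)$, $E_b=E_b(t,q)$ be the generating functions, with $t$ marking height and $q$ marking length, of crossings of width $b$ (counted up to left-right reflection), bubbles of width $i$, and endings in a rectangle of width $b$, respectively. Put $\Sigma_b=\sum_{i=2}^{b-1}B_i$ (an empty sum is $0$). For $j=1,2,3,4$ let $F_{j,b}(t,q)=\sum_{k,n}|\mathcal{F}_j(b,k,n)|\,t^kq^n$ be the generating function of the family $\mathcal{F}_j$ of snakes of width $b$. Then $$F_{1,b}=2\,[1+P(1+E_b)]^2\,\frac{P\,C_b^2}{1-P(C_b+\Sigma_b)},\qquad F_{2,b}=4\,[1+P(1+E_b)]^2\,\frac{P\,C_b\,\Sigma_b}{1-P(C_b+\Sigma_b)},$$ $$F_{3,b}=2\,[1+P(1+E_b)]^2\,\frac{P\,\Sigma_b}{1-P\,\Sigma_b}\cdot\frac{P\,C_b\,\Sigma_b}{1-P(C_b+\Sigma_b)},\qquad F_{4,b}=2\,[1+P(1+E_b)]^2\,C_b-tq^b,$$ and the generating function $\sum_{k,n}pds(b,k,n)t^kq^n$ of the numbers $pds(b,k,n)$ of partially directed snakes of length $n$ inscribed in a $b\times k$ rectangle equals $F_{1,b}+F_{2,b}+F_{3,b}+F_{4,b}$; it is a rational function of $t$ and $q$.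
   Context: Cells are unit squares of the square lattice, adjacent when they share an edge. A snake of length $n$ is an edge-connected set of $n$ cells (up to translation) whose adjacency graph has no cycle and all degrees at most two (so it is a path). Snakes are non-oriented. A snake is a partially directed snake (PDS) if its cells can be listed $c_1,\dots,c_n$ from one end (tail) to the other (head) with every step North, East or West. A snake is inscribed in a $b\times k$ rectangle ($b$ = horizontal width, $k$ = vertical height) if it is contained in it and touches all four of its sides. The height of a snake is the number of rows it occupies. Columns of the rectangle are numbered $1,\dots,b$ from left to right; columns $1$ and $b$ are the side columns. Pieces (in a rectangle of width $b$), listed from bottom to top with steps North/East/West: - crossing of width $b$: a PDS with cells in columns $1,\dots,b$ whose only cell in column $1$ is the tail and whose only cell in column $b$ is the head (or the left-right mirror image). $C_b(t,q)$ counts those with tail in column $1$. - bubble of width $r$, $2\le r<b$: a PDS with tail and head in one side column, say column $1$, all other cells in columns $2,\dots,r$, and at least one cell in column $r$ (or the mirror image with tail and head in column $b$). $B_r(t,q)$ counts those on a given side. - ending: a PDS whose tail is in one side column, say column $1$, and all of whose other cells, of which there is at least one, lie in columns $2,\dots,b-1$ (or the mirror image). $E_b(t,q)$ counts those with tail on a given side. - pillar: a vertical row of at least one cell in a side column; $P(t,q)=\frac{tq}{1-tq}$. Stacking: a sequence of pieces is stacked from bottom to top. Each pillar is placed directly above the top end cell of the preceding piece, in the same side column, and the piece following a pillar has its bottom end cell directly above the pillar in that same side column. Each piece is replaced by its left-right mirror image when needed. An ending may be used only as the first or last piece; when first, it is turned upside down so that its tail is its top end, on the side column. Write $P,C,B,E$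 for the four kinds of pieces (with $B$ of any width $2\le r\le b-1$), $[\,\cdot\,]$ for an optional part, $|$ for a choice, and $(\cdot)^*$ for repetition any number ($\ge 0$) of times. $\mathcal{F}_j(b,k,n)$ is the set of snakes of length $n$ inscribed in a $b\times k$ rectangle obtained by stackings of the following forms (lowest crossing or bubble starting on either side): $\mathcal{F}_1$: $[[E]P]\;C\;(P(C|B))^*\;P\,C\;[P[E]]$. $\mathcal{F}_2$: $[[E]P]\;C\;(P(C|B))^*\;P\,B\;[P[E]]$ and the upside-down reflections of such snakes. $\mathcal{F}_3$: $[[E]P]\;B\;(PB)^*\;P\,C\;(P(C|B))^*\;P\,B\;[P[E]]$. $\mathcal{F}_4$: $[[E]P]\;C\;[P[E]]$. *)

theory Defs
  imports "HOL-Computational_Algebra.Computational_Algebra"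
begin

section \<open>Snakes\<close>

text \<open>A cell is given by its column and its row; rows are numbered upwards.\<close>

type_synonym cell = "int \<times> int"

definition adj :: "cell \<Rightarrow> cell \<Rightarrow> bool" where
  "adj c d \<longleftrightarrow> \<bar>fst c - fst d\<bar> + \<bar>snd c - snd d\<bar> = 1"

definition edge_connected :: "cell set \<Rightarrow> bool" where
  "edge_connected S \<longleftrightarrow>
     (\<forall>c\<in>S. \<forall>d\<in>S. (c, d) \<in> {(x, y). x \<in> S \<and> y \<in> S \<and> adj x y}\<^sup>*)"

definition has_cycle :: "cell set \<Rightarrow> bool" where
  "has_cycle S \<longleftrightarrow>
     (\<exists>cs. length cs \<ge> 3 \<and> distinct cs \<and> set cs \<subseteq> S \<and>
           successively adj cs \<and> adj (last cs) (hd cs))"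

definition snake :: "cell set \<Rightarrow> bool" where
  "snake S \<longleftrightarrow> finite S \<and> S \<noteq> {} \<and> edge_connected S \<and> \<not> has_cycle S \<and>
     (\<forall>c\<in>S. card {d \<in> S. adj c d} \<le> 2)"

definition new_step :: "cell \<Rightarrow> cell \<Rightarrow> bool" where
  "new_step c d \<longleftrightarrow>
     d = (fst c, snd c + 1) \<or> d = (fst c + 1, snd c) \<or> d = (fst c - 1, snd c)"

text \<open>
  A listing of a partially directed snake: its first element is the tail of the snake and its
  last element the head. As the cells form a path and each is listed once, the listing
  necessarily runs from one end of the path to the other.
\<close>

definition pds_listing :: "cell list \<Rightarrow> bool" where
  "pds_listing cs \<longleftrightarrow> snake (set cs) \<and> distinct cs \<and> successively new_step cs"

definition is_pds :: "cell set \<Rightarrow> bool" where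
  "is_pds S \<longleftrightarrow> (\<exists>cs. pds_listing cs \<and> set cs = S)"

definition height :: "cell set \<Rightarrow> nat" where
  "height S = card (snd ` S)"

text \<open>
  The \<open>b \<times> k\<close> rectangle has columns \<open>1, \<dots>, b\<close> and rows \<open>1, \<dots>, k\<close>. Snakes are considered up to
  translation; as \<open>translate_inscribed\<close> and \<open>inscribed_unique\<close> below show, every translation class
  has exactly one member inscribed in a rectangle placed in this way, so inscribed snakes are
  counted as cell sets.
\<close>

definition inscribed :: "nat \<Rightarrow> nat \<Rightarrow> cell set \<Rightarrow> bool" where
  "inscribed b k S \<longleftrightarrow> S \<subseteq> {1..int b} \<times> {1..int k} \<and>
     (\<exists>c\<in>S. fst c = 1) \<and> (\<exists>c\<in>S. fst c = int b) \<and>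
     (\<exists>c\<in>S. snd c = 1) \<and> (\<exists>c\<in>S. snd c = int k)"

definition translate :: "cell \<Rightarrow> cell set \<Rightarrow> cell set" where
  "translate v S = (\<lambda>c. (fst c + fst v, snd c + snd v)) ` S"

lemma translate_inscribed:
  assumes "finite S" "S \<noteq> {}"
  shows "\<exists>v b k. inscribed b k (translate v S)"
proof -
  let ?x = "Min (fst ` S)" and ?X = "Max (fst ` S)"
  let ?y = "Min (snd ` S)" and ?Y = "Max (snd ` S)"
  have ne: "finite (fst ` S)" "fst ` S \<noteq> {}" "finite (snd ` S)" "snd ` S \<noteq> {}"
    using assms by auto
  have bd: "?x \<le> fst c" "fst c \<le> ?X" "?y \<le> snd c" "snd c \<le> ?Y" if "c \<in> S" for c
    using that ne by auto
  obtain c1 where c1: "?x = fst c1" "c1 \<in> S" using Min_in[OF ne(1,2)] by (rule imageE)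
  obtain c2 where c2: "?X = fst c2" "c2 \<in> S" using Max_in[OF ne(1,2)] by (rule imageE)
  obtain c3 where c3: "?y = snd c3" "c3 \<in> S" using Min_in[OF ne(3,4)] by (rule imageE)
  obtain c4 where c4: "?Y = snd c4" "c4 \<in> S" using Max_in[OF ne(3,4)] by (rule imageE)
  have "?x \<le> ?X" "?y \<le> ?Y"
    using bd[OF c1(2)] by linarith+
  then have n: "int (nat (?X - ?x + 1)) = ?X - ?x + 1" "int (nat (?Y - ?y + 1)) = ?Y - ?y + 1"
    by simp_all
  have "inscribed (nat (?X - ?x + 1)) (nat (?Y - ?y + 1)) (translate (1 - ?x, 1 - ?y) S)"
    unfolding inscribed_def n
  proof (intro conjI)
    show "translate (1 - ?x, 1 - ?y) S \<subseteq> {1..?X - ?x + 1} \<times> {1..?Y - ?y + 1}"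
    proof
      fix z assume "z \<in> translate (1 - ?x, 1 - ?y) S"
      then obtain c where c: "c \<in> S" and z: "z = (fst c + (1 - ?x), snd c + (1 - ?y))"
        unfolding translate_def fst_conv snd_conv by blast
      show "z \<in> {1..?X - ?x + 1} \<times> {1..?Y - ?y + 1}"
        unfolding z mem_Times_iff fst_conv snd_conv atLeastAtMost_iff
        using bd(1)[OF c] bd(2)[OF c] bd(3)[OF c] bd(4)[OF c] by linarith
    qed
  next
    show "\<exists>c\<in>translate (1 - ?x, 1 - ?y) S. fst c = 1"
      by (simp only: translate_def bex_simps fst_conv) (rule bexI[OF _ c1(2)], use c1(1) in linarith)
    show "\<exists>c\<in>translate (1 - ?x, 1 - ?y) S. fst c = ?X - ?x + 1"
      by (simp only: translate_def bex_simps fst_conv) (rule bexI[OF _ c2(2)], use c2(1) in linarith)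
    show "\<exists>c\<in>translate (1 - ?x, 1 - ?y) S. snd c = 1"
      by (simp only: translate_def bex_simps snd_conv) (rule bexI[OF _ c3(2)], use c3(1) in linarith)
    show "\<exists>c\<in>translate (1 - ?x, 1 - ?y) S. snd c = ?Y - ?y + 1"
      by (simp only: translate_def bex_simps snd_conv) (rule bexI[OF _ c4(2)], use c4(1) in linarith)
  qed
  then show ?thesis by blast
qed

lemma inscribed_unique:
  assumes "inscribed b k (translate v S)" "inscribed b' k' (translate w S)"
  shows "v = w \<and> b = b' \<and> k = k'"
proof -
  have *: "fst u = 1 - Min (fst ` S) \<and> int h = fst u + Max (fst ` S) \<and>
           snd u = 1 - Min (snd ` S) \<and> int l = snd u + Max (snd ` S)"
    if ins: "inscribed h l (translate u S)" for h l u
  proof -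
    have bd: "1 \<le> fst c + fst u \<and> fst c + fst u \<le> int h \<and>
              1 \<le> snd c + snd u \<and> snd c + snd u \<le> int l" if "c \<in> S" for c
      using ins that by (fastforce simp: inscribed_def translate_def)
    have "fst ` S \<subseteq> {1 - fst u..int h - fst u}" "snd ` S \<subseteq> {1 - snd u..int l - snd u}"
      by (auto dest!: bd)
    then have fin: "finite (fst ` S)" "finite (snd ` S)"
      using finite_subset finite_atLeastAtMost_int by blast+
    obtain c1 c2 c3 c4 where c: "c1 \<in> S" "fst c1 + fst u = 1" "c2 \<in> S" "fst c2 + fst u = int h"
        "c3 \<in> S" "snd c3 + snd u = 1" "c4 \<in> S" "snd c4 + snd u = int l"
      using ins by (auto simp: inscribed_def translate_def)
    have "Min (fst ` S) = 1 - fst u"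
    proof (rule Min_eqI[OF fin(1)])
      show "1 - fst u \<in> fst ` S"
        by (rule image_eqI[OF _ c(1)]) (use c(2) in linarith)
      show "y \<ge> 1 - fst u" if "y \<in> fst ` S" for y
        using that by (auto dest!: bd)
    qed
    moreover have "Max (fst ` S) = int h - fst u"
    proof (rule Max_eqI[OF fin(1)])
      show "int h - fst u \<in> fst ` S"
        by (rule image_eqI[OF _ c(3)]) (use c(4) in linarith)
      show "y \<le> int h - fst u" if "y \<in> fst ` S" for y
        using that by (auto dest!: bd)
    qed
    moreover have "Min (snd ` S) = 1 - snd u"
    proof (rule Min_eqI[OF fin(2)])
      show "1 - snd u \<in> snd ` S"
        by (rule image_eqI[OF _ c(5)]) (use c(6) in linarith)
      show "y \<ge> 1 - snd u" if "y \<in> snd ` S" for y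
        using that by (auto dest!: bd)
    qed
    moreover have "Max (snd ` S) = int l - snd u"
    proof (rule Max_eqI[OF fin(2)])
      show "int l - snd u \<in> snd ` S"
        by (rule image_eqI[OF _ c(7)]) (use c(8) in linarith)
      show "y \<le> int l - snd u" if "y \<in> snd ` S" for y
        using that by (auto dest!: bd)
    qed
    ultimately show ?thesis by simp
  qed
  show ?thesis
    using *[OF assms(1)] *[OF assms(2)] by (simp add: prod_eq_iff)
qed

definition pds :: "nat \<Rightarrow> nat \<Rightarrow> nat \<Rightarrow> nat" where
  "pds b k n = card {S. is_pds S \<and> inscribed b k S \<and> card S = n}"


section \<open>Pieces\<close>

text \<open>Pieces are represented by their listings from bottom to top.\<close>

definition left_crossing :: "nat \<Rightarrow> cell list \<Rightarrow> bool" where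
  "left_crossing b cs \<longleftrightarrow> pds_listing cs \<and> (\<forall>c\<in>set cs. fst c \<in> {1..int b}) \<and>
     {c \<in> set cs. fst c = 1} = {hd cs} \<and> {c \<in> set cs. fst c = int b} = {last cs}"

definition left_bubble :: "nat \<Rightarrow> cell list \<Rightarrow> bool" where
  "left_bubble r cs \<longleftrightarrow> pds_listing cs \<and> fst (hd cs) = 1 \<and> fst (last cs) = 1 \<and>
     (\<forall>c\<in>set cs - {hd cs, last cs}. fst c \<in> {2..int r}) \<and> (\<exists>c\<in>set cs. fst c = int r)"

definition left_ending :: "nat \<Rightarrow> cell list \<Rightarrow> bool" where
  "left_ending b cs \<longleftrightarrow> pds_listing cs \<and> fst (hd cs) = 1 \<and> length cs \<ge> 2 \<and>
     (\<forall>c\<in>set (tl cs). fst c \<in> {2..int b - 1})"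

definition pillar :: "nat \<Rightarrow> cell list \<Rightarrow> bool" where
  "pillar b cs \<longleftrightarrow>
     (\<exists>x\<in>{1, int b}. \<exists>y. \<exists>m\<ge>1. cs = map (\<lambda>i. (x, y + int i)) [0..<m])"

definition mirror :: "nat \<Rightarrow> cell list \<Rightarrow> cell list" where
  "mirror b = map (\<lambda>c. (int b + 1 - fst c, snd c))"

text \<open>Turning a piece upside down reverses its listing from bottom to top.\<close>

definition upside_down :: "cell list \<Rightarrow> cell list" where
  "upside_down cs = rev (map (\<lambda>c. (fst c, - snd c)) cs)"

text \<open>\<open>Lower_Ending\<close> is an ending used as first piece, \<open>Upper_Ending\<close> one used as last piece.\<close>

datatype piece = Pillar | Crossing | Bubble | Lower_Ending | Upper_Ending

fun is_piece :: "nat \<Rightarrow> piece \<Rightarrow> cell list \<Rightarrow> bool" where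
  "is_piece b Pillar cs \<longleftrightarrow> pillar b cs"
| "is_piece b Crossing cs \<longleftrightarrow> left_crossing b cs \<or> left_crossing b (mirror b cs)"
| "is_piece b Bubble cs \<longleftrightarrow>
     (\<exists>r. 2 \<le> r \<and> r < b \<and> (left_bubble r cs \<or> left_bubble r (mirror b cs)))"
| "is_piece b Upper_Ending cs \<longleftrightarrow> left_ending b cs \<or> left_ending b (mirror b cs)"
| "is_piece b Lower_Ending cs \<longleftrightarrow>
     left_ending b (upside_down cs) \<or> left_ending b (mirror b (upside_down cs))"


section \<open>Stackings and the four families\<close>

text \<open>
  Pieces are stacked at their final positions. In all forms below, pillars alternate with the other
  pieces, so the condition on consecutive pieces is the one for placing a pillar on a piece or a
  piece on a pillar.
\<close>

definition stacking :: "nat \<Rightarrow> piece list \<Rightarrow> cell list list \<Rightarrow> bool" where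
  "stacking b w ps \<longleftrightarrow> list_all2 (is_piece b) w ps \<and>
     successively (\<lambda>p p'. hd p' = (fst (last p), snd (last p) + 1)) ps"

definition obtained :: "nat \<Rightarrow> piece list set \<Rightarrow> nat \<Rightarrow> nat \<Rightarrow> cell set set" where
  "obtained b W k n = {S. snake S \<and> card S = n \<and> inscribed b k S \<and>
     (\<exists>w\<in>W. \<exists>ps. stacking b w ps \<and> S = set (concat ps))}"

definition conc :: "'a list set \<Rightarrow> 'a list set \<Rightarrow> 'a list set" (infixr "\<cdot>" 75) where
  "U \<cdot> V = {u @ v | u v. u \<in> U \<and> v \<in> V}"

definition star :: "'a list set \<Rightarrow> 'a list set" where
  "star U = {concat us | us. set us \<subseteq> U}"

definition lower :: "piece list set" where
  "lower = {[], [Pillar], [Lower_Ending, Pillar]}"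

definition upper :: "piece list set" where
  "upper = {[], [Pillar], [Pillar, Upper_Ending]}"

definition form1 :: "piece list set" where
  "form1 = lower \<cdot> {[Crossing]} \<cdot> star {[Pillar, Crossing], [Pillar, Bubble]} \<cdot>
     {[Pillar, Crossing]} \<cdot> upper"

definition form2 :: "piece list set" where
  "form2 = lower \<cdot> {[Crossing]} \<cdot> star {[Pillar, Crossing], [Pillar, Bubble]} \<cdot>
     {[Pillar, Bubble]} \<cdot> upper"

definition form3 :: "piece list set" where
  "form3 = lower \<cdot> {[Bubble]} \<cdot> star {[Pillar, Bubble]} \<cdot> {[Pillar, Crossing]} \<cdot>
     star {[Pillar, Crossing], [Pillar, Bubble]} \<cdot> {[Pillar, Bubble]} \<cdot> upper"

definition form4 :: "piece list set" where
  "form4 = lower \<cdot> {[Crossing]} \<cdot> upper"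

text \<open>Upside-down reflection of the rectangle with rows \<open>1, \<dots>, k\<close>.\<close>

definition reflect :: "nat \<Rightarrow> cell set \<Rightarrow> cell set" where
  "reflect k S = (\<lambda>c. (fst c, int k + 1 - snd c)) ` S"

definition family1 :: "nat \<Rightarrow> nat \<Rightarrow> nat \<Rightarrow> cell set set" where
  "family1 b k n = obtained b form1 k n"

definition family2 :: "nat \<Rightarrow> nat \<Rightarrow> nat \<Rightarrow> cell set set" where
  "family2 b k n = obtained b form2 k n \<union> reflect k ` obtained b form2 k n"

definition family3 :: "nat \<Rightarrow> nat \<Rightarrow> nat \<Rightarrow> cell set set" where
  "family3 b k n = obtained b form3 k n"

definition family4 :: "nat \<Rightarrow> nat \<Rightarrow> nat \<Rightarrow> cell set set" where
  "family4 b k n = obtained b form4 k n"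


section \<open>Generating functions\<close>

text \<open>
  Power series in \<open>t\<close> and \<open>q\<close> are power series in \<open>t\<close> whose coefficients are power series in \<open>q\<close>.
\<close>

type_synonym series = "rat fps fps"

definition t :: series where "t = fps_X"

definition q :: series where "q = fps_const fps_X"

definition gf :: "(nat \<Rightarrow> nat \<Rightarrow> nat) \<Rightarrow> series" where
  "gf a = Abs_fps (\<lambda>k. Abs_fps (\<lambda>n. of_nat (a k n)))"

text \<open>
  The coefficient ring of the outer power series is not a field, but every denominator below has
  constant coefficient 1 with respect to \<open>t\<close>, and for these the library's division is the true one.
\<close>

lemma series_divide:
  fixes f g :: series
  assumes "fps_nth g 0 = 1"
  shows "f / g * g = f"
proof -
  have "g \<noteq> 0" "subdegree g = 0"
    using assms by (auto intro: subdegree_eq_0)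
  then have "f / g = f * inverse g"
    by (simp add: fps_divide_def)
  moreover have "inverse g * g = 1"
    using fps_left_inverse'[of 1 g 1] by (simp add: fps_inverse_def[of g] assms)
  ultimately show ?thesis
    by (simp add: mult.assoc)
qed

text \<open>
  Pieces are counted up to vertical translation, with lowest cells in row 1, and up to left-right
  reflection.
\<close>

definition pieces :: "(cell list \<Rightarrow> bool) \<Rightarrow> nat \<Rightarrow> nat \<Rightarrow> cell set set" where
  "pieces Q k n = {S. (\<exists>cs. Q cs \<and> set cs = S) \<and> Min (snd ` S) = 1 \<and> height S = k \<and> card S = n}"

definition gfP :: series where
  "gfP = t * q / (1 - t * q)"

definition gfC :: "nat \<Rightarrow> series" where
  "gfC b = gf (\<lambda>k n. card (pieces (left_crossing b) k n))"

definition gfB :: "nat \<Rightarrow> series" where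
  "gfB r = gf (\<lambda>k n. card (pieces (left_bubble r) k n))"

definition gfE :: "nat \<Rightarrow> series" where
  "gfE b = gf (\<lambda>k n. card (pieces (left_ending b) k n))"

definition gfF1 :: "nat \<Rightarrow> series" where
  "gfF1 b = gf (\<lambda>k n. card (family1 b k n))"

definition gfF2 :: "nat \<Rightarrow> series" where
  "gfF2 b = gf (\<lambda>k n. card (family2 b k n))"

definition gfF3 :: "nat \<Rightarrow> series" where
  "gfF3 b = gf (\<lambda>k n. card (family3 b k n))"

definition gfF4 :: "nat \<Rightarrow> series" where
  "gfF4 b = gf (\<lambda>k n. card (family4 b k n))"

text \<open>
  A power series is a rational function if it is the expansion at the origin of a quotient of two
  polynomials in \<open>t\<close> and \<open>q\<close>, the denominator having nonzero constant term.
\<close>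

definition series_of_poly :: "rat poly poly \<Rightarrow> series" where
  "series_of_poly p = Abs_fps (\<lambda>k. fps_of_poly (coeff p k))"

definition rational :: "series \<Rightarrow> bool" where
  "rational f \<longleftrightarrow>
     (\<exists>p d. coeff (coeff d 0) 0 \<noteq> 0 \<and> f * series_of_poly d = series_of_poly p)"

end

theory Submission
  imports Defs
begin

text \<open>
  A partially directed snake amounts to a walk with steps N, E, W in which no step is undone and no
  factor ENW or WNE occurs: a condition on at most four consecutive cells, which survives cutting
  and stacking as long as two vertical steps separate an arrival at a side column from the next
  departure. Cutting a snake that touches both sides at its visits to the side columns therefore
  yields a stacking with at least one crossing, and this stacking is unique, because every piece
  other than a pillar ends at the next cell in a side column or at the end of the snake. So counting
  snakes is counting words of pieces, weighted by the generating functions of the pieces, together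
  with the side on which they start. Only a single row of cells is then counted twice.

  Rationality comes from a finite automaton that reads the walk cell by cell: its transition matrix
  is polynomial and vanishes at the origin.
\<close>

section \<open>Listings as locally constrained walks\<close>

text \<open>Being a snake is a global property: no cycle, bounded degrees. If no step is undone,
  cells three steps apart can be adjacent only after ENW or WNE, where four cells fill a unit
  square; this is what the last clause of \<open>walk\<close> bans. Since rows never decrease, no
  longer contact can arise without such a short one (\<open>stays_ahead\<close>). Counting is done
  on listings instead of cell sets, because a listing carries the order of the visits to the side
  columns. A listing can be recovered from its cells and its first cell, and from the cells alone
  once there are two rows. Crossings, bubbles and endings are treated as one kind of object, two end
  cells around interior cells, told apart only by their end columns. Rationality is not read off the
  closed forms, which would require \<open>gfC\<close>, \<open>gfB\<close> and \<open>gfE\<close> to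
  be rational beforehand: the automaton handles all snakes of the strip at once and remembers which
  side columns are still unvisited.\<close>

definition walk :: "cell list \<Rightarrow> bool" where
  "walk cs \<longleftrightarrow> cs \<noteq> [] \<and> successively new_step cs \<and>
     (\<forall>i. i + 2 < length cs \<longrightarrow> cs ! (i + 2) \<noteq> cs ! i) \<and>
     (\<forall>i. i + 3 < length cs \<longrightarrow> \<not> adj (cs ! i) (cs ! (i + 3)))"

lemma walkD:
  assumes "walk cs"
  shows "cs \<noteq> []" "\<And>i. Suc i < length cs \<Longrightarrow> new_step (cs ! i) (cs ! Suc i)"
    "\<And>i. i + 2 < length cs \<Longrightarrow> cs ! (i + 2) \<noteq> cs ! i"
    "\<And>i. i + 3 < length cs \<Longrightarrow> \<not> adj (cs ! i) (cs ! (i + 3))"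
    "successively new_step cs"
  using assms by (auto simp: walk_def successively_conv_nth)

lemma walk_single [simp]: "walk [c]"
  by (simp add: walk_def)

lemma walk_drop:
  assumes "walk cs" "n < length cs"
  shows "walk (drop n cs)"
proof -
  have "new_step (drop n cs ! i) (drop n cs ! Suc i)" if "Suc i < length (drop n cs)" for i
    using walkD(2)[OF assms(1), of "n + i"] that by simp
  moreover have "drop n cs ! (i + 2) \<noteq> drop n cs ! i" if "i + 2 < length (drop n cs)" for i
    using walkD(3)[OF assms(1), of "n + i"] that by (simp add: add.assoc)
  moreover have "\<not> adj (drop n cs ! i) (drop n cs ! (i + 3))" if "i + 3 < length (drop n cs)" for i
    using walkD(4)[OF assms(1), of "n + i"] that by (simp add: add.assoc)
  ultimately show ?thesis
    using assms(2) unfolding walk_def successively_conv_nth by auto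
qed

lemma walk_take:
  assumes "walk cs" "0 < n"
  shows "walk (take n cs)"
  using assms by (auto simp: walk_def successively_conv_nth)

lemma walk_appendD1: "walk (xs @ ys) \<Longrightarrow> xs \<noteq> [] \<Longrightarrow> walk xs"
  using walk_take[of "xs @ ys" "length xs"] by simp

lemma walk_appendD2: "walk (xs @ ys) \<Longrightarrow> ys \<noteq> [] \<Longrightarrow> walk ys"
  using walk_drop[of "xs @ ys" "length xs"] by simp

lemma walk_ConsD: "walk (c # cs) \<Longrightarrow> cs \<noteq> [] \<Longrightarrow> walk cs"
  using walk_appendD2[of "[c]" cs] by simp

lemma new_step_rows: "new_step c d \<Longrightarrow> snd d = snd c \<or> snd d = snd c + 1"
  by (auto simp: new_step_def)

lemma new_step_vertical: "new_step c d \<Longrightarrow> fst d = fst c \<Longrightarrow> snd d = snd c + 1"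
  by (auto simp: new_step_def)

lemma new_step_adj: "new_step c d \<Longrightarrow> adj c d"
  by (auto simp: new_step_def adj_def)

lemma adj_sym: "adj c d \<Longrightarrow> adj d c"
  by (auto simp: adj_def)

lemma not_adj_self [simp]: "\<not> adj c c"
  by (simp add: adj_def)

section \<open>Walks are induced paths\<close>

lemma rows_mono:
  assumes "successively new_step cs" "i \<le> j" "j < length cs"
  shows "snd (cs ! i) \<le> snd (cs ! j)"
  using assms(2,3)
proof (induction rule: dec_induct)
  case (step n)
  then show ?case
    using successively_nth[OF assms(1), of n] new_step_rows by fastforce
qed simp

lemma rows_hd_last:
  assumes "successively new_step cs" "c \<in> set cs"
  shows "snd (hd cs) \<le> snd c" "snd c \<le> snd (last cs)"
proof -
  obtain i where i: "i < length cs" "c = cs ! i"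
    using assms(2) by (metis in_set_conv_nth)
  then have "cs \<noteq> []" by auto
  then have "hd cs = cs ! 0" "last cs = cs ! (length cs - 1)"
    by (simp_all add: hd_conv_nth last_conv_nth)
  with i show "snd (hd cs) \<le> snd c" "snd c \<le> snd (last cs)"
    using rows_mono[OF assms(1), of 0 i] rows_mono[OF assms(1), of i "length cs - 1"] by auto
qed

text \<open>
  After a horizontal step the walk stays strictly ahead of its first cell in the current row and in
  the next one: it would have to climb twice before it can turn back.
\<close>

lemma stays_ahead:
  assumes "walk (c # d # cs)" "d = (fst c + s, snd c)" "s = 1 \<or> s = -1"
    and "e \<in> set (d # cs)"
  shows "snd e > snd c + 1 \<or> s * (fst e - fst c) > 0"
  using assms
\<comment> \<open>Strong induction on the length: the argument restarts one cell later after a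
  second horizontal step, but two cells later after a single climb.\<close>
proof (induction "length cs" arbitrary: c d cs rule: less_induct)
  case less
  have s: "s * s = 1" "s * (fst d - fst c) > 0"
    using less.prems by auto
  show ?case
  proof (cases cs)
    case Nil
    then show ?thesis using less.prems s by auto
  next
    case (Cons f cs')
    note L = walkD[OF less.prems(1)]
    have df: "new_step d f" "f \<noteq> c"
      using L(2)[of 1] L(3)[of 0] Cons by simp_all
    have tl: "walk (d # f # cs')"
      using walk_ConsD[OF less.prems(1)] Cons by simp
    consider "f = (fst d + s, snd d)" | "f = (fst d, snd d + 1)"
      using df less.prems(2,3) by (auto simp: new_step_def prod_eq_iff)
    then show ?thesis
    proof cases
      case 1
      show ?thesis
      proof (cases "e = d")
        case False
        then have "snd e > snd d + 1 \<or> s * (fst e - fst d) > 0"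
          using less.hyps[OF _ tl 1 less.prems(3)] less.prems(4) Cons by auto
        then show ?thesis
          using less.prems(2) less.prems(3) by auto
      qed (use s in auto)
    next
      case 2
      show ?thesis
      proof (cases cs')
        case Nil
        then show ?thesis using less.prems 2 Cons s by auto
      next
        case (Cons g cs'')
        have fg: "new_step f g" "\<not> adj c g"
          using L(2)[of 2] L(4)[of 0] \<open>cs = f # cs'\<close> Cons by (simp_all add: eval_nat_numeral)
        have tl': "walk (f # g # cs'')"
          using walk_ConsD[OF tl] Cons by simp
        \<comment> \<open>Turning back at \<open>f\<close> would put \<open>g\<close> directly above
          \<open>c\<close>, a contact at distance three.\<close>
        consider "g = (fst f + s, snd f)" | "g = (fst f, snd f + 1)"
          using fg less.prems(2,3) 2 by (auto simp: new_step_def prod_eq_iff adj_def)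
        then show ?thesis
        proof cases
          case 1
          show ?thesis
          proof (cases "e = d \<or> e = f")
            case False
            then have "snd e > snd f + 1 \<or> s * (fst e - fst f) > 0"
              using less.hyps[OF _ tl' 1 less.prems(3)] less.prems(4) Cons \<open>cs = f # cs'\<close> by auto
            then show ?thesis
              using less.prems(2) less.prems(3) 2 by auto
          qed (use s 2 in auto)
        next
          case up: 2
          show ?thesis
          proof (cases "e = d \<or> e = f")
            case False
            then have "e \<in> set (g # cs'')"
              using less.prems(4) Cons \<open>cs = f # cs'\<close> by auto
            then have "snd e \<ge> snd g"
              using rows_hd_last(1)[of "g # cs''" e]
                walkD(5)[OF walk_ConsD[OF tl']] by simp
            then show ?thesis using up 2 less.prems(2) by simp
          qed (use s 2 in auto)
        qed
      qed
    qed
  qed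
qed

text \<open>Here the local conditions become global. After a step up, all later cells lie in higher
  rows, where the only neighbour of \<open>c\<close> is its successor; after a horizontal step,
  \<open>stays_ahead\<close> leaves the successor as the only possible contact.\<close>

lemma walk_head:
  assumes "walk (c # cs)" "d \<in> set cs"
  shows "d \<noteq> c" "adj c d \<Longrightarrow> d = hd cs"
proof -
  obtain e cs' where cs: "cs = e # cs'" using assms(2) by (cases cs) auto
  have ce: "new_step c e"
    using walkD(2)[OF assms(1), of 0] cs by simp
  have row: "snd d \<ge> snd e" "snd d \<ge> snd c"
    using rows_hd_last(1)[of cs d] rows_hd_last(1)[of "c # cs" d]
      walkD(5)[OF walk_ConsD[OF assms(1)]] walkD(5)[OF assms(1)] cs assms(2)
    by auto
  have H: "d \<noteq> c \<and> (adj c d \<longrightarrow> d = hd cs)"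
  proof (cases "e = (fst c, snd c + 1)")
    case True
    have "adj c d \<Longrightarrow> d = e"
      using row True by (auto simp: adj_def prod_eq_iff abs_if split: if_splits)
    then show ?thesis using True row cs by auto
  next
    case False
    with ce obtain s where s: "s = 1 \<or> s = -1" "e = (fst c + s, snd c)"
      unfolding new_step_def by (metis add_uminus_conv_diff)
    have A: "snd d > snd c + 1 \<or> s * (fst d - fst c) > 0"
      using stays_ahead[of c e cs' s d] assms cs s by auto
    then show ?thesis using s row cs by (auto simp: adj_def prod_eq_iff abs_if split: if_splits)
  qed
  then show "d \<noteq> c" "adj c d \<Longrightarrow> d = hd cs" by auto
qed

lemma walk_distinct: "walk cs \<Longrightarrow> distinct cs"
proof (induction cs)
  case (Cons c cs)
  then show ?case
    using walk_head(1)[of c cs c] walk_ConsD[of c cs] by (cases "cs = []") auto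
qed simp

text \<open>\<open>walk_head\<close> applied to the suffix that starts at the smaller index.
  Acyclicity and the degree bound are both read off from this.\<close>

lemma walk_adj_nth:
  assumes "walk cs" "i < length cs" "j < length cs" "adj (cs ! i) (cs ! j)"
  shows "j = Suc i \<or> i = Suc j"
proof -
  have *: "j = Suc i" if "i < j" "j < length cs" "adj (cs ! i) (cs ! j)" for i j
  proof -
    have "drop i cs = cs ! i # drop (Suc i) cs"
      using that by (simp add: Cons_nth_drop_Suc)
    moreover have "cs ! j \<in> set (drop (Suc i) cs)"
      using that by (auto simp: in_set_conv_nth intro!: exI[of _ "j - Suc i"])
    ultimately have "cs ! j = hd (drop (Suc i) cs)"
      using walk_head(2) walk_drop[OF assms(1), of i] that by (metis less_trans)
    also have "\<dots> = cs ! Suc i"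
      using that by (simp add: hd_drop_conv_nth)
    finally show ?thesis
      using walk_distinct[OF assms(1)] that by (simp add: nth_eq_iff_index_eq)
  qed
  have "i \<noteq> j" using assms(4) by auto
  then show ?thesis
    using *[of i j] *[of j i] assms adj_sym by (metis linorder_neqE_nat)
qed

lemma successively_adj_cyclic:
  assumes "successively adj cs" "adj (last cs) (hd cs)" "i < length cs"
  shows "adj (cs ! i) (cs ! (Suc i mod length cs))"
proof (cases "Suc i < length cs")
  case False
  then have "Suc i = length cs" using assms(3) by simp
  moreover have "cs \<noteq> []" using assms(3) by auto
  ultimately show ?thesis
    using assms(2) by (metis hd_conv_nth last_conv_nth diff_Suc_1 mod_self)
qed (use successively_nth[OF assms(1)] in simp)

text \<open>In a cycle, take the cell that comes last in the walk: both its cyclic neighbours must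
  be the cell just before it, so they coincide, which is impossible with at least three distinct
  cells.\<close>

lemma walk_no_cycle:
  assumes "walk L"
  shows "\<not> has_cycle (set L)"
proof
  assume "has_cycle (set L)"
  then obtain cs where cs: "length cs \<ge> 3" "distinct cs" "set cs \<subseteq> set L"
      "successively adj cs" "adj (last cs) (hd cs)"
    unfolding has_cycle_def by blast
  define n where "n = length cs"
  have "\<forall>i. \<exists>j. i < n \<longrightarrow> j < length L \<and> L ! j = cs ! i"
    using cs(3) n_def by (metis in_set_conv_nth nth_mem subsetD)
  then obtain f where f: "\<And>i. i < n \<Longrightarrow> f i < length L \<and> L ! f i = cs ! i"
    by metis
  have inj: "i = j" if "f i = f j" "i < n" "j < n" for i j
    using that f[of i] f[of j] cs(2) n_def by (metis nth_eq_iff_index_eq)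
  have step: "f (Suc i mod n) = Suc (f i) \<or> f i = Suc (f (Suc i mod n))" if "i < n" for i
  proof -
    have m: "Suc i mod n < n" using that by simp
    show ?thesis
      using walk_adj_nth[OF assms, of "f i" "f (Suc i mod n)"] f[OF that] f[OF m]
        successively_adj_cyclic[OF cs(4,5), of i] that n_def by auto
  qed
  have "0 \<in> {..<n}" using cs(1) n_def by auto
  then have "finite (f ` {..<n})" "f ` {..<n} \<noteq> {}" by blast+
  then have "Max (f ` {..<n}) \<in> f ` {..<n}" by (rule Max_in)
  then obtain i where i: "i < n" "f i = Max (f ` {..<n})" by auto
  have le: "f j \<le> f i" if "j < n" for j
    unfolding i(2) using that by (intro Max_ge) auto
  \<comment> \<open>The cyclic predecessor of \<open>i\<close>; it differs from the successor
    because the cycle has at least three cells.\<close>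
  define j where "j = (if i = 0 then n - 1 else i - 1)"
  have n3: "n \<ge> 3" using cs(1) n_def by simp
  have j: "j < n" "Suc j mod n = i" "j \<noteq> Suc i mod n"
    using i(1) n3 unfolding j_def by (auto simp: mod_if)
  have "Suc (f j) = f i"
    using step[OF j(1)] le[OF j(1)] j(2) by auto
  moreover have "Suc (f (Suc i mod n)) = f i"
    using step[OF i(1)] le[of "Suc i mod n"] i(1) by auto
  ultimately show False
    using inj[of j "Suc i mod n"] j i(1) by simp
qed

lemma walk_degree:
  assumes "walk L" "c \<in> set L"
  shows "card {d \<in> set L. adj c d} \<le> 2"
proof -
  obtain i where i: "i < length L" "L ! i = c"
    using assms(2) by (metis in_set_conv_nth)
  \<comment> \<open>At either end of the walk one of the two listed values is not a neighbour
    (truncated subtraction for \<open>i = 0\<close>, a default element past the end); this only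
    enlarges the bounding set.\<close>
  have "{d \<in> set L. adj c d} \<subseteq> {L ! Suc i, L ! (i - 1)}"
  proof
    fix d assume "d \<in> {d \<in> set L. adj c d}"
    then obtain j where "j < length L" "L ! j = d" "adj (L ! i) (L ! j)"
      using i by (auto simp: in_set_conv_nth)
    then show "d \<in> {L ! Suc i, L ! (i - 1)}"
      using walk_adj_nth[OF assms(1) i(1)] by fastforce
  qed
  then have "card {d \<in> set L. adj c d} \<le> card {L ! Suc i, L ! (i - 1)}"
    by (intro card_mono) auto
  also have "\<dots> \<le> 2" by (simp add: card_insert_if)
  finally show ?thesis .
qed

lemma edge_connected_path:
  assumes "successively adj L"
  shows "edge_connected (set L)"
proof -
  let ?R = "{(x, y). x \<in> set L \<and> y \<in> set L \<and> adj x y}"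
  have up: "(L ! i, L ! j) \<in> ?R\<^sup>*" if "i \<le> j" "j < length L" for i j
    using that
  proof (induction rule: dec_induct)
    case (step n)
    then have "(L ! n, L ! Suc n) \<in> ?R"
      using successively_nth[OF assms, of n] by simp
    then show ?case using step by (auto intro: rtrancl_into_rtrancl)
  qed simp
  have "sym ?R" by (auto simp: sym_def adj_sym)
  then have sym: "sym (?R\<^sup>*)" by (rule sym_rtrancl)
  have "(L ! i, L ! j) \<in> ?R\<^sup>*" if "i < length L" "j < length L" for i j
  proof (cases "i \<le> j")
    case False
    then have "(L ! j, L ! i) \<in> ?R\<^sup>*" using up[of j i] that by simp
    then show ?thesis by (rule symD[OF sym])
  qed (use up that in simp)
  then have "(c, d) \<in> ?R\<^sup>*" if "c \<in> set L" "d \<in> set L" for c d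
    using that unfolding in_set_conv_nth[of c L] in_set_conv_nth[of d L] by blast
  then show ?thesis unfolding edge_connected_def by blast
qed

text \<open>Forwards, distinctness forbids undoing a step, and a contact at distance three would
  close a cycle of four cells. Backwards, all parts of \<open>snake\<close> follow from the walk
  being an induced path.\<close>

theorem pds_listing_iff_local: "pds_listing L \<longleftrightarrow> walk L"
proof
  assume L: "walk L"
  have "successively adj L"
    using walkD(5)[OF L] by (rule successively_mono) (simp add: new_step_adj)
  then show "pds_listing L"
    unfolding pds_listing_def snake_def
    using L edge_connected_path walk_no_cycle walk_degree walk_distinct
      walkD(1,5) by auto
next
  assume "pds_listing L"
  then have L: "L \<noteq> []" "distinct L" "successively new_step L" "\<not> has_cycle (set L)"
    by (auto simp: pds_listing_def snake_def)
  have "\<not> adj (L ! i) (L ! (i + 3))" if i: "i + 3 < length L" for i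
  proof
    assume a: "adj (L ! i) (L ! (i + 3))"
    let ?cs = "[L ! i, L ! Suc i, L ! Suc (Suc i), L ! (i + 3)]"
    have "new_step (L ! i) (L ! Suc i)" "new_step (L ! Suc i) (L ! Suc (Suc i))"
      "new_step (L ! Suc (Suc i)) (L ! (i + 3))"
      using i successively_nth[OF L(3), of i] successively_nth[OF L(3), of "Suc i"]
        successively_nth[OF L(3), of "Suc (Suc i)"] by (simp_all add: eval_nat_numeral)
    then have "successively adj ?cs" by (simp add: new_step_adj)
    moreover have "distinct ?cs" using L(2) i by (simp add: nth_eq_iff_index_eq)
    moreover have "set ?cs \<subseteq> set L" using i by simp
    ultimately have "has_cycle (set L)"
      unfolding has_cycle_def using adj_sym[OF a] by (intro exI[of _ ?cs]) simp
    then show False using L(4) by blast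
  qed
  then show "walk L"
    using L by (auto simp: walk_def nth_eq_iff_index_eq)
qed

text \<open>Only windows of at most four cells across the junction are new. The junction itself is a
  step up, so the danger is a horizontal step just before it that is reversed just after it;
  \<open>vert\<close> prevents this by a second vertical step, or by one part being too
  short.\<close>

lemma walk_append:
  assumes L: "walk L" and M: "walk M"
    and glue: "hd M = (fst (last L), snd (last L) + 1)"
    and vert: "length L = 1 \<or> length M = 1 \<or> fst (M ! 1) = fst (M ! 0) \<or>
      fst (L ! (length L - 2)) = fst (last L)"
  shows "walk (L @ M)"
proof -
  let ?l = "length L" and ?r = "snd (last L)"
  have ne: "L \<noteq> []" "M \<noteq> []" using L M by (auto simp: walk_def)
  have lastL: "last L = L ! (?l - 1)" and hdM: "hd M = M ! 0"
    using ne by (simp_all add: last_conv_nth hd_conv_nth)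
  have rL: "snd (L ! i) \<le> ?r" if "i < ?l" for i
    using rows_hd_last(2)[OF walkD(5)[OF L]] that by simp
  have rM: "snd (M ! i) \<ge> ?r + 1" if "i < length M" for i
    using rows_hd_last(1)[OF walkD(5)[OF M], of "M ! i"] that glue by simp
  have "successively new_step (L @ M)"
    using L M glue by (auto simp: successively_append_iff walk_def new_step_def)
  moreover have "(L @ M) ! (i + 2) \<noteq> (L @ M) ! i" if i: "i + 2 < length (L @ M)" for i
  proof -
    consider "i + 2 < ?l" | "i \<ge> ?l" | "i < ?l" "i + 2 \<ge> ?l" by linarith
    then show ?thesis
    proof cases
      case 1 then show ?thesis using walkD(3)[OF L] by (simp add: nth_append)
    next
      case 2
      then have "i - ?l + 2 = i + 2 - ?l" by simp
      then show ?thesis using walkD(3)[OF M, of "i - ?l"] i 2 by (simp add: nth_append)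
    next
      case 3
      then have "snd ((L @ M) ! i) \<le> ?r" "snd ((L @ M) ! (i + 2)) \<ge> ?r + 1"
        using rL[of i] rM[of "i + 2 - ?l"] i by (simp_all add: nth_append)
      then show ?thesis by auto
    qed
  qed
  moreover have "\<not> adj ((L @ M) ! i) ((L @ M) ! (i + 3))" if i: "i + 3 < length (L @ M)" for i
  proof -
    consider "i + 3 < ?l" | "i \<ge> ?l" | "?l = i + 1" | "?l = i + 2" | "?l = i + 3" by linarith
    then show ?thesis
    proof cases
      case 1 then show ?thesis using walkD(4)[OF L] by (simp add: nth_append)
    next
      case 2
      then have "i - ?l + 3 = i + 3 - ?l" by simp
      then show ?thesis using walkD(4)[OF M, of "i - ?l"] i 2 by (simp add: nth_append)
    next
      case 3
      then have eq: "(L @ M) ! i = last L" "(L @ M) ! (i + 3) = M ! 2" and len: "length M > 2"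
        using i by (simp_all add: nth_append lastL)
      have "M ! 2 \<noteq> M ! 0" using walkD(3)[OF M, of 0] len by (simp add: eval_nat_numeral)
      then show ?thesis
        unfolding eq using rM[of 2] len glue hdM
        by (auto simp: adj_def prod_eq_iff abs_if split: if_splits)
    next
      \<comment> \<open>Two cells on either side of the junction: the only window that needs
        \<open>vert\<close>, which makes the outer cells differ by two rows.\<close>
      case 4
      then have eq: "(L @ M) ! i = L ! i" "(L @ M) ! (i + 3) = M ! 1" "last L = L ! Suc i"
        and len: "length M > 1"
        using i by (simp_all add: nth_append lastL)
      have ns: "new_step (L ! i) (last L)" "new_step (M ! 0) (M ! 1)"
        using walkD(2)[OF L, of i] walkD(2)[OF M, of 0] eq 4 len by simp_all
      have "fst (M ! 1) = fst (M ! 0) \<or> fst (L ! i) = fst (last L)" using vert len 4 by simp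
      moreover have "snd (M ! 0) = ?r + 1" using glue hdM by simp
      ultimately have "snd (M ! 1) = ?r + 2 \<or> snd (L ! i) = ?r - 1"
        using new_step_vertical[OF ns(1)] new_step_vertical[OF ns(2)] by linarith
      then have "snd (M ! 1) - snd (L ! i) \<ge> 2"
        using rL[of i] rM[of 1] 4 len by linarith
      then show ?thesis
        unfolding eq(1,2) by (auto simp: adj_def)
    next
      case 5
      then have eq: "(L @ M) ! i = L ! i" "(L @ M) ! (i + 3) = M ! 0" "last L = L ! (i + 2)"
        using i by (simp_all add: nth_append lastL)
      have "L ! (i + 2) \<noteq> L ! i" using walkD(3)[OF L, of i] 5 by simp
      then show ?thesis
        unfolding eq using rL[of i] 5 glue hdM eq
        by (auto simp: adj_def prod_eq_iff abs_if split: if_splits)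
    qed
  qed
  ultimately show ?thesis using ne by (simp add: walk_def)
qed

section \<open>Symmetries of walks\<close>

lemma walk_map:
  assumes "\<And>c d. new_step c d \<Longrightarrow> new_step (f c) (f d)" "\<And>c d. adj (f c) (f d) \<longleftrightarrow> adj c d" "inj f"
    and "walk L"
  shows "walk (map f L)"
  using assms(4) unfolding walk_def
  by (auto simp: successively_map assms(2) inj_eq[OF assms(3)] intro: successively_mono assms(1))

text \<open>A reflection in a horizontal line also reverses the listing, so that its steps remain upwards.\<close>

lemma walk_rev:
  assumes "\<And>c d. new_step c d \<Longrightarrow> new_step (f d) (f c)" "\<And>c d. adj (f c) (f d) \<longleftrightarrow> adj c d" "inj f"
    and L: "walk L"
  shows "walk (rev (map f L))"
proof -
  let ?n = "length L"
  have nth: "rev (map f L) ! i = f (L ! (?n - Suc i))" if "i < ?n" for i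
    using that by (simp add: rev_nth)
  have "successively new_step (rev (map f L))"
    unfolding successively_rev successively_map
    using walkD(5)[OF L] by (rule successively_mono) (simp add: assms(1))
  moreover have "rev (map f L) ! (i + 2) \<noteq> rev (map f L) ! i" if "i + 2 < ?n" for i
  proof -
    have "?n - Suc i = ?n - Suc (i + 2) + 2" using that by simp
    then have "L ! (?n - Suc i) \<noteq> L ! (?n - Suc (i + 2))"
      using walkD(3)[OF L, of "?n - Suc (i + 2)"] that by simp
    then show ?thesis
      using that nth[of i] nth[of "i + 2"] by (simp add: inj_eq[OF assms(3)])
  qed
  moreover have "\<not> adj (rev (map f L) ! i) (rev (map f L) ! (i + 3))" if "i + 3 < ?n" for i
  proof -
    have "?n - Suc i = ?n - Suc (i + 3) + 3" using that by simp
    then have "\<not> adj (L ! (?n - Suc (i + 3))) (L ! (?n - Suc i))"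
      using walkD(4)[OF L, of "?n - Suc (i + 3)"] that by auto
    then show ?thesis
      using that nth[of i] nth[of "i + 3"] by (auto simp: assms(2) dest: adj_sym)
  qed
  ultimately show ?thesis
    using walkD(1)[OF L] by (simp add: walk_def)
qed

section \<open>Pieces and stackings as listings\<close>

abbreviation up :: "cell \<Rightarrow> cell" where "up c \<equiv> (fst c, snd c + 1)"

lemma mirror_mirror [simp]: "mirror b (mirror b p) = p"
  by (simp add: mirror_def comp_def)

lemma upside_down_upside_down [simp]: "upside_down (upside_down p) = p"
  by (simp add: upside_down_def rev_map[symmetric] comp_def)

lemma walk_mirror [simp]: "walk (mirror b p) \<longleftrightarrow> walk p"
proof -
  have "walk (mirror b p)" if "walk p" for p
    unfolding mirror_def
    by (rule walk_map[OF _ _ _ that]) (auto simp: new_step_def adj_def inj_def prod_eq_iff)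
  then show ?thesis by (metis mirror_mirror)
qed

text \<open>The axis is left open: \<open>r = 0\<close> gives \<open>upside_down\<close>,
  \<open>r = k + 1\<close> reflects a rectangle with \<open>k\<close> rows, and
  \<open>r = snd (last p) + 1\<close> turns a piece over within its own rows if it starts in row
  1.\<close>

lemma walk_flip:
  assumes "walk p"
  shows "walk (rev (map (\<lambda>c. (fst c, r - snd c)) p))"
  by (rule walk_rev[OF _ _ _ assms]) (auto simp: new_step_def adj_def inj_def prod_eq_iff)

lemma walk_upside_down [simp]: "walk (upside_down p) \<longleftrightarrow> walk p"
proof -
  have "walk (upside_down p)" if "walk p" for p
    using walk_flip[OF that, of 0] by (simp add: upside_down_def)
  from this[of p] this[of "upside_down p"] show ?thesis by auto
qed

section \<open>Vertical runs\<close>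

definition vertical :: "cell list \<Rightarrow> bool" where
  "vertical p \<longleftrightarrow> successively (\<lambda>c d. d = up c) p"

lemma vertical_column: "vertical p \<Longrightarrow> c \<in> set p \<Longrightarrow> fst c = fst (hd p)"
  unfolding vertical_def by (induction p) (auto simp: successively_Cons)

lemma vertical_nth: "vertical p \<Longrightarrow> i < length p \<Longrightarrow> p ! i = (fst (hd p), snd (hd p) + int i)"
proof (induction i)
  case 0
  then show ?case by (cases p) auto
next
  case (Suc i)
  then show ?case
    using successively_nth[of "\<lambda>c d. d = up c" p i] by (simp add: vertical_def)
qed

lemma vertical_eq: "vertical p \<Longrightarrow> p = map (\<lambda>i. (fst (hd p), snd (hd p) + int i)) [0..<length p]"
  by (rule nth_equalityI) (simp_all add: vertical_nth)

lemma vertical_map: "vertical (map (\<lambda>i. (x, y + int i)) [0..<m])"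
  by (auto simp: vertical_def successively_conv_nth)

lemma walk_vertical: "vertical p \<Longrightarrow> p \<noteq> [] \<Longrightarrow> walk p"
proof -
  assume p: "vertical p" "p \<noteq> []"
  have "successively new_step p"
    using p(1) unfolding vertical_def by (rule successively_mono) (simp add: new_step_def)
  then show ?thesis
    using p by (auto simp: walk_def vertical_nth adj_def)
qed

lemma constant_column_vertical:
  assumes "walk p" "\<And>c. c \<in> set p \<Longrightarrow> fst c = x"
  shows "vertical p"
  unfolding vertical_def successively_conv_nth
proof (intro allI impI)
  fix i assume i: "Suc i < length p"
  then have "fst (p ! i) = x" "fst (p ! Suc i) = x" using assms(2) by simp_all
  then show "p ! Suc i = up (p ! i)"
    using walkD(2)[OF assms(1) i] by (auto simp: new_step_def)
qed

text \<open>The bound makes the two side columns distinct; for \<open>b = 2\<close> there are no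
  interior columns.\<close>

locale strip =
  fixes b :: nat
  assumes width: "2 \<le> b"
begin

definition side :: "int \<Rightarrow> bool" where "side x \<longleftrightarrow> x = 1 \<or> x = int b"

definition interior :: "int \<Rightarrow> bool" where "interior x \<longleftrightarrow> 1 < x \<and> x < int b"

lemma not_side_interior: "interior x \<Longrightarrow> \<not> side x"
  by (auto simp: side_def interior_def)

lemma side_mirror [simp]: "side (int b + 1 - x) \<longleftrightarrow> side x"
  by (auto simp: side_def)

lemma interior_mirror [simp]: "interior (int b + 1 - x) \<longleftrightarrow> interior x"
  by (auto simp: interior_def)

lemma pillar_iff: "pillar b p \<longleftrightarrow> p \<noteq> [] \<and> side (fst (hd p)) \<and> vertical p"
proof
  assume "pillar b p"
  then obtain x y m where m: "x \<in> {1, int b}" "m \<ge> 1" "p = map (\<lambda>i. (x, y + int i)) [0..<m]"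
    unfolding pillar_def by blast
  then have "[0..<m] \<noteq> []" by simp
  then have "p \<noteq> []" "hd p = (x, y)" using m(2,3) by (simp_all add: hd_map del: upt_eq_Nil_conv)
  then show "p \<noteq> [] \<and> side (fst (hd p)) \<and> vertical p"
    using m vertical_map by (auto simp: side_def)
next
  assume p: "p \<noteq> [] \<and> side (fst (hd p)) \<and> vertical p"
  show "pillar b p"
    unfolding pillar_def
    by (rule bexI[of _ "fst (hd p)"], rule exI[of _ "snd (hd p)"], rule exI[of _ "length p"])
      (use p vertical_eq in \<open>auto simp: side_def Suc_le_eq\<close>)
qed

text \<open>
  The middle argument tells whether the piece has cells other than its end cells: two cells in the
  same side column do not make a bubble.
\<close>

fun end_columns :: "piece \<Rightarrow> int \<Rightarrow> bool \<Rightarrow> int \<Rightarrow> bool" where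
  "end_columns Pillar x m z \<longleftrightarrow> False"
| "end_columns Crossing x m z \<longleftrightarrow> side x \<and> side z \<and> x \<noteq> z"
| "end_columns Bubble x m z \<longleftrightarrow> side x \<and> z = x \<and> m"
| "end_columns Upper_Ending x m z \<longleftrightarrow> side x \<and> interior z"
| "end_columns Lower_Ending x m z \<longleftrightarrow> interior x \<and> side z"

text \<open>A uniform description of every piece except the pillar. Reflections, unique
  decomposition and cutting can then be proved once for all kinds, with the kind entering only
  through \<open>end_columns\<close>.\<close>

definition shape :: "piece \<Rightarrow> cell list \<Rightarrow> bool" where
  "shape X p \<longleftrightarrow> walk p \<and>
     (\<exists>c ys d. p = c # ys @ [d] \<and> (\<forall>e\<in>set ys. interior (fst e)) \<and>
        end_columns X (fst c) (ys \<noteq> []) (fst d))"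

lemma shapeI:
  "walk (c # ys @ [d]) \<Longrightarrow> (\<And>e. e \<in> set ys \<Longrightarrow> interior (fst e)) \<Longrightarrow>
   end_columns X (fst c) (ys \<noteq> []) (fst d) \<Longrightarrow> shape X (c # ys @ [d])"
  unfolding shape_def by blast

lemma shapeE:
  assumes "shape X p"
  obtains c ys d where "p = c # ys @ [d]" "\<And>e. e \<in> set ys \<Longrightarrow> interior (fst e)"
    "end_columns X (fst c) (ys \<noteq> []) (fst d)" "walk (c # ys @ [d])"
  using assms unfolding shape_def by blast

lemma shape_mirror: "shape X (mirror b p) \<longleftrightarrow> shape X p"
proof -
  have "shape X (mirror b p)" if "shape X p" for p
  proof -
    from that obtain c ys d where p: "p = c # ys @ [d]" "\<And>e. e \<in> set ys \<Longrightarrow> interior (fst e)"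
        "end_columns X (fst c) (ys \<noteq> []) (fst d)" "walk (c # ys @ [d])"
      by (rule shapeE) blast
    have "walk (mirror b (c # ys @ [d]))" using p(4) by simp
    then show ?thesis
      unfolding p(1) mirror_def list.map map_append
      by (rule shapeI) (use p(2,3) in \<open>cases X; auto\<close>)+
  qed
  then show ?thesis by (metis mirror_mirror)
qed

fun flip :: "piece \<Rightarrow> piece" where
  "flip Lower_Ending = Upper_Ending"
| "flip Upper_Ending = Lower_Ending"
| "flip X = X"

lemma flip_flip [simp]: "flip (flip X) = X"
  by (cases X) auto

lemma shape_flip:
  assumes "shape X p"
  shows "shape (flip X) (rev (map (\<lambda>c. (fst c, r - snd c)) p))"
proof -
  from assms obtain c ys d where p: "p = c # ys @ [d]" "\<And>e. e \<in> set ys \<Longrightarrow> interior (fst e)"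
      "end_columns X (fst c) (ys \<noteq> []) (fst d)" "walk (c # ys @ [d])"
    by (rule shapeE) blast
  have "walk (rev (map (\<lambda>c. (fst c, r - snd c)) (c # ys @ [d])))"
    by (rule walk_flip) (rule p(4))
  then show ?thesis
    unfolding p(1) list.map map_append rev.simps rev_append append.simps
    by (rule shapeI) (use p(2,3) in \<open>cases X; auto\<close>)+
qed

lemma shape_upside_down: "shape X (upside_down p) \<longleftrightarrow> shape (flip X) p"
  using shape_flip[of X "upside_down p" 0] shape_flip[of "flip X" p 0]
  by (auto simp: upside_down_def rev_map[symmetric] comp_def)

lemma left_crossing_iff: "left_crossing b p \<longleftrightarrow> shape Crossing p \<and> fst (hd p) = 1"
proof
  assume p: "left_crossing b p"
  then have L: "walk p" and col: "\<And>c. c \<in> set p \<Longrightarrow> 1 \<le> fst c \<and> fst c \<le> int b"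
    and c1: "\<And>c. c \<in> set p \<Longrightarrow> fst c = 1 \<longleftrightarrow> c = hd p"
    and cb: "\<And>c. c \<in> set p \<Longrightarrow> fst c = int b \<longleftrightarrow> c = last p"
    unfolding left_crossing_def pds_listing_iff_local by auto
  have p0: "p \<noteq> []" using L by (simp add: walk_def)
  then have ne: "hd p \<noteq> last p" and h1: "fst (hd p) = 1"
    using c1[of "hd p"] cb[of "last p"] width by auto
  then obtain ys where ys: "p = hd p # ys @ [last p]"
    using p0 by (metis append_butlast_last_id last.simps list.collapse)
  then have dist: "hd p \<notin> set ys" "last p \<notin> set ys" "set ys \<subseteq> set p"
    using walk_distinct[OF L]
    by (metis distinct.simps(2) in_set_conv_decomp set_append UnI1,
        metis distinct.simps(2) distinct_append disjoint_iff list.set_intros(1),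
        metis set_subset_Cons set_append Un_upper1 subset_trans)
  have "shape Crossing p"
  proof (subst ys, rule shapeI)
    show "walk (hd p # ys @ [last p])" using L ys by simp
    show "interior (fst e)" if "e \<in> set ys" for e
      using that dist c1[of e] cb[of e] col[of e] by (force simp: interior_def)
    show "end_columns Crossing (fst (hd p)) (ys \<noteq> []) (fst (last p))"
      using h1 cb[of "last p"] p0 width by (auto simp: side_def)
  qed
  with h1 show "shape Crossing p \<and> fst (hd p) = 1" by blast
next
  assume p: "shape Crossing p \<and> fst (hd p) = 1"
  then obtain c ys d where "p = c # ys @ [d]" "\<And>e. e \<in> set ys \<Longrightarrow> interior (fst e)"
      "end_columns Crossing (fst c) (ys \<noteq> []) (fst d)" "walk (c # ys @ [d])"
    by (blast elim: shapeE)
  then show "left_crossing b p"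
    using p width unfolding left_crossing_def pds_listing_iff_local
    by (force simp: side_def interior_def)
qed

lemma left_ending_iff: "left_ending b p \<longleftrightarrow> shape Upper_Ending p \<and> fst (hd p) = 1"
proof
  assume p: "left_ending b p"
  then have L: "walk p" "fst (hd p) = 1" "length p \<ge> 2"
      "\<And>c. c \<in> set (tl p) \<Longrightarrow> interior (fst c)"
    unfolding left_ending_def pds_listing_iff_local interior_def by auto
  then have "tl p \<noteq> []" "p \<noteq> []" by (cases p; auto)+
  then have ys: "p = hd p # butlast (tl p) @ [last (tl p)]" by simp
  have "shape Upper_Ending p"
  proof (subst ys, rule shapeI)
    show "walk (hd p # butlast (tl p) @ [last (tl p)])" using L ys by simp
    show "interior (fst e)" if "e \<in> set (butlast (tl p))" for e
      using L(4) that by (meson in_set_butlastD)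
    show "end_columns Upper_Ending (fst (hd p)) (butlast (tl p) \<noteq> []) (fst (last (tl p)))"
      using L(2,4) \<open>tl p \<noteq> []\<close> by (simp add: side_def)
  qed
  then show "shape Upper_Ending p \<and> fst (hd p) = 1" using L by blast
next
  assume p: "shape Upper_Ending p \<and> fst (hd p) = 1"
  then obtain c ys d where "p = c # ys @ [d]" "\<And>e. e \<in> set ys \<Longrightarrow> interior (fst e)"
      "end_columns Upper_Ending (fst c) (ys \<noteq> []) (fst d)" "walk (c # ys @ [d])"
    by (blast elim: shapeE)
  then show "left_ending b p"
    using p unfolding left_ending_def pds_listing_iff_local
    by (force simp: side_def interior_def)
qed

text \<open>The width is recovered as the largest column met by the middle cells, so quantifying
  over it leaves just an excursion from column 1 through interior columns and back.\<close>

lemma left_bubble_iff: "(\<exists>r. 2 \<le> r \<and> r < b \<and> left_bubble r p) \<longleftrightarrow> shape Bubble p \<and> fst (hd p) = 1"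
proof
  assume "\<exists>r. 2 \<le> r \<and> r < b \<and> left_bubble r p"
  then obtain r where r: "2 \<le> r" "r < b" "left_bubble r p" by blast
  then have L: "walk p" "fst (hd p) = 1" "fst (last p) = 1"
      and mid: "\<forall>c\<in>set p - {hd p, last p}. fst c \<in> {2..int r}"
    unfolding left_bubble_def pds_listing_iff_local by auto
  have L4: "interior (fst c)" if "c \<in> set p" "c \<noteq> hd p" "c \<noteq> last p" for c
    using bspec[OF mid, of c] that r(2) by (simp add: interior_def)
  obtain c where c: "c \<in> set p" "fst c = int r" using r(3) unfolding left_bubble_def by blast
  then have cne: "c \<noteq> hd p" "c \<noteq> last p" using L r by auto
  obtain i where i: "i < length p" "p ! i = c" using c by (metis in_set_conv_nth)
  have p0: "p \<noteq> []" using c by auto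
  with cne i have i3: "0 < i" "i < length p - 1"
    by (metis gr0I hd_conv_nth, metis One_nat_def Suc_pred' last_conv_nth length_greater_0_conv less_antisym)
  define ys where "ys = butlast (tl p)"
  have "tl p \<noteq> []" using i3 by (cases p) auto
  then have ys: "p = hd p # ys @ [last p]"
    using p0 append_butlast_last_id[of "tl p"] by (simp add: ys_def last_tl[symmetric])
  have "distinct (hd p # ys @ [last p])" using walk_distinct[OF L(1)] ys by simp
  then have dist: "hd p \<notin> set ys" "last p \<notin> set ys" by auto
  have sub: "set ys \<subseteq> set p" unfolding ys_def using p0 by (metis in_set_butlastD list.set_sel(2) subsetI)
  have ysne: "ys \<noteq> []" using i3 by (auto simp: ys_def simp flip: length_0_conv)
  have "shape Bubble p"
  proof (subst ys, rule shapeI)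
    show "walk (hd p # ys @ [last p])" using L ys by simp
    show "interior (fst e)" if "e \<in> set ys" for e
      using that dist sub L4[of e] by blast
    show "end_columns Bubble (fst (hd p)) (ys \<noteq> []) (fst (last p))"
      using L ysne by (auto simp: side_def)
  qed
  then show "shape Bubble p \<and> fst (hd p) = 1" using L by blast
next
  assume p: "shape Bubble p \<and> fst (hd p) = 1"
  then obtain c ys d where p': "p = c # ys @ [d]" "\<And>e. e \<in> set ys \<Longrightarrow> interior (fst e)"
      "end_columns Bubble (fst c) (ys \<noteq> []) (fst d)" "walk (c # ys @ [d])"
    by (blast elim: shapeE)
  define R where "R = Max (fst ` set ys)"
  have fin: "finite (fst ` set ys)" "fst ` set ys \<noteq> {}" using p'(3) by auto
  then obtain e where e: "e \<in> set ys" "fst e = R" 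
    using Max_in[OF fin] unfolding R_def by (metis imageE)
  have le: "fst e' \<le> R" if "e' \<in> set ys" for e'
    unfolding R_def using that fin(1) by (intro Max_ge) auto
  have int: "interior R" using e p'(2) by blast
  have "left_bubble (nat R) p"
    using p p' e le int unfolding left_bubble_def pds_listing_iff_local
    by (fastforce simp: interior_def)
  moreover have "2 \<le> nat R" "nat R < b" using int by (auto simp: interior_def)
  ultimately show "\<exists>r. 2 \<le> r \<and> r < b \<and> left_bubble r p" by blast
qed

lemma hd_mirror: "p \<noteq> [] \<Longrightarrow> fst (hd (mirror b p)) = int b + 1 - fst (hd p)"
  by (simp add: mirror_def hd_map)

lemma shape_nonempty: "shape X p \<Longrightarrow> p \<noteq> []"
  by (auto elim: shapeE)

lemma shape_hd_side:
  "shape X p \<Longrightarrow> X \<noteq> Lower_Ending \<Longrightarrow> side (fst (hd p))"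
  by (erule shapeE) (cases X; auto)

lemma mirror_cases:
  assumes "\<And>p. Q p \<longleftrightarrow> shape X p \<and> fst (hd p) = 1" "X \<noteq> Lower_Ending"
  shows "Q p \<or> Q (mirror b p) \<longleftrightarrow> shape X p"
  using shape_hd_side[of X p] assms(2) shape_nonempty[of X p] hd_mirror[of p]
  unfolding assms(1) shape_mirror by (auto simp: side_def)

theorem is_piece_iff:
  assumes "X \<noteq> Pillar"
  shows "is_piece b X p \<longleftrightarrow> shape X p"
proof (cases X)
  case Bubble
  then have "is_piece b X p \<longleftrightarrow> (\<exists>r. 2 \<le> r \<and> r < b \<and> left_bubble r p) \<or>
      (\<exists>r. 2 \<le> r \<and> r < b \<and> left_bubble r (mirror b p))" by auto
  also have "\<dots> \<longleftrightarrow> shape X p"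
    unfolding Bubble by (rule mirror_cases) (simp_all add: left_bubble_iff)
  finally show ?thesis .
next
  case Lower_Ending
  have "left_ending b (upside_down p) \<or> left_ending b (mirror b (upside_down p)) \<longleftrightarrow>
      shape Upper_Ending (upside_down p)"
    by (rule mirror_cases) (simp_all add: left_ending_iff)
  then show ?thesis by (simp add: Lower_Ending shape_upside_down)
qed (use assms mirror_cases[of "left_crossing b" Crossing] left_crossing_iff
      mirror_cases[of "left_ending b" Upper_Ending] left_ending_iff in auto)

section \<open>Stacks built on a given cell\<close>

lemma piece_listing: "is_piece b X p \<Longrightarrow> walk p"
  by (cases "X = Pillar") (auto simp: is_piece_iff shape_def pillar_iff walk_vertical)

lemma piece_nonempty: "is_piece b X p \<Longrightarrow> p \<noteq> []"
  using piece_listing walkD(1) by blast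

text \<open>Recursive form of \<open>stacking\<close> that carries the cell on which the next piece
  must start. Inductions need this cell, because the side and the row of the remaining stack depend
  on the piece below.\<close>

fun stk :: "cell \<Rightarrow> piece list \<Rightarrow> cell list list \<Rightarrow> bool" where
  "stk c [] [] \<longleftrightarrow> True"
| "stk c (X # w) (p # ps) \<longleftrightarrow> is_piece b X p \<and> hd p = c \<and> stk (up (last p)) w ps"
| "stk c _ _ \<longleftrightarrow> False"

lemma stk_ConsE:
  assumes "stk c (X # w) ps"
  obtains p ps' where "ps = p # ps'" "is_piece b X p" "hd p = c" "stk (up (last p)) w ps'"
  using assms by (cases ps) auto

lemma stk_Nil [simp]: "stk c [] ps \<longleftrightarrow> ps = []" "stk c w [] \<longleftrightarrow> w = []"
  by (cases ps; simp) (cases w; simp)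

lemma stk_hd: "stk c w ps \<Longrightarrow> w \<noteq> [] \<Longrightarrow> concat ps \<noteq> [] \<and> hd (concat ps) = c"
  using piece_nonempty by (cases w; cases ps) auto

lemma stacking_iff_stk: "w \<noteq> [] \<Longrightarrow> stacking b w ps \<longleftrightarrow> stk (hd (concat ps)) w ps"
proof (induction w arbitrary: ps)
  case (Cons X w)
  show ?case
  proof (cases ps)
    case Nil
    then show ?thesis by (simp add: stacking_def)
  next
    case (Cons p ps')
    have st: "stacking b (X # w) ps \<longleftrightarrow> is_piece b X p \<and> stacking b w ps' \<and>
        (ps' = [] \<or> hd (hd ps') = up (last p))"
      unfolding Cons stacking_def by (auto simp: successively_Cons)
    show ?thesis
    proof (cases "w = []")
      case True
      then show ?thesis
        using Cons st piece_nonempty[of X p] by (auto simp: stacking_def)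
    next
      case False
      have *: "stk (hd (concat ps')) w ps' \<Longrightarrow> ps' \<noteq> [] \<and> hd (concat ps') = hd (hd ps')"
        using False piece_nonempty by (cases w; cases ps') auto
      have **: "stk d w ps' \<Longrightarrow> hd (hd ps') = d" for d
        using False by (cases w; cases ps') auto
      show ?thesis
        unfolding st Cons.IH[OF False] unfolding Cons
        using * **[of "up (last p)"] piece_nonempty[of X p] stk_hd[of "up (last p)" w ps'] False
        by (auto simp: hd_append)
    qed
  qed
qed simp

text \<open>Alternation with pillars is what puts two vertical steps between an arrival at a side
  column and the next departure.\<close>

definition alternating :: "piece list \<Rightarrow> bool" where
  "alternating w \<longleftrightarrow> successively (\<lambda>X Y. (X = Pillar) \<noteq> (Y = Pillar)) w"

lemma alternating_Cons:
  "alternating (X # w) \<longleftrightarrow> w = [] \<or> (X = Pillar) \<noteq> (hd w = Pillar) \<and> alternating w"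
  by (simp add: alternating_def successively_Cons)

lemma alternating_ConsD: "alternating (X # w) \<Longrightarrow> alternating w"
  by (auto simp: alternating_def successively_Cons)

text \<open>A pillar of one cell has no step of its own; the second cell of the stack is then the
  start of the next piece, which lies directly above.\<close>

lemma pillar_vertical_start:
  assumes "stk c (Pillar # w) ps" "length (concat ps) \<ge> 2"
  shows "concat ps ! 1 = up (concat ps ! 0)"
  using assms(1)
proof (rule stk_ConsE)
  fix p ps' assume p: "ps = p # ps'" "is_piece b Pillar p" "hd p = c" "stk (up (last p)) w ps'"
  then have v: "p \<noteq> []" "vertical p" by (auto simp: pillar_iff)
  show ?thesis
  proof (cases "length p = 1")
    case True
    then obtain d where d: "p = [d]" by (auto simp: length_Suc_conv)
    then have "length (concat ps') \<ge> 1" using assms(2) p by simp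
    then have ne: "concat ps' \<noteq> []" by (metis list.size(3) not_one_le_zero)
    then have "w \<noteq> []" using p(4) by (cases ps') auto
    with stk_hd[OF p(4)] show ?thesis using p d hd_conv_nth[OF ne] by simp
  next
    case False
    then have "length p \<ge> 2" using v by (cases p) (auto simp: Suc_le_eq)
    then show ?thesis
      using v p successively_nth[of "\<lambda>c d. d = up c" p 0] by (auto simp: nth_append vertical_def)
  qed
qed

text \<open>At each junction one of the two neighbouring pieces is a pillar, and it supplies the
  vertical step required by \<open>walk_append\<close>.\<close>

lemma stacking_walk:
  assumes "stk c w ps" "alternating w" "w \<noteq> []"
  shows "walk (concat ps)"
  using assms
proof (induction w arbitrary: c ps)
  case (Cons X w)
  from Cons.prems(1) obtain p ps' where p: "ps = p # ps'" "is_piece b X p" "hd p = c"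
      "stk (up (last p)) w ps'"
    by (rule stk_ConsE)
  have Lp: "walk p" using piece_listing p(2) .
  show ?case
  proof (cases "w = []")
    case True
    then show ?thesis using p Lp by simp
  next
    case False
    have alt: "(X = Pillar) \<noteq> (hd w = Pillar)" "alternating w"
      using Cons.prems(2) False by (auto simp: alternating_Cons)
    have M: "walk (concat ps')" using Cons.IH[OF p(4) alt(2) False] .
    have "walk (p @ concat ps')"
    proof (rule walk_append[OF Lp M])
      show "hd (concat ps') = up (last p)" using stk_hd[OF p(4) False] by blast
      show "length p = 1 \<or> length (concat ps') = 1 \<or> fst (concat ps' ! 1) = fst (concat ps' ! 0) \<or>
          fst (p ! (length p - 2)) = fst (last p)"
      proof (cases "X = Pillar")
        case True
        then have "p \<noteq> []" "vertical p" using p(2) by (auto simp: pillar_iff)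
        then show ?thesis
          using vertical_column[of p "p ! (length p - 2)"] vertical_column[of p "last p"]
          by (auto simp: Suc_le_eq)
      next
        case False
        then obtain w' where w: "w = Pillar # w'"
          using alt \<open>w \<noteq> []\<close> by (cases w) auto
        show ?thesis
        proof (cases "length (concat ps') \<ge> 2")
          case True
          have "concat ps' ! 1 = up (concat ps' ! 0)"
            using pillar_vertical_start[OF p(4)[unfolded w] True] .
          then show ?thesis by simp
        next
          case False
          have "concat ps' \<noteq> []" using stk_hd[OF p(4) \<open>w \<noteq> []\<close>] by blast
          then have "length (concat ps') \<noteq> 0" by blast
          with False have "length (concat ps') = 1" by linarith
          then show ?thesis by blast
        qed
      qed
    qed
    then show ?thesis using p by simp
  qed
qed simp

subsection \<open>A stacking is determined by its cells\<close>

lemma end_columns_unique: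
  "end_columns X x m z \<Longrightarrow> end_columns Y x m' z \<Longrightarrow> X = Y"
  using not_side_interior by (cases X; cases Y) auto

text \<open>If \<open>p'\<close> were longer, the last cell of \<open>p\<close> would be a middle
  cell of \<open>p'\<close>, hence interior; but only an upper ending stops in the interior, and
  nothing follows that one.\<close>

lemma shape_prefix_unique:
  assumes "shape X p" "shape Y p'" "p @ r = p' @ r'" "length p \<le> length p'"
    and "X = Upper_Ending \<Longrightarrow> r = []"
  shows "p = p' \<and> X = Y"
proof -
  obtain s where s: "p' = p @ s" "r = s @ r'"
    using assms(3,4) by (auto simp: append_eq_append_conv2)
  obtain c ys d where p: "p = c # ys @ [d]" "end_columns X (fst c) (ys \<noteq> []) (fst d)"
    using assms(1) by (auto elim: shapeE)
  obtain c' ys' d' where p': "p' = c' # ys' @ [d']" "\<And>e. e \<in> set ys' \<Longrightarrow> interior (fst e)"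
      "end_columns Y (fst c') (ys' \<noteq> []) (fst d')"
    using assms(2) by (rule shapeE) blast
  have "s = []"
  proof (rule ccontr)
    assume "s \<noteq> []"
    then obtain s' e where "s = s' @ [e]" by (metis append_butlast_last_id)
    with s(1) p(1) p'(1) have "d \<in> set ys'" by auto
    with p'(2) have "interior (fst d)" by blast
    with p(2) have "X = Upper_Ending" using not_side_interior by (cases X) auto
    with assms(5) s \<open>s \<noteq> []\<close> show False by simp
  qed
  then have "p = p'" using s by simp
  moreover from this p p' have "X = Y" using end_columns_unique by auto
  ultimately show ?thesis ..
qed

text \<open>This separates the other pieces from pillars, whose stacks begin with a step up. For a
  bubble it holds because its middle is nonempty.\<close>

lemma shape_horizontal_start:
  assumes "shape X p" "X \<noteq> Lower_Ending"
  shows "length p \<ge> 2" "fst (p ! 1) \<noteq> fst (p ! 0)" "side (fst (p ! 0))"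
proof -
  obtain c ys d where p: "p = c # ys @ [d]" "\<And>e. e \<in> set ys \<Longrightarrow> interior (fst e)"
      "end_columns X (fst c) (ys \<noteq> []) (fst d)"
    using assms(1) by (rule shapeE) blast
  show "length p \<ge> 2" "side (fst (p ! 0))" using p assms(2) by (cases X; auto)+
  show "fst (p ! 1) \<noteq> fst (p ! 0)"
  proof (cases ys)
    case Nil
    then show ?thesis using p assms(2) not_side_interior[of "fst d"] by (cases X) auto
  next
    case (Cons e ys')
    then have "interior (fst e)" "side (fst c)" using p assms(2) by (cases X; auto)+
    then show ?thesis using p(1) Cons not_side_interior by auto
  qed
qed

text \<open>By alternation the next piece would be a pillar, which stands in a side column, while an
  ending stops in the interior.\<close>

lemma upper_ending_last:
  assumes "stk c (Upper_Ending # w) ps" "alternating (Upper_Ending # w)"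
  shows "w = []"
  using assms(1)
proof (rule stk_ConsE)
  fix p ps' assume p: "is_piece b Upper_Ending p" "stk (up (last p)) w ps'"
  show "w = []"
  proof (rule ccontr)
    assume "w \<noteq> []"
    then obtain w' where w: "w = Pillar # w'" using assms(2) by (cases w) (auto simp: alternating_Cons)
    have "side (fst (last p))" using p(2) unfolding w
      by (rule stk_ConsE) (auto simp: pillar_iff)
    moreover have "interior (fst (last p))"
      using p(1) is_piece_iff[of Upper_Ending p] by (auto elim: shapeE)
    ultimately show False using not_side_interior by blast
  qed
qed

lemma nonpillar_after_pillar:
  assumes "is_piece b Pillar p" "stk (up (last p)) (X # w) ps" "X \<noteq> Pillar"
  shows "length (concat ps) \<ge> 2 \<and> fst (concat ps ! 0) = fst (hd p) \<and> fst (concat ps ! 1) \<noteq> fst (hd p)"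
  using assms(2)
proof (rule stk_ConsE)
  fix p' ps' assume p': "ps = p' # ps'" "is_piece b X p'" "hd p' = up (last p)"
  have v: "p \<noteq> []" "side (fst (hd p))" "vertical p" using assms(1) by (auto simp: pillar_iff)
  then have f: "fst (hd p') = fst (hd p)" using p'(3) vertical_column[of p "last p"] by simp
  have sh: "shape X p'" using p'(2) assms(3) by (simp add: is_piece_iff)
  moreover have "X \<noteq> Lower_Ending"
    using sh f v(2) not_side_interior by (auto elim!: shapeE)
  ultimately show ?thesis
    using shape_horizontal_start[of X p'] f shape_nonempty[OF sh] p'(1)
    by (auto simp: nth_append hd_conv_nth)
qed

text \<open>The cells show where a pillar stops: the piece above it has one more cell in the same
  column and then steps sideways. A longer pillar would have to contain, or be continued by, that
  sideways step.\<close>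

lemma pillar_prefix_le:
  assumes p: "is_piece b Pillar p" "stk (up (last p)) w ps"
    and p': "is_piece b Pillar p'" "stk (up (last p')) w' ps'"
    and alt: "alternating (Pillar # w)" and eq: "p @ concat ps = p' @ concat ps'"
    and le: "length p \<le> length p'"
  shows "p = p'"
proof -
  obtain s where s: "p' = p @ s" "concat ps = s @ concat ps'"
    using eq le by (auto simp: append_eq_append_conv2)
  have v: "p \<noteq> []" "vertical p'" "p' \<noteq> []" using p p' by (auto simp: pillar_iff)
  have "s = []"
  proof (rule ccontr)
    assume sne: "s \<noteq> []"
    then have "w \<noteq> []" using s(2) p(2) by auto
    then obtain X w1 where w: "w = X # w1" "X \<noteq> Pillar"
      using alt by (cases w) (auto simp: alternating_Cons)
    have N: "length (concat ps) \<ge> 2" "fst (concat ps ! 1) \<noteq> fst (hd p)"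
      using nonpillar_after_pillar[OF p(1) p(2)[unfolded w(1)] w(2)] by auto
    have hd: "hd p = hd p'" using s v by simp
    have last: "fst (last p') = fst (hd p')" using vertical_column[OF v(2), of "last p'"] v(3) by simp
    show False
    proof (cases "length s = 1")
      \<comment> \<open>With just one extra cell, \<open>p'\<close> ends at the first cell of the
        piece above \<open>p\<close>. The sideways step would then be the junction above
        \<open>p'\<close>, which goes straight up.\<close>
      case True
      then obtain e where e: "s = [e]" by (auto simp: length_Suc_conv)
      then have "length (concat ps') \<ge> 1" using N(1) s(2) by simp
      then have ne: "concat ps' \<noteq> []" by (metis list.size(3) not_one_le_zero)
      then have "w' \<noteq> []" using p'(2) by (cases ps') auto
      then have "hd (concat ps') = up (last p')" using stk_hd[OF p'(2)] by blast
      then have "concat ps ! 1 = up (last p')" using s(2) e ne by (simp add: hd_conv_nth)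
      then show False using N(2) last hd by simp
    next
      case False
      then have l: "length s \<ge> 2" using sne by (cases s) (auto simp: Suc_le_eq)
      then have "concat ps ! 1 = s ! 1" using s(2) by (simp add: nth_append)
      moreover have "s ! 1 \<in> set p'" using l s(1) by simp
      ultimately show False using N(2) vertical_column[OF v(2)] hd by metis
    qed
  qed
  then show ?thesis using s by simp
qed

text \<open>The first piece can be read off from the cells: the first step tells pillars from other
  pieces, and \<open>pillar_prefix_le\<close> or \<open>shape_prefix_unique\<close> then fixes its
  extent. The rest follows by induction from the cell above it.\<close>

theorem stacking_unique:
  assumes "stk c w ps" "stk c w' ps'" "alternating w" "alternating w'" "concat ps = concat ps'"
  shows "w = w' \<and> ps = ps'"
  using assms
proof (induction w arbitrary: c w' ps ps')
  case Nil
  then have "w' = []" using stk_hd[OF Nil.prems(2)] by auto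
  with Nil show ?case by simp
next
  case (Cons X w)
  have "w' \<noteq> []" using stk_hd[OF Cons.prems(1)] Cons.prems(2,5) by auto
  then obtain Y v where w': "w' = Y # v" by (cases w') auto
  from Cons.prems(1) obtain p qs where p: "ps = p # qs" "is_piece b X p" "hd p = c"
      "stk (up (last p)) w qs"
    by (rule stk_ConsE)
  from Cons.prems(2)[unfolded w'] obtain p' qs' where p': "ps' = p' # qs'" "is_piece b Y p'"
      "hd p' = c" "stk (up (last p')) v qs'"
    by (rule stk_ConsE)
  have eq: "p @ concat qs = p' @ concat qs'" using Cons.prems(5) p p' by simp
  have alt: "alternating (X # w)" "alternating (Y # v)"
    using Cons.prems(3,4) w' by auto
  \<comment> \<open>A stack on a pillar begins upwards, while any other piece starting in a side
    column begins sideways.\<close>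
  have nomix: False
    if "is_piece b Pillar p" "stk (up (last p)) w qs" "stk c (Pillar # w) ps" "is_piece b Y p'" "Y \<noteq> Pillar"
      "hd p = c" "hd p' = c" "concat ps = p' @ concat qs'" for p p' Y w qs qs' ps
  proof -
    have sh: "shape Y p'" using that(4,5) by (simp add: is_piece_iff)
    have "Y \<noteq> Lower_Ending"
      using sh that(1,6,7) not_side_interior by (auto elim!: shapeE simp: pillar_iff)
    note H = shape_horizontal_start[OF sh this]
    have "length (concat ps) \<ge> 2" using that(8) H(1) by simp
    then have "concat ps ! 1 = up (concat ps ! 0)"
      using pillar_vertical_start[OF that(3)] by blast
    then show False using H(1,2) that(8) by (simp add: nth_append split: if_splits)
  qed
  have "X = Y \<and> p = p'"
  proof (cases "X = Pillar")
    case True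
    then have Y: "Y = Pillar"
      using nomix[of p w qs ps Y p' qs'] p p' Cons.prems(1) eq by auto
    have "p = p'"
    proof (cases "length p \<le> length p'")
      case True
      then show ?thesis
        using pillar_prefix_le[of p w qs p' v qs'] p p' \<open>X = Pillar\<close> Y alt eq by auto
    next
      case False
      then show ?thesis
        using pillar_prefix_le[of p' v qs' p w qs] p p' \<open>X = Pillar\<close> Y alt eq by auto
    qed
    with True Y show ?thesis by simp
  next
    case False
    have Y: "Y \<noteq> Pillar"
      using nomix[of p' v qs' ps' X p qs] p p' Cons.prems(2) w' eq False by auto
    have sh: "shape X p" "shape Y p'" using p p' False Y by (simp_all add: is_piece_iff)
    have UE: "X = Upper_Ending \<Longrightarrow> concat qs = []" "Y = Upper_Ending \<Longrightarrow> concat qs' = []"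
      using upper_ending_last[of c w ps] upper_ending_last[of c v ps'] Cons.prems(1,2) alt p p' w' by auto
    show ?thesis
    proof (cases "length p \<le> length p'")
      case True
      then show ?thesis using shape_prefix_unique[OF sh eq True UE(1)] by blast
    next
      case False
      then show ?thesis using shape_prefix_unique[OF sh(2,1) eq[symmetric] _ UE(2)] by auto
    qed
  qed
  then have XY: "X = Y" "p = p'" by auto
  then have "w = v \<and> qs = qs'"
    using Cons.IH[of "up (last p)" qs v qs'] p p' eq alt alternating_ConsD XY by auto
  then show ?case using XY p p' w' by simp
qed

subsection \<open>Every snake touching both sides is a stacking\<close>

definition in_strip :: "cell list \<Rightarrow> bool" where
  "in_strip L \<longleftrightarrow> (\<forall>c\<in>set L. 1 \<le> fst c \<and> fst c \<le> int b)"

lemma in_strip_simps [simp]: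
  "in_strip []" "in_strip (c # L) \<longleftrightarrow> 1 \<le> fst c \<and> fst c \<le> int b \<and> in_strip L"
  "in_strip (L @ M) \<longleftrightarrow> in_strip L \<and> in_strip M"
  by (auto simp: in_strip_def)

lemma interior_iff: "1 \<le> x \<Longrightarrow> x \<le> int b \<Longrightarrow> interior x \<longleftrightarrow> \<not> side x"
  by (auto simp: interior_def side_def)

text \<open>The last cell \<open>v\<close> of the initial vertical run is kept apart from
  \<open>V\<close>: the run without it becomes the pillar, while \<open>v\<close> is already the
  first cell of the next piece.\<close>

lemma vertical_split:
  assumes "walk L" "\<not> vertical L"
  obtains V v g rest where "L = V @ v # g # rest" "vertical (V @ [v])" "fst g \<noteq> fst v"
proof -
  have "\<exists>c\<in>set L. fst c \<noteq> fst (hd L)"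
    using constant_column_vertical[OF assms(1)] assms(2) by blast
  from split_list_first_prop[OF this] obtain ys g zs where L: "L = ys @ g # zs"
      "fst g \<noteq> fst (hd L)" "\<forall>c\<in>set ys. fst c = fst (hd L)" by auto
  have "ys \<noteq> []" using L by auto
  then obtain V v where ys: "ys = V @ [v]" by (metis append_butlast_last_id)
  have "vertical ys"
    using constant_column_vertical[OF walk_appendD1] assms(1) L \<open>ys \<noteq> []\<close> by metis
  then show ?thesis using that[of V v g zs] L ys by simp
qed

lemma vertical_snoc: "vertical (V @ [v]) \<Longrightarrow> vertical V \<and> (V \<noteq> [] \<longrightarrow> v = up (last V))"
  by (auto simp: vertical_def successively_append_iff)

text \<open>A side column has only one neighbouring column inside the strip, so horizontal arrival
  at it and horizontal departure from it use the same column.\<close>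

lemma side_neighbour_unique:
  assumes "side (fst d)" "1 \<le> x" "x \<le> int b" "1 \<le> y" "y \<le> int b"
    "\<bar>x - fst d\<bar> = 1" "\<bar>y - fst d\<bar> = 1"
  shows "x = y"
  using assms by (auto simp: side_def)

text \<open>Having reached a side column horizontally, the walk cannot go on (the strip ends) or
  back (no step is undone), so it climbs. It must climb a second time before leaving, and the cells
  in between form a nonempty pillar.\<close>

lemma after_arrival:
  assumes L: "walk (f # d # zs)" and strip: "in_strip (f # d # zs)"
    and fd: "fst f \<noteq> fst d" "side (fst d)" and "zs \<noteq> []"
  obtains "is_piece b Pillar zs" "hd zs = up d"
  | V v g rest where "zs = V @ v # g # rest" "is_piece b Pillar V" "hd V = up d"
      "v = up (last V)" "fst g \<noteq> fst v" "side (fst v)"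
proof -
  obtain e zs' where zs: "zs = e # zs'" using assms(5) by (cases zs) auto
  have nfd: "new_step f d" "new_step d e" "e \<noteq> f"
    using walkD(2)[OF L, of 0] walkD(2)[OF L, of 1] walkD(3)[OF L, of 0] zs
    by (simp_all add: eval_nat_numeral)
  have f: "\<bar>fst f - fst d\<bar> = 1" "snd f = snd d" using nfd(1) fd(1) by (auto simp: new_step_def)
  have e: "e = up d"
  proof (rule ccontr)
    assume "e \<noteq> up d"
    then have e: "\<bar>fst e - fst d\<bar> = 1" "snd e = snd d" using nfd(2) by (auto simp: new_step_def)
    then have "fst e = fst f"
      using side_neighbour_unique[of d "fst e" "fst f"] strip zs fd f by auto
    with e f nfd(3) show False by (simp add: prod_eq_iff)
  qed
  have Lzs: "walk zs"
    using walk_ConsD[OF walk_ConsD[OF L]] assms(5) by simp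
  show ?thesis
  proof (cases "vertical zs")
    case True
    then show ?thesis using that(1) fd(2) e zs by (simp add: pillar_iff)
  next
    case False
    then obtain V v g rest where V: "zs = V @ v # g # rest" "vertical (V @ [v])" "fst g \<noteq> fst v"
      using vertical_split[OF Lzs] by blast
    \<comment> \<open>An empty pillar would mean leaving from the cell just above \<open>d\<close>,
      so that \<open>g\<close> lies on top of \<open>f\<close>: the forbidden unit square.\<close>
    have "V \<noteq> []"
    proof
      assume "V = []"
      then have vg: "zs = v # g # rest" "v = up d" using V zs e by auto
      have "new_step v g" "\<not> adj f g"
        using walkD(2)[OF L, of 2] walkD(4)[OF L, of 0] vg by (simp_all add: eval_nat_numeral)
      then have g: "\<bar>fst g - fst d\<bar> = 1" "snd g = snd d + 1"
        using V(3) vg by (auto simp: new_step_def)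
      then have "fst g = fst f"
        using side_neighbour_unique[of d "fst g" "fst f"] strip vg fd f by auto
      with g f \<open>\<not> adj f g\<close> show False by (simp add: adj_def)
    qed
    moreover from this have "hd V = up d" using V(1) zs e by (cases V) auto
    moreover have "vertical V" "v = up (last V)" using vertical_snoc[OF V(2)] \<open>V \<noteq> []\<close> by auto
    moreover from this have "fst v = fst (hd V)"
      using vertical_column[of V "last V"] \<open>V \<noteq> []\<close> by simp
    ultimately show ?thesis using that(2)[of V v g rest] V fd(2) by (simp add: pillar_iff)
  qed
qed

section \<open>Cutting a walk at its visits to the side columns\<close>

definition inter :: "piece list \<Rightarrow> piece list" where
  "inter xs = concat (map (\<lambda>x. [Pillar, x]) xs)"

lemma inter_simps [simp]:
  "inter [] = []" "inter (x # xs) = Pillar # x # inter xs" "inter (xs @ ys) = inter xs @ inter ys"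
  by (simp_all add: inter_def)

lemma set_inter: "set (inter xs) = (if xs = [] then {} else insert Pillar (set xs))"
  by (induction xs) auto

text \<open>The part of a word from its lowest crossing or bubble upwards. No crossing is demanded
  yet, as a cut that starts midway need not meet one.\<close>

definition core :: "piece list set" where
  "core = {x # inter xs @ u | x xs u. set (x # xs) \<subseteq> {Crossing, Bubble} \<and> u \<in> upper}"

lemma arrival_step:
  assumes "walk (c # ys @ d # zs)" "\<And>e. e \<in> set ys \<Longrightarrow> interior (fst e)" "side (fst d)"
    "ys = [] \<Longrightarrow> fst c \<noteq> fst d" "in_strip (c # ys @ d # zs)"
  obtains f where "walk (f # d # zs)" "fst f \<noteq> fst d" "in_strip (f # d # zs)"
proof -
  define f where "f = last (c # ys)"
  have "c # ys = butlast (c # ys) @ [f]" unfolding f_def by (metis append_butlast_last_id list.discI)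
  then have "walk ((butlast (c # ys) @ [f]) @ d # zs)" using assms(1) by (metis append_Cons)
  then have "walk (f # d # zs)"
    using walk_appendD2[of "butlast (c # ys)" "f # d # zs"] by simp
  moreover have "fst f \<noteq> fst d"
    using assms(2)[of "last ys"] assms(3,4) not_side_interior by (auto simp: f_def)
  moreover have "in_strip (f # d # zs)"
    using assms(5) unfolding f_def by (auto simp: in_strip_def)
  ultimately show ?thesis using that by blast
qed

text \<open>Cut at the next cell in a side column: the part up to it is a bubble or a crossing,
  according to the side reached, and \<open>after_arrival\<close> yields a pillar and a shorter walk
  that again leaves a side column horizontally. If no such cell remains, the whole walk is an upper
  ending.\<close>

lemma cover_from_side:
  assumes "walk (c # e # L)" "in_strip (c # e # L)" "side (fst c)" "fst e \<noteq> fst c"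
  shows "\<exists>w ps. stk c w ps \<and> concat ps = c # e # L \<and> (w = [Upper_Ending] \<or> w \<in> core)"
  using assms
proof (induction "length L" arbitrary: c e L rule: less_induct)
  case less
  note loc = less.prems(1) and strip = less.prems(2)
  show ?case
  proof (cases "\<exists>d\<in>set (e # L). side (fst d)")
    case False
    define M where "M = butlast (e # L)"
    have eq: "c # e # L = c # M @ [last (e # L)]"
      unfolding M_def by (simp only: append_butlast_last_id list.discI not_False_eq_True)
    have int: "interior (fst d)" if "d \<in> set (e # L)" for d
      using that False strip interior_iff[of "fst d"] by (auto simp: in_strip_def)
    have "shape Upper_Ending (c # e # L)"
      unfolding eq
    proof (rule shapeI)
      show "walk (c # M @ [last (e # L)])" using loc eq by simp
      show "interior (fst d)" if "d \<in> set M" for d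
        using int that unfolding M_def by (meson in_set_butlastD)
      show "end_columns Upper_Ending (fst c) (M \<noteq> []) (fst (last (e # L)))"
        using less.prems(3) int[of "last (e # L)"] by simp
    qed
    then have "is_piece b Upper_Ending (c # e # L)" using is_piece_iff[of Upper_Ending] by blast
    then have "stk c [Upper_Ending] [c # e # L]" by simp
    then show ?thesis by (metis append_Nil2 concat.simps)
  next
    case True
    from split_list_first_prop[OF this] obtain ys d zs where
      sp: "e # L = ys @ d # zs" "side (fst d)" "\<forall>d\<in>set ys. \<not> side (fst d)" by blast
    have int: "interior (fst d)" if "d \<in> set ys" for d
    proof -
      have "d \<in> set (e # L)" using that sp(1) by simp
      then show ?thesis
        using that sp(3) strip interior_iff[of "fst d"] by (auto simp: in_strip_def)
    qed
    define X where "X = (if fst d = fst c then Bubble else Crossing)"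
    have ysne: "ys \<noteq> []" if "fst d = fst c" using that less.prems(4) sp by auto
    have XX: "X \<in> {Crossing, Bubble}" "X \<noteq> Pillar" by (auto simp: X_def)
    have loc': "walk (c # ys @ d # zs)" using loc sp by simp
    then have "walk (c # ys @ [d])"
      using walk_appendD1[of "c # ys @ [d]" zs] by simp
    then have "shape X (c # ys @ [d])"
      by (rule shapeI) (use int less.prems(3) sp ysne in \<open>auto simp: X_def\<close>)
    then have p: "is_piece b X (c # ys @ [d])" using XX is_piece_iff by simp
    have strip': "in_strip (c # ys @ d # zs)" using strip sp(1) by (metis in_strip_simps(2))
    show ?thesis
    proof (cases "zs = []")
      case True
      have "stk c [X] [c # ys @ [d]]" using p by simp
      moreover have "[X] \<in> core" unfolding core_def using XX
        by (intro CollectI exI[of _ X] exI[of _ "[]"] conjI) (auto simp: upper_def)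
      ultimately show ?thesis using True sp by (metis append_Nil2 concat.simps)
    next
      case zs: False
      obtain f where f: "walk (f # d # zs)" "fst f \<noteq> fst d" "in_strip (f # d # zs)"
        by (rule arrival_step[OF loc' int sp(2) _ strip']) (use ysne in auto)
      show ?thesis
        using f(1,3,2) sp(2) zs
      proof (cases rule: after_arrival)
        case 1
        have "stk c [X, Pillar] [c # ys @ [d], zs]" using p 1 by simp
        moreover have "[X, Pillar] \<in> core" unfolding core_def using XX
          by (intro CollectI exI[of _ X] exI[of _ "[]"] exI[of _ "[Pillar]"] conjI)
            (auto simp: upper_def)
        moreover have "concat [c # ys @ [d], zs] = c # e # L" using sp by simp
        ultimately show ?thesis by metis
      next
        case (2 V v g rest)
        have "walk (v # g # rest)"
          using walk_appendD2[of "f # d # V" "v # g # rest"] f(1) 2(1) by simp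
        moreover have "in_strip (v # g # rest)" using f(3) 2(1) by simp
        moreover have "length rest < length L"
        proof -
          have "length (e # L) = length (ys @ d # zs)" using sp(1) by simp
          then show ?thesis using 2(1) by simp
        qed
        ultimately obtain w ps where IH: "stk v w ps" "concat ps = v # g # rest"
            "w = [Upper_Ending] \<or> w \<in> core"
          using less.hyps[of rest v g] 2 by blast
        have "stk c (X # Pillar # w) ((c # ys @ [d]) # V # ps)" using p 2 IH by simp
        moreover have "concat ((c # ys @ [d]) # V # ps) = c # e # L" using sp 2 IH by simp
        moreover have "X # Pillar # w \<in> core"
          using IH(3)
        proof
          assume "w = [Upper_Ending]"
          then show ?thesis unfolding core_def using XX
            by (intro CollectI exI[of _ X] exI[of _ "[]"] exI[of _ "[Pillar, Upper_Ending]"] conjI)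
              (auto simp: upper_def)
        next
          assume "w \<in> core"
          then obtain y xs u where w: "w = y # inter xs @ u" "set (y # xs) \<subseteq> {Crossing, Bubble}"
              "u \<in> upper" unfolding core_def by blast
          then show ?thesis unfolding core_def using XX
            by (intro CollectI exI[of _ X] exI[of _ "y # xs"] exI[of _ u] conjI) auto
        qed
        ultimately show ?thesis by metis
      qed
    qed
  qed
qed

lemma piece_hd_side: "is_piece b X p \<Longrightarrow> X \<noteq> Lower_Ending \<Longrightarrow> side (fst (hd p))"
  using is_piece_iff[of X p] shape_hd_side[of X p] by (cases "X = Pillar") (auto simp: pillar_iff)

lemma piece_in_strip: "is_piece b X p \<Longrightarrow> in_strip p"
proof (cases "X = Pillar")
  case True
  assume "is_piece b X p"
  then have p: "side (fst (hd p))" "vertical p" using True by (auto simp: pillar_iff)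
  then have "1 \<le> fst (hd p) \<and> fst (hd p) \<le> int b" using width by (auto simp: side_def)
  then show ?thesis using vertical_column[OF p(2)] by (auto simp only: in_strip_def)
next
  case False
  assume "is_piece b X p"
  then have "shape X p" using False is_piece_iff by blast
  then obtain c ys d where p: "p = c # ys @ [d]" "\<And>e. e \<in> set ys \<Longrightarrow> interior (fst e)"
      "end_columns X (fst c) (ys \<noteq> []) (fst d)"
    by (rule shapeE) blast
  then have "in_strip ys" by (fastforce simp: in_strip_def interior_def)
  then show ?thesis
    using p(1,3) width by (cases X) (auto simp: side_def interior_def)
qed

lemma stk_in_strip: "stk c w ps \<Longrightarrow> in_strip (concat ps)"
  by (induction c w ps rule: stk.induct) (auto dest: piece_in_strip)

lemma crossing_touches:
  "stk c w ps \<Longrightarrow> Crossing \<in> set w \<Longrightarrow> \<exists>d\<in>set (concat ps). \<exists>e\<in>set (concat ps). fst d = 1 \<and> fst e = int b"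
proof (induction c w ps rule: stk.induct)
  case (2 c X w p ps)
  show ?case
  proof (cases "X = Crossing")
    case True
    then have "shape Crossing p" using 2 is_piece_iff[of X p] by simp
    then obtain d ys e where p: "p = d # ys @ [e]" "side (fst d)" "side (fst e)" "fst d \<noteq> fst e"
      by (auto elim!: shapeE)
    from p(2-4) consider "fst d = 1 \<and> fst e = int b" | "fst e = 1 \<and> fst d = int b"
      by (auto simp: side_def)
    then show ?thesis by cases (use p(1) in auto)
  qed (use 2 in auto)
qed auto

lemma no_crossing_one_side:
  assumes "stk c w ps" "side (fst c)" "set w \<subseteq> {Pillar, Bubble, Upper_Ending}"
    "e \<in> set (concat ps)" "side (fst e)"
  shows "fst e = fst c"
  using assms
proof (induction w arbitrary: c ps)
  case (Cons X w)
  from Cons.prems(1) obtain p qs where p: "ps = p # qs" "is_piece b X p" "hd p = c"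
      "stk (up (last p)) w qs"
    by (rule stk_ConsE)
  show ?case
  proof (cases "X = Pillar")
    case True
    then have v: "p \<noteq> []" "vertical p" using p by (auto simp: pillar_iff)
    have "fst (last p) = fst c" using vertical_column[OF v(2), of "last p"] v p by simp
    moreover have "fst e = fst c" if "e \<in> set p" using vertical_column[OF v(2) that] p by simp
    ultimately show ?thesis using Cons.IH[OF p(4)] Cons.prems p by auto
  next
    case False
    then have "shape X p" using p is_piece_iff by blast
    then obtain d ys d' where q: "p = d # ys @ [d']" "\<And>e. e \<in> set ys \<Longrightarrow> interior (fst e)"
        "end_columns X (fst d) (ys \<noteq> []) (fst d')"
      by (rule shapeE) blast
    show ?thesis
    proof (cases "X = Bubble")
      case True
      then have "fst d' = fst c" using q p by simp
      moreover have "fst e = fst c" if "e \<in> set p"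
      proof -
        have "e \<notin> set ys" using q(2) Cons.prems(5) not_side_interior by blast
        then show ?thesis using that q(1) p(3) \<open>fst d' = fst c\<close> by auto
      qed
      ultimately show ?thesis using Cons.IH[OF p(4)] Cons.prems p q by auto
    next
      case False
      then have X: "X = Upper_Ending" using Cons.prems \<open>X \<noteq> Pillar\<close> by auto
      then have int: "interior (fst d')" using q by simp
      have "w = []"
      proof (rule ccontr)
        assume "w \<noteq> []"
        then obtain Y w' where w: "w = Y # w'" by (cases w) auto
        then have Y: "Y \<in> {Pillar, Bubble, Upper_Ending}" using Cons.prems(3) by auto
        then have "Y \<noteq> Lower_Ending" by auto
        from p(4)[unfolded w] obtain p' where "is_piece b Y p'" "hd p' = up (last p)"
          by (rule stk_ConsE)
        then have "side (fst (up (last p)))" using piece_hd_side[OF _ \<open>Y \<noteq> Lower_Ending\<close>] by metis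
        then show False using int q not_side_interior by simp
      qed
      then have "concat qs = []" using p(4) by simp
      then have "concat ps = p" using p(1) by (simp only: concat.simps append_Nil2)
      then have "e \<in> set p" using Cons.prems(4) by simp
      moreover have "e \<notin> set ys" using q(2) Cons.prems(5) not_side_interior by blast
      moreover have "e \<noteq> d'" using int Cons.prems(5) not_side_interior by blast
      ultimately show ?thesis using q(1) p(3) by auto
    qed
  qed
qed simp

text \<open>The three words of \<open>lower\<close> correspond to the three ways to begin: leaving a
  side column at once, climbing it first, or starting in the interior. The remaining walk is handled
  by \<open>cover_from_side\<close>.\<close>

theorem cover:
  assumes loc: "walk L" and strip: "in_strip L"
    and touch: "\<exists>c\<in>set L. fst c = 1" "\<exists>c\<in>set L. fst c = int b"
  obtains lo w ps where "lo \<in> lower" "w \<in> core" "Crossing \<in> set w" "stk (hd L) (lo @ w) ps"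
    "concat ps = L"
proof -
  have Lne: "L \<noteq> []" using touch by auto
  have notv: "\<not> vertical L"
  proof
    assume v: "vertical L"
    obtain c d where "c \<in> set L" "d \<in> set L" "fst c = 1" "fst d = int b" using touch by blast
    then show False using vertical_column[OF v, of c] vertical_column[OF v, of d] width by simp
  qed
  have other_side: "\<exists>d\<in>set L. side (fst d) \<and> fst d \<noteq> x" for x
  proof -
    obtain c d where "c \<in> set L" "d \<in> set L" "fst c = 1" "fst d = int b" using touch by blast
    moreover from this have "fst c \<noteq> x \<or> fst d \<noteq> x" using width by auto
    ultimately show ?thesis unfolding side_def by blast
  qed
  \<comment> \<open>Meeting both sides excludes stacks without a crossing, in particular a lone
    upper ending.\<close>
  have core_crossing: "Crossing \<in> set w \<and> w \<in> core"
    if "stk c w ps" "side (fst c)" "w = [Upper_Ending] \<or> w \<in> core"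
      "\<exists>d\<in>set (concat ps). \<exists>e\<in>set (concat ps). side (fst d) \<and> side (fst e) \<and> fst d \<noteq> fst e" for c w ps
  proof -
    have "set w \<subseteq> {Pillar, Bubble, Upper_Ending, Crossing}"
      using that(3) unfolding core_def upper_def by (auto simp: set_inter split: if_splits)
    note ends = that(4)
    have "Crossing \<in> set w"
    proof (rule ccontr)
      assume "Crossing \<notin> set w"
      then have sub: "set w \<subseteq> {Pillar, Bubble, Upper_Ending}" using \<open>set w \<subseteq> _\<close> by blast
      obtain d e where "d \<in> set (concat ps)" "e \<in> set (concat ps)" "side (fst d)" "side (fst e)"
          "fst d \<noteq> fst e"
        using ends by blast
      then show False
        using no_crossing_one_side[OF that(1,2) sub, of d] no_crossing_one_side[OF that(1,2) sub, of e]
        by metis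
    qed
    moreover from this have "w \<noteq> [Upper_Ending]" by auto
    ultimately show ?thesis using that(3) by blast
  qed
  show ?thesis
  proof (cases "side (fst (hd L))")
    case True
    obtain V v g rest where V: "L = V @ v # g # rest" "vertical (V @ [v])" "fst g \<noteq> fst v"
      using vertical_split[OF loc notv] by blast
    have "hd (V @ [v]) = hd L" using V(1) by (cases V) auto
    then have fv: "fst (hd L) = fst v" "\<And>c. c \<in> set V \<Longrightarrow> fst c = fst v"
      using vertical_column[OF V(2), of v] vertical_column[OF V(2)] by simp_all
    have "walk (v # g # rest)" "in_strip (v # g # rest)"
      using walk_appendD2[of V "v # g # rest"] loc strip V(1) by simp_all
    then obtain w ps where w: "stk v w ps" "concat ps = v # g # rest" "w = [Upper_Ending] \<or> w \<in> core"
      using cover_from_side[of v g rest] True fv V(3) by auto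
    have "\<exists>d\<in>set (concat ps). side (fst d) \<and> fst d \<noteq> fst v"
    proof -
      obtain d where d: "d \<in> set L" "side (fst d)" "fst d \<noteq> fst v"
        using other_side by blast
      then have "d \<notin> set V" using fv(2) by blast
      then show ?thesis using d V(1) w(2) by auto
    qed
    then have cw: "Crossing \<in> set w \<and> w \<in> core"
      using core_crossing[OF w(1) _ w(3)] True fv w(2) by (metis list.set_intros(1))
    show ?thesis
    proof (cases "V = []")
      case True
      then show ?thesis using that[of "[]" w ps] cw w V by (simp add: lower_def)
    next
      case False
      then have "vertical V" "v = up (last V)" using vertical_snoc[OF V(2)] by auto
      moreover have "hd V = hd L" using False V by simp
      ultimately have "stk (hd L) ([Pillar] @ w) (V # ps)"
        using w True False by (simp add: pillar_iff)
      then show ?thesis using that[of "[Pillar]" w "V # ps"] cw w V by (simp add: lower_def)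
    qed
  next
    case False
    have "\<exists>d\<in>set L. side (fst d)" using touch by (auto simp: side_def)
    from split_list_first_prop[OF this] obtain ys d zs where
      sp: "L = ys @ d # zs" "side (fst d)" "\<forall>d\<in>set ys. \<not> side (fst d)" by blast
    have "ys \<noteq> []" using sp False by auto
    then obtain c ys' where ys: "ys = c # ys'" by (cases ys) auto
    have int: "interior (fst e)" if "e \<in> set ys" for e
      using that sp strip interior_iff[of "fst e"] by (auto simp: in_strip_def)
    have loc': "walk (c # ys' @ d # zs)" using loc sp ys by simp
    then have "walk (c # ys' @ [d])"
      using walk_appendD1[of "c # ys' @ [d]" zs] by simp
    then have "shape Lower_Ending (c # ys' @ [d])"
      by (rule shapeI) (use int sp ys in auto)
    then have p: "is_piece b Lower_Ending (ys @ [d])" using is_piece_iff[of Lower_Ending] ys by auto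
    have other: "\<exists>e\<in>set zs. side (fst e) \<and> fst e \<noteq> fst d"
    proof -
      obtain e where e: "e \<in> set L" "side (fst e)" "fst e \<noteq> fst d"
        using other_side by blast
      then show ?thesis using sp by auto
    qed
    then have zs: "zs \<noteq> []" by auto
    have strip': "in_strip (c # ys' @ d # zs)" using strip sp ys by simp
    have cd: "fst c \<noteq> fst d" using sp(2,3) ys by auto
    obtain f where f: "walk (f # d # zs)" "fst f \<noteq> fst d" "in_strip (f # d # zs)"
      by (rule arrival_step[OF loc' _ sp(2) cd strip']) (use int ys in auto)
    show ?thesis
      using f(1,3,2) sp(2) zs
    proof (cases rule: after_arrival)
      \<comment> \<open>A final pillar is impossible here, since the other side column is still to
        be visited.\<close>
      case 1
      then have "vertical zs" by (simp add: pillar_iff)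
      then have "fst e = fst d" if "e \<in> set zs" for e
        using vertical_column[OF _ that] 1(2) by simp
      then show ?thesis using other by auto
    next
      case (2 V v g rest)
      have vV: "vertical V" "V \<noteq> []" using 2 by (auto simp: pillar_iff)
      then have fV: "fst e = fst d" if "e \<in> set V" for e
        using vertical_column[OF vV(1) that] 2(3) by simp
      then have fv: "fst v = fst d" using 2(4) vV(2) by simp
      have "walk (v # g # rest)"
        using walk_appendD2[of "f # d # V" "v # g # rest"] f(1) 2(1) by simp
      moreover have "in_strip (v # g # rest)" using f(3) 2(1) by simp
      ultimately obtain w ps where w: "stk v w ps" "concat ps = v # g # rest"
          "w = [Upper_Ending] \<or> w \<in> core"
        using cover_from_side[of v g rest] 2 by auto
      obtain e where e: "e \<in> set zs" "side (fst e)" "fst e \<noteq> fst d" using other by blast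
      moreover from e have "e \<notin> set V" using fV by blast
      ultimately have "e \<in> set (concat ps)" using 2(1) w(2) by simp
      then have "Crossing \<in> set w \<and> w \<in> core"
        using core_crossing[OF w(1) _ w(3)] 2(6) fv w(2) e by (metis list.set_intros(1))
      moreover have "stk (hd L) ([Lower_Ending, Pillar] @ w) ((ys @ [d]) # V # ps)"
        using p 2 w sp ys by simp
      moreover have "concat ((ys @ [d]) # V # ps) = L" using sp w(2) 2(1) by simp
      ultimately show ?thesis
        using that[of "[Lower_Ending, Pillar]" w "(ys @ [d]) # V # ps"] by (simp add: lower_def)
    qed
  qed
qed

end

section \<open>Counting with two weights\<close>

text \<open>Here \<open>h\<close> is marked by \<open>t\<close> and \<open>s\<close> by
  \<open>q\<close>. Finiteness is part of the notion because \<open>card\<close> is 0 on infinite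
  sets, which would spoil the rules for unions and products.\<close>

definition has_gf :: "('a \<Rightarrow> nat) \<Rightarrow> ('a \<Rightarrow> nat) \<Rightarrow> 'a set \<Rightarrow> series \<Rightarrow> bool" where
  "has_gf h s A F \<longleftrightarrow> (\<forall>k n. finite {a \<in> A. h a = k \<and> s a = n} \<and>
     of_nat (card {a \<in> A. h a = k \<and> s a = n}) = fps_nth (fps_nth F k) n)"

lemma has_gfD:
  assumes "has_gf h s A F"
  shows "finite {a \<in> A. h a = k \<and> s a = n}"
    "of_nat (card {a \<in> A. h a = k \<and> s a = n}) = fps_nth (fps_nth F k) n"
  using assms by (auto simp: has_gf_def)

lemma has_gf_gf: "has_gf h s A F \<Longrightarrow> F = gf (\<lambda>k n. card {a \<in> A. h a = k \<and> s a = n})"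
  by (auto simp: gf_def fps_eq_iff has_gfD)

lemma has_gf_unique: "has_gf h s A F \<Longrightarrow> has_gf h s A H \<Longrightarrow> F = H"
  using has_gf_gf by blast

lemma has_gf_bij:
  assumes "has_gf h s A F" "bij_betw f A B" "\<And>a. a \<in> A \<Longrightarrow> h' (f a) = h a" "\<And>a. a \<in> A \<Longrightarrow> s' (f a) = s a"
  shows "has_gf h' s' B F"
  unfolding has_gf_def
proof (intro allI)
  fix k n
  have bij: "bij_betw f {a \<in> A. h a = k \<and> s a = n} {a \<in> B. h' a = k \<and> s' a = n}"
    using assms(2-4) unfolding bij_betw_def by (auto simp: inj_on_def)
  show "finite {a \<in> B. h' a = k \<and> s' a = n} \<and>
      of_nat (card {a \<in> B. h' a = k \<and> s' a = n}) = fps_nth (fps_nth F k) n"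
    using has_gfD[OF assms(1), of k n] bij_betw_finite[OF bij] bij_betw_same_card[OF bij] by simp
qed

lemma has_gf_Un:
  assumes "has_gf h s A F" "has_gf h s B G" "A \<inter> B = {}"
  shows "has_gf h s (A \<union> B) (F + G)"
  unfolding has_gf_def
proof (intro allI)
  fix k n
  have eq: "{a \<in> A \<union> B. h a = k \<and> s a = n} =
      {a \<in> A. h a = k \<and> s a = n} \<union> {a \<in> B. h a = k \<and> s a = n}" by auto
  have "card ({a \<in> A. h a = k \<and> s a = n} \<union> {a \<in> B. h a = k \<and> s a = n}) =
      card {a \<in> A. h a = k \<and> s a = n} + card {a \<in> B. h a = k \<and> s a = n}"
    using has_gfD(1)[OF assms(1)] has_gfD(1)[OF assms(2)] assms(3) by (intro card_Un_disjoint) auto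
  then show "finite {a \<in> A \<union> B. h a = k \<and> s a = n} \<and>
      of_nat (card {a \<in> A \<union> B. h a = k \<and> s a = n}) = fps_nth (fps_nth (F + G) k) n"
    unfolding eq using has_gfD[OF assms(1), of k n] has_gfD[OF assms(2), of k n] by simp
qed

lemma has_gf_empty: "has_gf h s {} 0"
  by (simp add: has_gf_def)

lemma has_gf_UN_finite:
  assumes "finite I" "\<And>i. i \<in> I \<Longrightarrow> has_gf h s (A i) (F i)"
    "\<And>i j. i \<in> I \<Longrightarrow> j \<in> I \<Longrightarrow> i \<noteq> j \<Longrightarrow> A i \<inter> A j = {}"
  shows "has_gf h s (\<Union>i\<in>I. A i) (\<Sum>i\<in>I. F i)"
  using assms
proof (induction I rule: finite_induct)
  case (insert i I)
  have "has_gf h s (A i \<union> (\<Union>i\<in>I. A i)) (F i + (\<Sum>i\<in>I. F i))"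
  proof (rule has_gf_Un)
    show "A i \<inter> (\<Union>i\<in>I. A i) = {}" using insert.prems(2)[of i] insert.hyps by fastforce
  qed (use insert in auto)
  then show ?case using insert.hyps by simp
qed (simp add: has_gf_empty)

text \<open>Infinitely many disjoint sets may be united provided each power of \<open>t\<close>
  involves only finitely many of them; \<open>J k\<close> contains all indices relevant for
  \<open>t ^ k\<close>.\<close>

lemma has_gf_UN:
  assumes gf: "\<And>i. i \<in> I \<Longrightarrow> has_gf h s (A i) (F i)"
    and disj: "\<And>i j. i \<in> I \<Longrightarrow> j \<in> I \<Longrightarrow> i \<noteq> j \<Longrightarrow> A i \<inter> A j = {}"
    and J: "\<And>k. finite (J k)" "\<And>k. J k \<subseteq> I" "\<And>k i. i \<in> I \<Longrightarrow> i \<notin> J k \<Longrightarrow> fps_nth (F i) k = 0"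
  shows "has_gf h s (\<Union>i\<in>I. A i) (Abs_fps (\<lambda>k. \<Sum>i\<in>J k. fps_nth (F i) k))"
  unfolding has_gf_def
proof (intro allI)
  fix k n
  have "{a \<in> \<Union>i\<in>I. A i. h a = k \<and> s a = n} = {a \<in> \<Union>i\<in>J k. A i. h a = k \<and> s a = n}"
  proof -
    \<comment> \<open>Finiteness turns a vanishing coefficient into an empty set.\<close>
    have "{a \<in> A i. h a = k \<and> s a = n} = {}" if "i \<in> I" "i \<notin> J k" for i
      using has_gfD[OF gf[OF that(1)], of k n] J(3)[OF that] by (simp add: card_eq_0_iff)
    then show ?thesis using J(2)[of k] by blast
  qed
  moreover have "has_gf h s (\<Union>i\<in>J k. A i) (\<Sum>i\<in>J k. F i)"
    by (rule has_gf_UN_finite) (use J gf disj in blast)+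
  ultimately show "finite {a \<in> \<Union>i\<in>I. A i. h a = k \<and> s a = n} \<and>
      of_nat (card {a \<in> \<Union>i\<in>I. A i. h a = k \<and> s a = n}) =
        fps_nth (fps_nth (Abs_fps (\<lambda>k. \<Sum>i\<in>J k. fps_nth (F i) k)) k) n"
    using has_gfD[of h s "\<Union>i\<in>J k. A i" "\<Sum>i\<in>J k. F i" k n] by (simp add: fps_sum_nth)
qed

text \<open>The second set may depend on the first component as long as its series does not. This
  suits stacks, where the cell on which the rest is built depends on the piece below.\<close>

lemma has_gf_Sigma:
  assumes A: "has_gf h s A F" and B: "\<And>a. a \<in> A \<Longrightarrow> has_gf h' s' (B a) G"
  shows "has_gf (\<lambda>x. h (fst x) + h' (snd x)) (\<lambda>x. s (fst x) + s' (snd x)) (Sigma A B) (F * G)"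
  unfolding has_gf_def
proof (intro allI)
  fix k n
  define S where "S ij = (SIGMA a:{a \<in> A. h a = fst ij \<and> s a = snd ij}.
      {c \<in> B a. h' c = k - fst ij \<and> s' c = n - snd ij})" for ij :: "nat \<times> nat"
  let ?I = "{0..k} \<times> {0..n}"
  have eq: "{x \<in> Sigma A B. h (fst x) + h' (snd x) = k \<and> s (fst x) + s' (snd x) = n} = (\<Union>ij\<in>?I. S ij)"
    by (auto simp: S_def)
  have fin: "finite (S ij)" for ij
    unfolding S_def using has_gfD(1)[OF A] has_gfD(1)[OF B] by (intro finite_SigmaI) auto
  have card_S: "of_nat (card (S ij)) =
      fps_nth (fps_nth F (fst ij)) (snd ij) * fps_nth (fps_nth G (k - fst ij)) (n - snd ij)" for ij
  proof -
    let ?A = "{a \<in> A. h a = fst ij \<and> s a = snd ij}"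
    let ?B = "\<lambda>a. {c \<in> B a. h' c = k - fst ij \<and> s' c = n - snd ij}"
    have "card (S ij) = (\<Sum>a\<in>?A. card (?B a))"
      unfolding S_def using has_gfD(1)[OF A] has_gfD(1)[OF B] by (intro card_SigmaI) auto
    then have "(of_nat (card (S ij)) :: rat) = (\<Sum>a\<in>?A. of_nat (card (?B a)))" by simp
    also have "\<dots> = (\<Sum>a\<in>?A. fps_nth (fps_nth G (k - fst ij)) (n - snd ij))"
      using has_gfD(2)[OF B] by (intro sum.cong) auto
    finally show ?thesis using has_gfD(2)[OF A] by simp
  qed
  have "card (\<Union>ij\<in>?I. S ij) = (\<Sum>ij\<in>?I. card (S ij))"
    by (rule card_UN_disjoint) (auto simp: fin, auto simp: S_def)
  then have "of_nat (card (\<Union>ij\<in>?I. S ij)) =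
      (\<Sum>ij\<in>?I. fps_nth (fps_nth F (fst ij)) (snd ij) * fps_nth (fps_nth G (k - fst ij)) (n - snd ij))"
    by (simp add: card_S)
  also have "\<dots> = fps_nth (fps_nth (F * G) k) n"
    by (simp add: fps_mult_nth fps_sum_nth sum.cartesian_product case_prod_beta)
  finally show "finite {x \<in> Sigma A B. h (fst x) + h' (snd x) = k \<and> s (fst x) + s' (snd x) = n} \<and>
      of_nat (card {x \<in> Sigma A B. h (fst x) + h' (snd x) = k \<and> s (fst x) + s' (snd x) = n}) =
        fps_nth (fps_nth (F * G) k) n"
    unfolding eq using fin by simp
qed

lemma has_gf_singleton: "has_gf h s {a} 1" if "h a = 0" "s a = 0"
proof -
  have "{x \<in> {a}. h x = k \<and> s x = n} = (if k = 0 \<and> n = 0 then {a} else {})" for k n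
    using that by auto
  then show ?thesis by (simp add: has_gf_def)
qed

section \<open>Generating functions of languages of piece words\<close>

lemma finite_pieces: "finite (UNIV :: piece set)"
proof -
  have "UNIV = {Pillar, Crossing, Bubble, Lower_Ending, Upper_Ending}"
    using piece.exhaust by auto
  then show ?thesis by (metis finite.emptyI finite.insertI)
qed

lemma finite_short_words: "finite {w \<in> W. length w \<le> k}" for W :: "piece list set"
proof -
  have "finite {w :: piece list. set w \<subseteq> UNIV \<and> length w \<le> k}"
    by (rule finite_lists_length_le) (rule finite_pieces)
  then show ?thesis by (rule rev_finite_subset) auto
qed

definition weight :: "(piece \<Rightarrow> series) \<Rightarrow> piece list \<Rightarrow> series" where
  "weight g w = prod_list (map g w)"

lemma weight_simps [simp]:
  "weight g [] = 1" "weight g (X # w) = g X * weight g w" "weight g (u @ v) = weight g u * weight g v"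
  by (simp_all add: weight_def)

text \<open>
  As every piece has positive height, only the words of length at most \<open>k\<close> contribute to the
  coefficient of \<open>t ^ k\<close>; hence the sum over the language is finite.
\<close>

definition language_gf :: "(piece \<Rightarrow> series) \<Rightarrow> piece list set \<Rightarrow> series" where
  "language_gf g W = Abs_fps (\<lambda>k. \<Sum>w | w \<in> W \<and> length w \<le> k. fps_nth (weight g w) k)"

definition unambiguous :: "piece list set \<Rightarrow> piece list set \<Rightarrow> bool" where
  "unambiguous U V \<longleftrightarrow> inj_on (\<lambda>(u, v). u @ v) (U \<times> V)"

text \<open>A cutting position that can be computed from the whole word determines both
  factors.\<close>

lemma unambiguousI:
  assumes "\<And>u v. u \<in> U \<Longrightarrow> v \<in> V \<Longrightarrow> f (u @ v) = length u"
  shows "unambiguous U V"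
  unfolding unambiguous_def
proof (rule inj_onI)
  fix x y assume xy: "x \<in> U \<times> V" "y \<in> U \<times> V" "(\<lambda>(u, v). u @ v) x = (\<lambda>(u, v). u @ v) y"
  then have "length (fst x) = length (fst y)"
    using assms[of "fst x" "snd x"] assms[of "fst y" "snd y"] by (auto simp: case_prod_beta)
  then show "x = y" using xy by (auto simp: case_prod_beta prod_eq_iff)
qed

context
  fixes g :: "piece \<Rightarrow> series"
  assumes g0: "fps_nth (g X) 0 = 0"
begin

lemma weight_low: "k < length w \<Longrightarrow> fps_nth (weight g w) k = 0"
proof (induction w arbitrary: k)
  case (Cons X w)
  have "fps_nth (g X) i * fps_nth (weight g w) (k - i) = 0" if "i \<le> k" for i
    using Cons g0[of X] that by (cases "i = 0") auto
  then show ?case unfolding weight_simps fps_mult_nth by (intro sum.neutral) simp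
qed simp

text \<open>A common length bound for all coefficients up to \<open>t ^ m\<close>, needed to
  multiply two of these sums.\<close>

lemma language_gf_nth:
  assumes "k \<le> m"
  shows "fps_nth (language_gf g W) k = (\<Sum>w | w \<in> W \<and> length w \<le> m. fps_nth (weight g w) k)"
  unfolding language_gf_def fps_nth_Abs_fps
proof (rule sum.mono_neutral_left)
  show "\<forall>w\<in>{w. w \<in> W \<and> length w \<le> m} - {w. w \<in> W \<and> length w \<le> k}. fps_nth (weight g w) k = 0"
    using weight_low by (auto simp: not_le)
qed (use finite_short_words assms in auto)

lemma language_gf_union:
  assumes "U \<inter> V = {}"
  shows "language_gf g (U \<union> V) = language_gf g U + language_gf g V"
proof -
  have "{w. w \<in> U \<union> V \<and> length w \<le> k} = {w \<in> U. length w \<le> k} \<union> {w \<in> V. length w \<le> k}" for k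
    by auto
  then show ?thesis
    using assms by (intro fps_ext) (auto simp: language_gf_def sum.union_disjoint finite_short_words disjoint_iff)
qed

lemma language_gf_singleton: "language_gf g {w} = weight g w"
proof (rule fps_ext)
  fix k
  have "{v. v \<in> {w} \<and> length v \<le> k} = (if length w \<le> k then {w} else {})" by auto
  then show "fps_nth (language_gf g {w}) k = fps_nth (weight g w) k"
    using weight_low[of k w] by (simp add: language_gf_def)
qed

lemma language_gf_insert: "w \<notin> W \<Longrightarrow> language_gf g (insert w W) = weight g w + language_gf g W"
  using language_gf_union[of "{w}" W] by (simp add: language_gf_singleton)

lemma language_gf_empty: "language_gf g {} = 0"
  by (simp add: language_gf_def fps_zero_def)

text \<open>Expand the Cauchy product over pairs of short factors and merge each pair into its
  concatenation; unambiguity makes the merging injective.\<close>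

lemma language_gf_conc:
  assumes "unambiguous U V"
  shows "language_gf g (U \<cdot> V) = language_gf g U * language_gf g V"
proof (rule fps_ext)
  fix k
  let ?U = "{u \<in> U. length u \<le> k}" and ?V = "{v \<in> V. length v \<le> k}"
  let ?w = "fps_nth \<circ> weight g"
  have "fps_nth (language_gf g U * language_gf g V) k =
      (\<Sum>i=0..k. (\<Sum>u\<in>?U. ?w u i) * (\<Sum>v\<in>?V. ?w v (k - i)))"
    unfolding fps_mult_nth
    by (intro sum.cong refl arg_cong2[where f = "(*)"]) (auto simp: language_gf_nth[of _ k])
  also have "\<dots> = (\<Sum>i=0..k. \<Sum>(u, v)\<in>?U \<times> ?V. ?w u i * ?w v (k - i))"
    by (simp add: sum_product sum.cartesian_product)
  also have "\<dots> = (\<Sum>x\<in>?U \<times> ?V. \<Sum>i=0..k. ?w (fst x) i * ?w (snd x) (k - i))"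
    by (subst sum.swap) (simp add: case_prod_beta)
  also have "\<dots> = (\<Sum>x\<in>?U \<times> ?V. ?w ((\<lambda>(u, v). u @ v) x) k)"
    by (intro sum.cong refl) (auto simp: fps_mult_nth)
  also have "\<dots> = (\<Sum>w\<in>(\<lambda>(u, v). u @ v) ` (?U \<times> ?V). ?w w k)"
    using assms unfolding unambiguous_def by (intro sum.reindex_cong[symmetric, where l = "\<lambda>(u, v). u @ v"])
      (auto intro: inj_on_subset)
  also have "\<dots> = (\<Sum>w | w \<in> U \<cdot> V \<and> length w \<le> k. ?w w k)"
  \<comment> \<open>Two factors of length at most \<open>k\<close> may have a longer product, but
    its weight then has no \<open>t ^ k\<close> term.\<close>
  proof (rule sum.mono_neutral_right)
    show "finite ((\<lambda>(u, v). u @ v) ` (?U \<times> ?V))" by (intro finite_imageI finite_cartesian_product finite_short_words)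
    show "{w. w \<in> U \<cdot> V \<and> length w \<le> k} \<subseteq> (\<lambda>(u, v). u @ v) ` (?U \<times> ?V)"
      by (force simp: conc_def image_iff)
    show "\<forall>w\<in>(\<lambda>(u, v). u @ v) ` (?U \<times> ?V) - {w. w \<in> U \<cdot> V \<and> length w \<le> k}. ?w w k = 0"
      by (auto simp: conc_def intro!: weight_low)
  qed
  finally show "fps_nth (language_gf g (U \<cdot> V)) k = fps_nth (language_gf g U * language_gf g V) k"
    by (simp add: language_gf_def)
qed

text \<open>From the disjoint decomposition of \<open>star U\<close> into the empty word and
  \<open>U \<cdot> star U\<close>, which is unambiguous because all words of \<open>U\<close> have
  the same length. The product form avoids dividing over a coefficient ring that is not a
  field.\<close>

lemma language_gf_star:
  assumes "\<And>u. u \<in> U \<Longrightarrow> length u = m" "m > 0"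
  shows "language_gf g (star U) * (1 - language_gf g U) = 1"
proof -
  have star: "star U = insert [] (U \<cdot> star U)"
  proof
    show "star U \<subseteq> insert [] (U \<cdot> star U)"
    proof
      fix w assume "w \<in> star U"
      then obtain us where us: "w = concat us" "set us \<subseteq> U" by (auto simp: star_def)
      show "w \<in> insert [] (U \<cdot> star U)"
      proof (cases us)
        case (Cons u us')
        then show ?thesis using us unfolding conc_def star_def
          by (intro insertI2 CollectI exI[of _ u] exI[of _ "concat us'"]) auto
      qed (use us in simp)
    qed
    show "insert [] (U \<cdot> star U) \<subseteq> star U"
    proof
      fix w assume "w \<in> insert [] (U \<cdot> star U)"
      then consider "w = []" | "w \<in> U \<cdot> star U" by blast
      then show "w \<in> star U"
      proof cases
        case 1
        then show ?thesis unfolding star_def by (intro CollectI exI[of _ "[]"]) simp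
      next
        case 2
        then obtain u us where "u \<in> U" "set us \<subseteq> U" "w = u @ concat us"
          unfolding conc_def star_def by blast
        then show ?thesis unfolding star_def by (intro CollectI exI[of _ "u # us"]) auto
      qed
    qed
  qed
  have "[] \<notin> U \<cdot> star U" using assms by (auto simp: conc_def)
  then have "language_gf g (star U) = 1 + language_gf g (U \<cdot> star U)"
    by (subst star) (simp add: language_gf_insert)
  also have "language_gf g (U \<cdot> star U) = language_gf g U * language_gf g (star U)"
    by (rule language_gf_conc, rule unambiguousI[where f = "\<lambda>_. m"]) (simp add: assms)
  finally have eq: "language_gf g (star U) - language_gf g U * language_gf g (star U) = 1"
    unfolding diff_eq_eq .
  have "language_gf g (star U) * (1 - language_gf g U) =
      language_gf g (star U) - language_gf g U * language_gf g (star U)"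
    by (simp add: right_diff_distrib mult.commute)
  then show ?thesis unfolding eq .
qed

end

section \<open>Counting pieces\<close>

definition rows :: "cell list \<Rightarrow> nat" where
  "rows p = nat (snd (last p) - snd (hd p) + 1)"

lemma snd_image_listing:
  assumes "successively new_step p" "p \<noteq> []"
  shows "snd ` set p = {snd (hd p)..snd (last p)}"
  using assms
proof (induction p)
  case (Cons c p)
  show ?case
  proof (cases "p = []")
    case False
    then have "new_step c (hd p)" "snd ` set p = {snd (hd p)..snd (last p)}"
      using Cons by (auto simp: successively_Cons)
    moreover have "snd (hd p) \<le> snd (last p)"
      using rows_hd_last(1)[of p "last p"] Cons.prems False by (auto simp: successively_Cons)
    ultimately show ?thesis using new_step_rows[of c "hd p"] False by auto
  qed simp
qed simp

lemma height_listing: "successively new_step p \<Longrightarrow> p \<noteq> [] \<Longrightarrow> height (set p) = rows p"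
  by (simp add: height_def snd_image_listing rows_def)

lemma Min_listing:
  assumes "successively new_step p" "p \<noteq> []"
  shows "Min (snd ` set p) = snd (hd p)"
  using assms rows_hd_last(1)[OF assms(1)] by (intro Min_eqI) auto

text \<open>Once the first cell is fixed there is no choice: its only neighbour among the remaining
  cells is its successor, by \<open>walk_head\<close>, and the argument repeats there.\<close>

lemma listing_unique:
  assumes "walk L" "walk M" "set L = set M" "hd L = hd M"
  shows "L = M"
  using assms
proof (induction L arbitrary: M)
  case (Cons c L)
  then obtain M' where M: "M = c # M'" by (cases M) (auto simp: walk_def)
  have "c \<notin> set L" "c \<notin> set M'"
    using walk_distinct Cons.prems(1,2) M by fastforce+
  then have eq: "set L = set M'" using Cons.prems(3) M by auto
  show ?case
  proof (cases "L = []")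
    case False
    then have M': "M' \<noteq> []" using eq by auto
    have "hd M' \<in> set L" "adj c (hd M')"
      using M' eq walkD(5)[OF Cons.prems(2)] M by (auto simp: successively_Cons new_step_adj)
    then have "hd L = hd M'" using walk_head(2)[OF Cons.prems(1)] by simp
    then show ?thesis
      using Cons.IH[OF walk_ConsD _ eq] Cons.prems M M' False walk_ConsD by blast
  qed (use eq M in simp)
qed (simp add: walk_def)

lemma finite_listings: "finite {p. walk p \<and> hd p = c \<and> length p = n}"
proof (induction n arbitrary: c)
  case 0
  have "{p. walk p \<and> hd p = c \<and> length p = 0} = {}" by (auto simp: walk_def)
  then show ?case by simp
next
  case (Suc n)
  let ?N = "{up c, (fst c + 1, snd c), (fst c - 1, snd c)}"
  let ?S = "insert [c] (\<Union>d\<in>?N. Cons c ` {p. walk p \<and> hd p = d \<and> length p = n})"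
  have "{p. walk p \<and> hd p = c \<and> length p = Suc n} \<subseteq> ?S"
  proof
    fix p assume "p \<in> {p. walk p \<and> hd p = c \<and> length p = Suc n}"
    then obtain p' where p: "p = c # p'" "walk (c # p')" "length p' = n"
      by (cases p) auto
    show "p \<in> ?S"
    proof (cases "p' = []")
      case False
      then have "new_step c (hd p')" using walkD(5)[OF p(2)] by (simp add: successively_Cons)
      then have "hd p' \<in> ?N" by (auto simp: new_step_def)
      then show ?thesis using p walk_ConsD[OF p(2) False] by blast
    qed (use p in simp)
  qed
  moreover have "finite ?S" using Suc.IH by blast
  ultimately show ?case by (rule finite_subset)
qed

section \<open>Vertical translations and the series of single pieces\<close>

definition shift :: "int \<Rightarrow> cell list \<Rightarrow> cell list" where
  "shift r = map (\<lambda>c. (fst c, snd c + r))"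

lemma shift_simps: "shift r (shift r' p) = shift (r + r') p" "shift 0 p = p" "length (shift r p) = length p"
  "shift r p = [] \<longleftrightarrow> p = []"
  by (auto simp: shift_def comp_def algebra_simps)

lemma shift_hd: "p \<noteq> [] \<Longrightarrow> hd (shift r p) = (fst (hd p), snd (hd p) + r)"
  by (simp add: shift_def hd_map)

lemma shift_last: "p \<noteq> [] \<Longrightarrow> last (shift r p) = (fst (last p), snd (last p) + r)"
  by (simp add: shift_def last_map)

lemma walk_shift: "walk (shift r p) \<longleftrightarrow> walk p"
proof -
  have *: "walk (shift r p)" if "walk p" for p r
    unfolding shift_def
    by (rule walk_map[OF _ _ _ that]) (auto simp: new_step_def adj_def inj_def prod_eq_iff)
  show ?thesis using *[of p r] *[of "shift r p" "- r"] by (auto simp: shift_simps)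
qed

lemma shift_set: "set (shift r p) = (\<lambda>c. (fst c, snd c + r)) ` set p"
  by (simp add: shift_def)

text \<open>
  The cells of a piece determine its listing: its tail is the cell of column 1 in the lowest row.
\<close>

lemma pieces_gf:
  assumes Q: "\<And>p. Q p \<Longrightarrow> walk p" "\<And>p. Q p \<Longrightarrow> fst (hd p) = 1"
    "\<And>p r. Q p \<Longrightarrow> Q (shift r p)"
  shows "has_gf rows length {p. Q p \<and> hd p = (1, y)} (gf (\<lambda>k n. card (pieces Q k n)))"
proof -
  have "has_gf rows length {p. Q p \<and> hd p = (1, 1)} (gf (\<lambda>k n. card (pieces Q k n)))"
    unfolding has_gf_def
  proof (intro allI)
    fix k n
    let ?A = "{p \<in> {p. Q p \<and> hd p = (1, 1)}. rows p = k \<and> length p = n}"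
    have fin: "finite ?A"
      by (rule finite_subset[OF _ finite_listings[of "(1, 1)" n]]) (use Q in auto)
    have props: "card (set p) = length p" "height (set p) = rows p" "Min (snd ` set p) = snd (hd p)"
      if "Q p" for p
      using walk_distinct[OF Q(1)[OF that]] walkD(1,5)[OF Q(1)[OF that]]
      by (auto simp: distinct_card height_listing Min_listing)
    have "bij_betw set ?A (pieces Q k n)"
      unfolding bij_betw_def
    proof
      show "inj_on set ?A" using listing_unique Q(1) by (auto simp: inj_on_def)
      show "set ` ?A = pieces Q k n"
      proof
        show "set ` ?A \<subseteq> pieces Q k n" using props unfolding pieces_def by fastforce
        show "pieces Q k n \<subseteq> set ` ?A"
        proof
          fix S assume "S \<in> pieces Q k n"
          then obtain p where p: "Q p" "set p = S" "Min (snd ` S) = 1" "height S = k" "card S = n"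
            unfolding pieces_def by blast
          then have "p \<in> ?A" using props[OF p(1)] Q(2)[OF p(1)] by (auto simp: prod_eq_iff)
          then show "S \<in> set ` ?A" using p(2) by blast
        qed
      qed
    qed
    then show "finite ?A \<and> of_nat (card ?A) = fps_nth (fps_nth (gf (\<lambda>k n. card (pieces Q k n))) k) n"
      using fin by (simp add: gf_def bij_betw_same_card)
  qed
  then show ?thesis
  proof (rule has_gf_bij)
    show "bij_betw (shift (y - 1)) {p. Q p \<and> hd p = (1, 1)} {p. Q p \<and> hd p = (1, y)}"
    proof (rule bij_betw_byWitness[where f' = "shift (1 - y)"])
      have "shift r p \<in> {p. Q p \<and> hd p = (1, z + r)}" if "Q p" "hd p = (1, z)" for p z r
        using that Q(3) shift_hd[of p r] walkD(1)[OF Q(1)] by auto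
      from this[of _ 1 "y - 1"] this[of _ y "1 - y"]
      show "shift (y - 1) ` {p. Q p \<and> hd p = (1, 1)} \<subseteq> {p. Q p \<and> hd p = (1, y)}"
        "shift (1 - y) ` {p. Q p \<and> hd p = (1, y)} \<subseteq> {p. Q p \<and> hd p = (1, 1)}"
        by auto
    qed (auto simp: shift_simps)
    show "rows (shift (y - 1) p) = rows p" if "p \<in> {p. Q p \<and> hd p = (1, 1)}" for p
      using that walkD(1)[OF Q(1)] by (auto simp: rows_def shift_hd shift_last)
  qed (simp add: shift_simps)
qed

text \<open>The geometric series; it agrees with the quotient because both solve
  \<open>F * (1 - t * q) = t * q\<close> and the factor can be cancelled.\<close>

lemma gfP_eq: "gfP = Abs_fps (\<lambda>k. if k = 0 then 0 else fps_X ^ k)" (is "_ = ?F")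
proof -
  have "?F * (1 - t * q) = t * q"
  proof (rule fps_ext)
    fix k
    have "?F * (1 - t * q) = ?F - fps_X * (?F * q)" by (simp add: t_def algebra_simps)
    moreover have "fps_nth (?F * q) k = (if k = 0 then 0 else fps_X ^ Suc k)" for k
      by (simp add: q_def)
    ultimately have "fps_nth (?F * (1 - t * q)) k =
        (if k = 0 then 0 else fps_X ^ k) - (if k \<le> 1 then 0 else fps_X ^ k)"
      by (cases k) (auto simp: fps_X_mult_nth)
    then show "fps_nth (?F * (1 - t * q)) k = fps_nth (t * q) k"
      by (cases k) (auto simp: t_def q_def fps_X_mult_nth)
  qed
  moreover have "gfP * (1 - t * q) = t * q"
    unfolding gfP_def by (rule series_divide) (simp add: t_def)
  moreover have "fps_nth (1 - t * q) 0 = 1" by (simp add: t_def)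
  then have "1 - t * q \<noteq> 0" by force
  ultimately show ?thesis by (metis mult_right_cancel)
qed

context strip begin

lemma pillar_gf:
  assumes "side (fst c)"
  shows "has_gf rows length {p. is_piece b Pillar p \<and> hd p = c} gfP"
  unfolding has_gf_def
proof (intro allI)
  fix k n
  let ?A = "{p \<in> {p. is_piece b Pillar p \<and> hd p = c}. rows p = k \<and> length p = n}"
  let ?p = "map (\<lambda>i. (fst c, snd c + int i)) [0..<n]"
  have rows: "rows p = length p" if "is_piece b Pillar p" for p
  proof -
    have "p \<noteq> []" "vertical p" using that by (auto simp: pillar_iff)
    then show ?thesis
      using vertical_nth[of p "length p - 1"] by (simp add: rows_def last_conv_nth Suc_le_eq nat_plus_as_int)
  qed
  have hdp: "hd ?p = c" if "n \<noteq> 0"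
    using that by (simp add: hd_map upt_rec[of 0 n])
  have "?A = (if k = n \<and> k \<noteq> 0 then {?p} else {})"
  proof (cases "k = n \<and> k \<noteq> 0")
    case True
    have "?p \<in> ?A"
      using True assms hdp rows[of ?p] by (simp add: pillar_iff vertical_map)
    moreover have "p = ?p" if "p \<in> ?A" for p
      using that vertical_eq[of p] by (auto simp: pillar_iff)
    ultimately show ?thesis using True by auto
  next
    case False
    then show ?thesis using rows by (auto simp: pillar_iff)
  qed
  then show "finite ?A \<and> of_nat (card ?A) = fps_nth (fps_nth gfP k) n"
    by (simp add: gfP_eq)
qed

lemma rows_mirror: "p \<noteq> [] \<Longrightarrow> rows (mirror b p) = rows p"
  by (simp add: rows_def mirror_def hd_map last_map)

lemma shape_shift: "shape X (shift r p) \<longleftrightarrow> shape X p"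
proof -
  have "shape X (shift r p)" if "shape X p" for p r
  proof -
    from that obtain c ys d where p: "p = c # ys @ [d]" "\<And>e. e \<in> set ys \<Longrightarrow> interior (fst e)"
        "end_columns X (fst c) (ys \<noteq> []) (fst d)" "walk (c # ys @ [d])"
      by (rule shapeE) blast
    have "walk (shift r (c # ys @ [d]))" using p(4) walk_shift by blast
    then show ?thesis
      unfolding p(1) shift_def list.map map_append
      by (rule shapeI) (use p(2,3) in auto)
  qed
  from this[of p r] this[of "shift r p" "-r"] show ?thesis by (auto simp: shift_simps)
qed

definition piece_gf :: "piece \<Rightarrow> series" where
  "piece_gf X = (case X of Pillar \<Rightarrow> gfP | Crossing \<Rightarrow> gfC b | Bubble \<Rightarrow> \<Sum>i=2..b - 1. gfB i
     | Lower_Ending \<Rightarrow> gfE b | Upper_Ending \<Rightarrow> gfE b)"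

lemma left_bubble_shift: "left_bubble r p \<Longrightarrow> left_bubble r (shift z p)"
proof -
  assume p: "left_bubble r p"
  then have L: "walk p" by (simp add: left_bubble_def pds_listing_iff_local)
  then have ne: "p \<noteq> []" by (rule walkD)
  have "set (shift z p) - {hd (shift z p), last (shift z p)} =
      (\<lambda>c. (fst c, snd c + z)) ` (set p - {hd p, last p})"
    using ne by (auto simp: shift_set shift_hd shift_last prod_eq_iff)
  then show ?thesis
    using p L ne unfolding left_bubble_def pds_listing_iff_local walk_shift
    by (simp add: shift_hd shift_last shift_set)
qed

lemma left_piece_gf:
  assumes "X \<in> {Crossing, Bubble, Upper_Ending}"
  shows "has_gf rows length {p. shape X p \<and> hd p = (1, y)} (piece_gf X)"
proof -
  have sh: "has_gf rows length {p. Q p \<and> hd p = (1, y)} (gf (\<lambda>k n. card (pieces Q k n)))"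
    if Q: "\<And>p. Q p \<longleftrightarrow> shape X p \<and> fst (hd p) = 1" for Q
  proof (rule pieces_gf)
    show "Q (shift r p)" if "Q p" for p r
      using that shape_nonempty[of X p] unfolding Q by (simp add: shape_shift shift_hd)
  qed (auto simp: Q shape_def)
  have eq: "{p. Q p \<and> hd p = (1, y)} = {p. shape X p \<and> hd p = (1, y)}"
    if "\<And>p. Q p \<longleftrightarrow> shape X p \<and> fst (hd p) = 1" for Q
    unfolding that by (rule Collect_cong) auto
  consider "X = Crossing" | "X = Upper_Ending" | "X = Bubble" using assms by auto
  then show ?thesis
  proof cases
    case 1
    then show ?thesis using sh[of "left_crossing b"] eq[of "left_crossing b"] left_crossing_iff
      by (simp add: piece_gf_def gfC_def)
  next
    case 2
    then show ?thesis using sh[of "left_ending b"] eq[of "left_ending b"] left_ending_iff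
      by (simp add: piece_gf_def gfE_def)
  next
    case 3
    \<comment> \<open>A bubble has exactly one width, so the union over \<open>r\<close> is disjoint
      and the series add up.\<close>
    have "has_gf rows length (\<Union>r\<in>{2..b - 1}. {p. left_bubble r p \<and> hd p = (1, y)}) (\<Sum>r=2..b - 1. gfB r)"
    proof (rule has_gf_UN_finite)
      show "has_gf rows length {p. left_bubble r p \<and> hd p = (1, y)} (gfB r)" for r
        unfolding gfB_def
      proof (rule pieces_gf)
        show "walk p" "fst (hd p) = 1" if "left_bubble r p" for p
          using that by (simp_all add: left_bubble_def pds_listing_iff_local)
      qed (rule left_bubble_shift)
      \<comment> \<open>A cell in column \<open>i >= 2\<close> is not one of the ends, which lie in
        column 1, so it is bound by the other width as well.\<close>
      have le: "i \<le> j" if p: "left_bubble i p" "left_bubble j p" and "2 \<le> i" for i j p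
      proof -
        obtain c where c: "c \<in> set p" "fst c = int i" using p(1) by (auto simp: left_bubble_def)
        moreover have "fst (hd p) = 1" "fst (last p) = 1" using p(1) by (auto simp: left_bubble_def)
        ultimately have "c \<in> set p - {hd p, last p}" using \<open>2 \<le> i\<close> by auto
        moreover have "\<forall>c\<in>set p - {hd p, last p}. fst c \<in> {2..int j}"
          using p(2) by (simp add: left_bubble_def)
        ultimately have "fst c \<in> {2..int j}" by blast
        then show ?thesis using c(2) by simp
      qed
      show "{p. left_bubble i p \<and> hd p = (1, y)} \<inter> {p. left_bubble j p \<and> hd p = (1, y)} = {}"
        if "i \<in> {2..b - 1}" "j \<in> {2..b - 1}" "i \<noteq> j" for i j
      proof -
        have "False" if "left_bubble i p" "left_bubble j p" for p
          using le[OF that] le[OF that(2,1)] \<open>i \<in> _\<close> \<open>j \<in> _\<close> \<open>i \<noteq> j\<close> by simp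
        then show ?thesis by auto
      qed
    qed simp
    moreover have "(\<Union>r\<in>{2..b - 1}. {p. left_bubble r p \<and> hd p = (1, y)}) = {p. shape X p \<and> hd p = (1, y)}"
    proof -
      have "shape X p \<longleftrightarrow> (\<exists>r\<in>{2..b - 1}. left_bubble r p)" if "hd p = (1, y)" for p
      proof -
        have "r \<in> {2..b - 1} \<longleftrightarrow> 2 \<le> r \<and> r < b" for r using width by auto
        then show ?thesis using left_bubble_iff[of p] that 3 by auto
      qed
      then show ?thesis by auto
    qed
    ultimately show ?thesis by (simp add: piece_gf_def 3)
  qed
qed

lemma shape_gf:
  assumes "X \<in> {Crossing, Bubble, Upper_Ending}" "side (fst c)"
  shows "has_gf rows length {p. shape X p \<and> hd p = c} (piece_gf X)"
proof (cases "fst c = 1")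
  case True
  then show ?thesis using left_piece_gf[OF assms(1), of "snd c"] by (metis prod.collapse)
next
  case False
  then have c: "c = (int b, snd c)" using assms(2) by (simp add: side_def prod_eq_iff)
  show ?thesis
    using left_piece_gf[OF assms(1), of "snd c"]
  proof (rule has_gf_bij)
    have *: "mirror b p \<in> {p. shape X p \<and> hd p = (int b + 1 - x, y)}" if "shape X p" "hd p = (x, y)" for p x y
      using that shape_nonempty[OF that(1)] shape_mirror[of X p] by (auto simp: mirror_def hd_map)
    show "bij_betw (mirror b) {p. shape X p \<and> hd p = (1, snd c)} {p. shape X p \<and> hd p = c}"
    proof (rule bij_betw_byWitness[where f' = "mirror b"])
      show "mirror b ` {p. shape X p \<and> hd p = (1, snd c)} \<subseteq> {p. shape X p \<and> hd p = c}"
        using *[of _ 1 "snd c"] c by force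
      show "mirror b ` {p. shape X p \<and> hd p = c} \<subseteq> {p. shape X p \<and> hd p = (1, snd c)}"
        using *[of _ "int b" "snd c"] c by force
    qed auto
    show "rows (mirror b p) = rows p" "length (mirror b p) = length p"
      if "p \<in> {p. shape X p \<and> hd p = (1, snd c)}" for p
      using that shape_nonempty[of X p] rows_mirror[of p] by (auto simp: mirror_def)
  qed
qed

lemma piece_gf:
  assumes "X \<noteq> Lower_Ending" "side (fst c)"
  shows "has_gf rows length {p. is_piece b X p \<and> hd p = c} (piece_gf X)"
proof (cases "X = Pillar")
  case True
  then show ?thesis using pillar_gf[OF assms(2)] by (simp add: piece_gf_def)
next
  case False
  then have "X \<in> {Crossing, Bubble, Upper_Ending}" using assms(1) by (cases X) auto
  then show ?thesis using shape_gf[OF _ assms(2)] is_piece_iff[OF False] by simp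
qed

text \<open>A lower ending is pinned down by the column of its top cell and by its lowest row, since
  its first cell lies at an unknown place in the interior. Turning it over gives an upper ending
  with a fixed first cell.\<close>

lemma lower_ending_gf:
  assumes "side x"
  shows "has_gf rows length {p. is_piece b Lower_Ending p \<and> snd (hd p) = 1 \<and> fst (last p) = x} (gfE b)"
proof -
  \<comment> \<open>A piece starting in row 1 is turned over within its own rows, which makes
    \<open>f\<close> its own inverse on the sets concerned.\<close>
  define f where "f p = rev (map (\<lambda>c :: cell. (fst c, snd (last p) + 1 - snd c)) p)" for p
  have ends: "hd (f p) = (fst (last p), 1)" "last (f p) = (fst (hd p), snd (last p) + 1 - snd (hd p))"
    if "p \<noteq> []" for p
    using that by (simp_all add: f_def hd_rev last_rev last_map hd_map)
  have ff: "f (f p) = p" if "p \<noteq> []" "snd (hd p) = 1" for p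
    using that by (simp add: f_def[of "f p"] ends) (simp add: f_def rev_map[symmetric] comp_def)
  have shape: "shape (flip X) (f p)" if "shape X p" for X p
    unfolding f_def using shape_flip[OF that] .
  have "has_gf rows length {p. shape Upper_Ending p \<and> hd p = (x, 1)} (piece_gf Upper_Ending)"
    using shape_gf[of Upper_Ending "(x, 1)"] assms by simp
  then have "has_gf rows length {p. shape Lower_Ending p \<and> snd (hd p) = 1 \<and> fst (last p) = x}
      (piece_gf Upper_Ending)"
  proof (rule has_gf_bij)
    show "bij_betw f {p. shape Upper_Ending p \<and> hd p = (x, 1)}
        {p. shape Lower_Ending p \<and> snd (hd p) = 1 \<and> fst (last p) = x}"
      by (rule bij_betw_byWitness[where f' = f])
        (use ff ends shape[of Upper_Ending] shape[of Lower_Ending] shape_nonempty in auto)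
    show "rows (f p) = rows p" if "p \<in> {p. shape Upper_Ending p \<and> hd p = (x, 1)}" for p
      using that ends[of p] shape_nonempty by (auto simp: rows_def)
  qed (simp add: f_def)
  then show ?thesis using is_piece_iff[of Lower_Ending] by (simp add: piece_gf_def)
qed

lemma piece_gf_0: "fps_nth (piece_gf X) 0 = 0"
proof -
  have "fps_nth (piece_gf X) 0 = 0" if "X \<noteq> Lower_Ending" for X
  proof (rule fps_ext)
    fix n
    have gf: "has_gf rows length {p. is_piece b X p \<and> hd p = (1, 1)} (piece_gf X)"
      by (rule piece_gf) (use that in \<open>auto simp: side_def\<close>)
    have "rows p > 0" if "is_piece b X p" for p
    proof -
      have "p \<noteq> []" "successively new_step p"
        using walkD(1,5)[OF piece_listing[OF that]] by auto
      then have "snd (hd p) \<le> snd (last p)" using rows_hd_last(1)[of p "last p"] by simp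
      then show ?thesis by (simp add: rows_def)
    qed
    then have "{p \<in> {p. is_piece b X p \<and> hd p = (1, 1)}. rows p = 0 \<and> length p = n} = {}" by auto
    then show "fps_nth (fps_nth (piece_gf X) 0) n = fps_nth 0 n"
      using has_gfD(2)[OF gf, of 0 n] by (simp only: card.empty of_nat_0 fps_zero_nth)
  qed
  from this[of X] this[of Upper_Ending] show ?thesis by (cases X) (auto simp: piece_gf_def)
qed

section \<open>Counting stackings\<close>

definition total :: "('a \<Rightarrow> nat) \<Rightarrow> 'a list \<Rightarrow> nat" where
  "total f ps = sum_list (map f ps)"

lemma total_simps [simp]: "total f [] = 0" "total f (p # ps) = f p + total f ps"
  by (simp_all add: total_def)

lemma piece_last_side:
  assumes "is_piece b X p" "X \<noteq> Upper_Ending"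
  shows "side (fst (last p))"
proof (cases "X = Pillar")
  case True
  then have "p \<noteq> []" "side (fst (hd p))" "vertical p" using assms by (auto simp: pillar_iff)
  then show ?thesis using vertical_column[of p "last p"] by simp
next
  case False
  then have "shape X p" using assms is_piece_iff by blast
  then show ?thesis by (rule shapeE) (use assms(2) in \<open>cases X; auto\<close>)
qed

lemma Cons_bij_Sigma:
  "bij_betw (\<lambda>x. fst x # snd x) (Sigma A B) {p # ps | p ps. p \<in> A \<and> ps \<in> B p}"
  by (auto simp: bij_betw_def inj_on_def prod_eq_iff image_iff)

text \<open>The series of a piece is the same for every starting cell in a side column. The
  conditions on endings ensure that every piece does start there: lower endings begin in the
  interior, and nothing can stand on an upper one.\<close>

lemma stk_gf:
  assumes "side (fst c)" "Lower_Ending \<notin> set w" "Upper_Ending \<notin> set (butlast w)"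
  shows "has_gf (total rows) (total length) {ps. stk c w ps} (weight piece_gf w)"
  using assms
proof (induction w arbitrary: c)
  case Nil
  then show ?case using has_gf_singleton[of "total rows" "[]" "total length"] by simp
next
  case (Cons X w)
  have X: "X \<noteq> Lower_Ending" using Cons.prems by auto
  have rest: "has_gf (total rows) (total length) {ps. stk (up (last p)) w ps} (weight piece_gf w)"
    if "is_piece b X p" for p
  proof (cases "w = []")
    case True
    then show ?thesis using has_gf_singleton[of "total rows" "[]" "total length"] by simp
  next
    case False
    then have "X \<noteq> Upper_Ending" using Cons.prems(3) by auto
    then have "side (fst (up (last p)))" using piece_last_side[OF that] by simp
    then show ?thesis using Cons.IH Cons.prems False by simp
  qed
  have "has_gf (\<lambda>x. rows (fst x) + total rows (snd x)) (\<lambda>x. length (fst x) + total length (snd x))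
      (SIGMA p:{p. is_piece b X p \<and> hd p = c}. {ps. stk (up (last p)) w ps}) (piece_gf X * weight piece_gf w)"
    by (rule has_gf_Sigma[OF piece_gf[OF X Cons.prems(1)]]) (use rest in blast)
  then have "has_gf (total rows) (total length)
      {p # ps | p ps. p \<in> {p. is_piece b X p \<and> hd p = c} \<and> ps \<in> {ps. stk (up (last p)) w ps}}
      (piece_gf X * weight piece_gf w)"
    by (rule has_gf_bij[OF _ Cons_bij_Sigma]) auto
  moreover have "{p # ps | p ps. p \<in> {p. is_piece b X p \<and> hd p = c} \<and> ps \<in> {ps. stk (up (last p)) w ps}} =
      {ps. stk c (X # w) ps}"
    by (auto elim!: stk_ConsE)
  ultimately show ?case by simp
qed

definition stackings :: "piece list \<Rightarrow> cell list list set" where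
  "stackings w = {ps. stacking b w ps \<and> snd (hd (concat ps)) = 1}"

text \<open>The factor 2 stands for the side column in which the lowest crossing or bubble starts.\<close>

lemma stackings_gf_side:
  assumes "w \<noteq> []" "Lower_Ending \<notin> set w" "Upper_Ending \<notin> set (butlast w)"
  shows "has_gf (total rows) (total length) (stackings w) (2 * weight piece_gf w)"
proof -
  have "stackings w = {ps. stk (1, 1) w ps} \<union> {ps. stk (int b, 1) w ps}"
  proof (intro set_eqI iffI)
    fix ps assume "ps \<in> stackings w"
    then have ps: "stk (hd (concat ps)) w ps" "snd (hd (concat ps)) = 1"
      using stacking_iff_stk[OF assms(1)] by (auto simp: stackings_def)
    obtain X v where w: "w = X # v" using assms(1) by (cases w) auto
    from ps(1)[unfolded w] have "side (fst (hd (concat ps)))"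
    proof (rule stk_ConsE)
      fix p assume "is_piece b X p" "hd p = hd (concat ps)"
      moreover have "X \<noteq> Lower_Ending" using w assms(2) by auto
      ultimately show ?thesis using piece_hd_side[of X p] by simp
    qed
    then have "hd (concat ps) = (1, 1) \<or> hd (concat ps) = (int b, 1)"
      using ps(2) by (auto simp: side_def prod_eq_iff)
    then show "ps \<in> {ps. stk (1, 1) w ps} \<union> {ps. stk (int b, 1) w ps}" using ps(1) by auto
  next
    fix ps assume "ps \<in> {ps. stk (1, 1) w ps} \<union> {ps. stk (int b, 1) w ps}"
    then obtain x where "stk (x, 1) w ps" by blast
    then show "ps \<in> stackings w"
      using stk_hd[of "(x, 1)" w ps] stacking_iff_stk[OF assms(1), of ps] assms(1) by (simp add: stackings_def)
  qed
  moreover have "{ps. stk (1, 1) w ps} \<inter> {ps. stk (int b, 1) w ps} = {}"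
    using stk_hd[of "(1, 1)" w] stk_hd[of "(int b, 1)" w] assms(1) width by fastforce
  moreover have "has_gf (total rows) (total length) {ps. stk (1, 1) w ps} (weight piece_gf w)"
    "has_gf (total rows) (total length) {ps. stk (int b, 1) w ps} (weight piece_gf w)"
    by (rule stk_gf; use assms in \<open>simp add: side_def\<close>)+
  ultimately show ?thesis using has_gf_Un by (simp only: mult_2)
qed

text \<open>Now the lowest cell is interior, so the factor 2 is the choice of the side at which the
  lower ending arrives; everything above starts from that side.\<close>

lemma stackings_gf_lower_ending:
  assumes "w \<noteq> []" "Lower_Ending \<notin> set w" "Upper_Ending \<notin> set (butlast w)"
  shows "has_gf (total rows) (total length) (stackings (Lower_Ending # w)) (2 * weight piece_gf (Lower_Ending # w))"
proof -
  let ?L = "\<lambda>x. {p. is_piece b Lower_Ending p \<and> snd (hd p) = 1 \<and> fst (last p) = x}"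
  have "has_gf rows length (?L 1 \<union> ?L (int b)) (gfE b + gfE b)"
    by (rule has_gf_Un[OF lower_ending_gf lower_ending_gf]) (use width in \<open>auto simp: side_def\<close>)
  moreover have "?L 1 \<union> ?L (int b) = {p. is_piece b Lower_Ending p \<and> snd (hd p) = 1}"
  proof -
    have "fst (last p) = 1 \<or> fst (last p) = int b" if "is_piece b Lower_Ending p" for p
      using piece_last_side[OF that] by (simp add: side_def)
    then show ?thesis by blast
  qed
  ultimately have L: "has_gf rows length {p. is_piece b Lower_Ending p \<and> snd (hd p) = 1} (2 * gfE b)"
    by (simp only: mult_2)
  have "has_gf (\<lambda>x. rows (fst x) + total rows (snd x)) (\<lambda>x. length (fst x) + total length (snd x))
      (SIGMA p:{p. is_piece b Lower_Ending p \<and> snd (hd p) = 1}. {ps. stk (up (last p)) w ps})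
      (2 * gfE b * weight piece_gf w)"
  proof (rule has_gf_Sigma[OF L])
    fix p assume "p \<in> {p. is_piece b Lower_Ending p \<and> snd (hd p) = 1}"
    then have "side (fst (up (last p)))" using piece_last_side[of Lower_Ending p] by simp
    then show "has_gf (total rows) (total length) {ps. stk (up (last p)) w ps} (weight piece_gf w)"
      by (rule stk_gf[OF _ assms(2,3)])
  qed
  then have "has_gf (total rows) (total length)
      {p # ps | p ps. p \<in> {p. is_piece b Lower_Ending p \<and> snd (hd p) = 1} \<and> ps \<in> {ps. stk (up (last p)) w ps}}
      (2 * gfE b * weight piece_gf w)"
    by (rule has_gf_bij[OF _ Cons_bij_Sigma]) auto
  moreover have "{p # ps | p ps. p \<in> {p. is_piece b Lower_Ending p \<and> snd (hd p) = 1} \<and>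
      ps \<in> {ps. stk (up (last p)) w ps}} = stackings (Lower_Ending # w)"
  proof (intro set_eqI iffI)
    fix ps assume "ps \<in> stackings (Lower_Ending # w)"
    then have "stk (hd (concat ps)) (Lower_Ending # w) ps" "snd (hd (concat ps)) = 1"
      using stacking_iff_stk[of "Lower_Ending # w" ps] by (auto simp: stackings_def)
    then show "ps \<in> {p # ps | p ps. p \<in> {p. is_piece b Lower_Ending p \<and> snd (hd p) = 1} \<and>
        ps \<in> {ps. stk (up (last p)) w ps}}"
      by (elim stk_ConsE) auto
  next
    fix qs assume "qs \<in> {p # ps | p ps. p \<in> {p. is_piece b Lower_Ending p \<and> snd (hd p) = 1} \<and>
        ps \<in> {ps. stk (up (last p)) w ps}}"
    then obtain p ps where q: "qs = p # ps" "is_piece b Lower_Ending p" "snd (hd p) = 1"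
        "stk (up (last p)) w ps" by blast
    then have hd: "hd (concat qs) = hd p" using piece_nonempty[OF q(2)] by simp
    have "stk (hd p) (Lower_Ending # w) qs" using q(2,4) unfolding q(1) stk.simps by blast
    then show "qs \<in> stackings (Lower_Ending # w)"
      using hd q(3) stacking_iff_stk[of "Lower_Ending # w" qs] by (simp add: stackings_def)
  qed
  ultimately show ?thesis by (simp add: piece_gf_def mult.assoc)
qed

end

section \<open>The words of the four families\<close>

text \<open>The words of the upside-down reflections of stackings of \<open>form2\<close>: a word is
  read backwards and its two kinds of endings are exchanged.\<close>

definition form2_reversed :: "piece list set" where
  "form2_reversed = lower \<cdot> {[Bubble]} \<cdot> star {[Pillar, Crossing], [Pillar, Bubble]} \<cdot>
     {[Pillar, Crossing]} \<cdot> upper"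

lemma conc_iff: "w \<in> U \<cdot> V \<longleftrightarrow> (\<exists>u v. u \<in> U \<and> v \<in> V \<and> w = u @ v)"
  by (auto simp: conc_def)

context strip begin

lemma star_inter: "star ((\<lambda>x. [Pillar, x]) ` A) = inter ` lists A"
proof -
  have "star U = concat ` lists U" for U :: "piece list set"
    by (auto simp: star_def lists_eq_set)
  moreover have "concat ` (map (\<lambda>x. [Pillar, x]) ` lists A) = inter ` lists A"
    by (simp add: image_image inter_def)
  ultimately show ?thesis by (simp add: lists_image)
qed

lemma star_inters:
  "star {[Pillar, Crossing], [Pillar, Bubble]} = inter ` lists {Crossing, Bubble}"
  "star {[Pillar, Bubble]} = inter ` lists {Bubble}"
  using star_inter[of "{Crossing, Bubble}"] star_inter[of "{Bubble}"] by simp_all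

text \<open>An invariant that tells the families apart and locates cuts in words, since pillars and
  endings do not affect it.\<close>

definition main_pieces :: "piece list \<Rightarrow> piece list" where
  "main_pieces w = filter (\<lambda>X. X = Crossing \<or> X = Bubble) w"

lemma main_pieces_simps [simp]:
  "main_pieces [] = []" "main_pieces (u @ v) = main_pieces u @ main_pieces v"
  "main_pieces (X # w) = (if X = Crossing \<or> X = Bubble then X # main_pieces w else main_pieces w)"
  by (auto simp: main_pieces_def)

lemma main_pieces_inter: "xs \<in> lists {Crossing, Bubble} \<Longrightarrow> main_pieces (inter xs) = xs"
  by (induction xs) auto

lemma main_pieces_ends: "u \<in> lower \<Longrightarrow> main_pieces u = []" "u \<in> upper \<Longrightarrow> main_pieces u = []"
  by (auto simp: lower_def upper_def)

definition words :: "piece list set \<Rightarrow> piece list set" where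
  "words M = {lo @ x # inter xs @ u | lo x xs u. lo \<in> lower \<and> u \<in> upper \<and> x # xs \<in> M}"

lemma concI: "u \<in> A \<Longrightarrow> v \<in> B \<Longrightarrow> u @ v \<in> A \<cdot> B"
  unfolding conc_iff by blast

lemma wordsI:
  "w = lo @ x # inter xs @ u \<Longrightarrow> lo \<in> lower \<Longrightarrow> u \<in> upper \<Longrightarrow> x # xs \<in> M \<Longrightarrow> w \<in> words M"
  unfolding words_def by blast

lemma wordsE:
  assumes "w \<in> words M"
  obtains lo x xs u where "w = lo @ x # inter xs @ u" "lo \<in> lower" "u \<in> upper" "x # xs \<in> M"
  using assms unfolding words_def by blast

lemma two_ends_words:
  "lower \<cdot> {[x]} \<cdot> star {[Pillar, Crossing], [Pillar, Bubble]} \<cdot> {[Pillar, y]} \<cdot> upper =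
     words {x # ys @ [y] | ys. ys \<in> lists {Crossing, Bubble}}" (is "?L = words ?M")
proof (intro set_eqI iffI)
  fix w assume "w \<in> ?L"
  then obtain lo ys u where w: "w = lo @ [x] @ inter ys @ [Pillar, y] @ u" "lo \<in> lower" "u \<in> upper"
      "ys \<in> lists {Crossing, Bubble}"
    unfolding conc_iff star_inters by blast
  show "w \<in> words ?M" by (rule wordsI[of _ lo x "ys @ [y]" u]) (use w in auto)
next
  fix w assume "w \<in> words ?M"
  then obtain lo x' xs u where w': "w = lo @ x' # inter xs @ u" "lo \<in> lower" "u \<in> upper" "x' # xs \<in> ?M"
    by (rule wordsE)
  then obtain ys where "x' # xs = x # ys @ [y]" "ys \<in> lists {Crossing, Bubble}" by blast
  with w' have w: "w = lo @ [x] @ inter ys @ [Pillar, y] @ u" "ys \<in> lists {Crossing, Bubble}" by simp_all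
  show "w \<in> ?L" unfolding w(1) star_inters by (intro concI) (use w w' in auto)
qed

lemma form1_words: "form1 = words {Crossing # ys @ [Crossing] | ys. ys \<in> lists {Crossing, Bubble}}"
  unfolding form1_def by (rule two_ends_words)

lemma form2_words: "form2 = words {Crossing # ys @ [Bubble] | ys. ys \<in> lists {Crossing, Bubble}}"
  unfolding form2_def by (rule two_ends_words)

lemma form2_reversed_words:
  "form2_reversed = words {Bubble # ys @ [Crossing] | ys. ys \<in> lists {Crossing, Bubble}}"
  unfolding form2_reversed_def by (rule two_ends_words)

lemma form3_words:
  "form3 = words {Bubble # ys @ [Crossing] @ zs @ [Bubble] | ys zs.
     ys \<in> lists {Bubble} \<and> zs \<in> lists {Crossing, Bubble}}" (is "_ = words ?M")
proof (intro set_eqI iffI)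
  fix w assume "w \<in> form3"
  then obtain lo ys zs u where
    w: "w = lo @ [Bubble] @ inter ys @ [Pillar, Crossing] @ inter zs @ [Pillar, Bubble] @ u"
      "lo \<in> lower" "u \<in> upper" "ys \<in> lists {Bubble}" "zs \<in> lists {Crossing, Bubble}"
    unfolding form3_def conc_iff star_inters by blast
  show "w \<in> words ?M"
    by (rule wordsI[of _ lo Bubble "ys @ [Crossing] @ zs @ [Bubble]" u]) (use w in auto)
next
  fix w assume "w \<in> words ?M"
  then obtain lo x xs u where w': "w = lo @ x # inter xs @ u" "lo \<in> lower" "u \<in> upper" "x # xs \<in> ?M"
    by (rule wordsE)
  then obtain ys zs where "x # xs = Bubble # ys @ [Crossing] @ zs @ [Bubble]"
      and yz: "ys \<in> lists {Bubble}" "zs \<in> lists {Crossing, Bubble}" by blast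
  with w' have w: "w = lo @ [Bubble] @ inter ys @ [Pillar, Crossing] @ inter zs @ [Pillar, Bubble] @ u"
    by simp
  show "w \<in> form3" unfolding form3_def w(1) star_inters by (intro concI) (use w' yz in auto)
qed

lemma form4_words: "form4 = words {[Crossing]}"
proof (intro set_eqI iffI)
  fix w assume "w \<in> form4"
  then obtain lo u where w: "w = lo @ [Crossing] @ u" "lo \<in> lower" "u \<in> upper"
    unfolding form4_def conc_iff by blast
  show "w \<in> words {[Crossing]}" by (rule wordsI[of _ lo Crossing "[]" u]) (use w in auto)
next
  fix w assume "w \<in> words {[Crossing]}"
  then obtain lo u where w: "w = lo @ [Crossing] @ u" "lo \<in> lower" "u \<in> upper"
    by (rule wordsE) auto
  show "w \<in> form4" unfolding form4_def w(1) by (intro concI) (use w in auto)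
qed

definition all_words :: "piece list set" where
  "all_words = words {xs \<in> lists {Crossing, Bubble}. Crossing \<in> set xs}"

lemma words_Un: "words (M \<union> N) = words M \<union> words N"
  unfolding words_def by blast

lemma words_main_pieces:
  assumes "w \<in> words M" "M \<subseteq> lists {Crossing, Bubble}"
  shows "main_pieces w \<in> M"
proof -
  obtain lo x xs u where w: "w = lo @ x # inter xs @ u" "lo \<in> lower" "u \<in> upper" "x # xs \<in> M"
    using assms(1) unfolding words_def by blast
  then have "x # xs \<in> lists {Crossing, Bubble}" using assms(2) by blast
  then have "main_pieces w = x # xs" using w by (auto simp: main_pieces_ends main_pieces_inter)
  then show ?thesis using w by simp
qed

lemma words_disjoint:
  assumes "M \<inter> N = {}" "M \<subseteq> lists {Crossing, Bubble}" "N \<subseteq> lists {Crossing, Bubble}"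
  shows "words M \<inter> words N = {}"
  using words_main_pieces assms by blast

text \<open>Sort by the first and last crossing or bubble: two crossings, one of each in either
  order, two bubbles, or one crossing alone.\<close>

lemma all_words_forms: "all_words = form1 \<union> (form2 \<union> form2_reversed) \<union> form3 \<union> form4"
proof -
  have "xs \<in> {Crossing # ys @ [Crossing] | ys. ys \<in> lists {Crossing, Bubble}}
      \<union> ({Crossing # ys @ [Bubble] | ys. ys \<in> lists {Crossing, Bubble}}
       \<union> {Bubble # ys @ [Crossing] | ys. ys \<in> lists {Crossing, Bubble}})
      \<union> {Bubble # ys @ [Crossing] @ zs @ [Bubble] | ys zs.
           ys \<in> lists {Bubble} \<and> zs \<in> lists {Crossing, Bubble}}
      \<union> {[Crossing]}" (is "_ \<in> ?R")
    if xs: "xs \<in> lists {Crossing, Bubble}" "Crossing \<in> set xs" for xs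
  proof -
    obtain x xs' where xs': "xs = x # xs'" using xs(2) by (cases xs) auto
    show ?thesis
    proof (cases xs' rule: rev_cases)
      case Nil
      then show ?thesis using xs xs' by auto
    next
      case (snoc ys z)
      have mem: "x \<in> {Crossing, Bubble}" "z \<in> {Crossing, Bubble}" "ys \<in> lists {Crossing, Bubble}"
        using xs(1) xs' snoc by auto
      show ?thesis
      proof (cases "x = Bubble \<and> z = Bubble")
        case True
        then have "Crossing \<in> set ys" using xs(2) xs' snoc by auto
        \<comment> \<open>\<open>form3\<close> is cut at the first crossing, so that only bubbles
          precede it.\<close>
        then obtain us vs where us: "ys = us @ Crossing # vs" "Crossing \<notin> set us"
          by (meson split_list_first)
        then have "us \<in> lists {Bubble}" "vs \<in> lists {Crossing, Bubble}" using mem(3) by auto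
        then have "xs \<in> {Bubble # ys @ [Crossing] @ zs @ [Bubble] | ys zs.
            ys \<in> lists {Bubble} \<and> zs \<in> lists {Crossing, Bubble}}"
          using True xs' snoc us by auto
        then show ?thesis by blast
      next
        case False
        then consider "x = Crossing" "z = Crossing" | "x = Crossing" "z = Bubble" | "x = Bubble" "z = Crossing"
          using mem by blast
        then show ?thesis using xs' snoc mem(3) by cases auto
      qed
    qed
  qed
  moreover have "?R \<subseteq> {xs \<in> lists {Crossing, Bubble}. Crossing \<in> set xs}"
    by auto
  ultimately have "{xs \<in> lists {Crossing, Bubble}. Crossing \<in> set xs} = ?R" by blast
  then show ?thesis
    unfolding all_words_def form1_words form2_words form2_reversed_words form3_words form4_words
    by (simp only: words_Un)
qed

lemma forms_disjoint:
  "form1 \<inter> (form2 \<union> form2_reversed) = {}" "form2 \<inter> form2_reversed = {}"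
  "(form1 \<union> (form2 \<union> form2_reversed)) \<inter> form3 = {}"
  "(form1 \<union> (form2 \<union> form2_reversed) \<union> form3) \<inter> form4 = {}"
  unfolding form1_words form2_words form2_reversed_words form3_words form4_words words_Un[symmetric]
  by (rule words_disjoint; fastforce)+

lemma core_all_words: "lo \<in> lower \<Longrightarrow> w \<in> core \<Longrightarrow> Crossing \<in> set w \<Longrightarrow> lo @ w \<in> all_words"
proof -
  assume lo: "lo \<in> lower" and w: "w \<in> core" "Crossing \<in> set w"
  then obtain x xs u where w': "w = x # inter xs @ u" "set (x # xs) \<subseteq> {Crossing, Bubble}" "u \<in> upper"
    unfolding core_def by blast
  have "Crossing \<notin> set u" using w'(3) by (auto simp: upper_def)
  then have "Crossing \<in> set (x # xs)" using w(2) w'(1) by (auto simp: set_inter split: if_splits)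
  moreover have "x # xs \<in> lists {Crossing, Bubble}" using w'(2) by (simp only: in_lists_conv_set) blast
  ultimately show ?thesis unfolding all_words_def words_def using lo w' by blast
qed

lemma all_words_structure:
  assumes "w \<in> all_words"
  obtains lo x xs u where "w = lo @ x # inter xs @ u" "lo \<in> lower" "u \<in> upper"
    "x \<in> {Crossing, Bubble}" "set xs \<subseteq> {Crossing, Bubble}" "Crossing \<in> set w" "Crossing \<in> set (x # xs)"
proof -
  obtain lo x xs u where w: "w = lo @ x # inter xs @ u" "lo \<in> lower" "u \<in> upper"
      "x # xs \<in> lists {Crossing, Bubble}" "Crossing \<in> set (x # xs)"
    using assms unfolding all_words_def words_def by blast
  then have "Crossing \<in> set w" by (auto simp: set_inter)
  then show ?thesis using that[of lo x xs u] w by (auto simp: in_lists_conv_set)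
qed

lemma all_words_alternating: "w \<in> all_words \<Longrightarrow> alternating w"
proof (erule all_words_structure)
  fix lo x xs u
  assume w: "w = lo @ x # inter xs @ u" "lo \<in> lower" "u \<in> upper"
    "x \<in> {Crossing, Bubble}" "set xs \<subseteq> {Crossing, Bubble}"
  have u: "alternating u" "u = [] \<or> hd u = Pillar" using w(3) by (auto simp: upper_def alternating_def)
  have "alternating (x # inter xs @ u)" if "x \<noteq> Pillar" "set xs \<subseteq> {Crossing, Bubble}" for x
    using that
  proof (induction xs arbitrary: x)
    case Nil
    then show ?case using u by (auto simp: alternating_Cons)
  next
    case (Cons y xs)
    then show ?case by (auto simp: alternating_Cons)
  qed
  then have *: "alternating (x # inter xs @ u)" using w by blast
  have "x \<noteq> Pillar" using w(4) by auto
  then show "alternating w" using w(1,2) * by (auto simp: lower_def alternating_Cons)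
qed

lemma all_words_stackings_gf:
  assumes "w \<in> all_words"
  shows "has_gf (total rows) (total length) (stackings w) (2 * weight piece_gf w)"
  using assms
proof (rule all_words_structure)
  fix lo x xs u
  assume w: "w = lo @ x # inter xs @ u" "lo \<in> lower" "u \<in> upper"
    "x \<in> {Crossing, Bubble}" "set xs \<subseteq> {Crossing, Bubble}"
  let ?v = "x # inter xs @ u"
  have v: "Lower_Ending \<notin> set ?v"
    using w(3-5) by (auto simp: upper_def set_inter split: if_splits)
  have "Upper_Ending \<notin> set (x # inter xs)" using w(4,5) by (auto simp: set_inter split: if_splits)
  moreover have "Upper_Ending \<notin> set (butlast u)" using w(3) by (auto simp: upper_def)
  moreover have "butlast ?v = (if u = [] then butlast (x # inter xs) else (x # inter xs) @ butlast u)"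
    using butlast_append[of "x # inter xs" u] by simp
  ultimately have v': "Upper_Ending \<notin> set (butlast ?v)" by (auto dest: in_set_butlastD simp del: butlast.simps)
  consider "lo = []" | "lo = [Pillar]" | "lo = [Lower_Ending, Pillar]" using w(2) by (auto simp: lower_def)
  then show ?thesis
  proof cases
    case 1
    then show ?thesis using stackings_gf_side[of ?v] v v' w(1) by simp
  next
    case 2
    then show ?thesis using stackings_gf_side[of "Pillar # ?v"] v v' w(1) by simp
  next
    case 3
    then show ?thesis using stackings_gf_lower_ending[of "Pillar # ?v"] v v' w(1) by simp
  qed
qed

subsection \<open>Their generating functions\<close>

abbreviation G :: "piece list set \<Rightarrow> series" where "G \<equiv> language_gf piece_gf"

lemmas G_conc = language_gf_conc[where g = piece_gf, OF piece_gf_0]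
lemmas G_singleton = language_gf_singleton[where g = piece_gf, OF piece_gf_0]
lemmas G_insert = language_gf_insert[where g = piece_gf, OF piece_gf_0]
lemmas G_Un = language_gf_union[where g = piece_gf, OF piece_gf_0]
lemmas G_empty = language_gf_empty[where g = piece_gf, OF piece_gf_0]
lemmas G_star = language_gf_star[where g = piece_gf, OF piece_gf_0]

abbreviation \<Sigma> :: series where "\<Sigma> \<equiv> \<Sum>i=2..b - 1. gfB i"

lemma piece_gf_simps [simp]:
  "piece_gf Pillar = gfP" "piece_gf Crossing = gfC b" "piece_gf Bubble = \<Sigma>"
  "piece_gf Lower_Ending = gfE b" "piece_gf Upper_Ending = gfE b"
  by (simp_all add: piece_gf_def)

abbreviation S :: series where "S \<equiv> G (star {[Pillar, Crossing], [Pillar, Bubble]})"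
abbreviation S' :: series where "S' \<equiv> G (star {[Pillar, Bubble]})"
abbreviation U :: series where "U \<equiv> 1 + gfP * (1 + gfE b)"

lemma G_ends: "G lower = U" "G upper = U"
  by (simp_all add: lower_def upper_def G_insert G_empty algebra_simps)

lemma G_stars: "S * (1 - gfP * (gfC b + \<Sigma>)) = 1" "S' * (1 - gfP * \<Sigma>) = 1"
proof -
  have "S * (1 - G {[Pillar, Crossing], [Pillar, Bubble]}) = 1"
    by (rule G_star[where m = 2]) auto
  then show "S * (1 - gfP * (gfC b + \<Sigma>)) = 1" by (simp add: G_insert G_empty distrib_left)
  have "S' * (1 - G {[Pillar, Bubble]}) = 1"
    by (rule G_star[where m = 2]) auto
  then show "S' * (1 - gfP * \<Sigma>) = 1" by (simp add: G_insert G_empty)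
qed

text \<open>The cut lies just before the first crossing or bubble.\<close>

lemma unambiguous_lower:
  assumes "\<And>v. v \<in> V \<Longrightarrow> v \<noteq> [] \<and> hd v \<in> {Crossing, Bubble}"
  shows "unambiguous lower V"
proof (rule unambiguousI[where f = "\<lambda>w. length (takeWhile (\<lambda>X. X \<notin> {Crossing, Bubble}) w)"])
  fix u v assume "u \<in> lower" "v \<in> V"
  then show "length (takeWhile (\<lambda>X. X \<notin> {Crossing, Bubble}) (u @ v)) = length u"
    using assms[of v] by (cases v) (auto simp: lower_def)
qed

lemma unambiguous_singleton: "unambiguous {u} V"
  by (rule unambiguousI[where f = "\<lambda>_. length u"]) simp

text \<open>The second factor may begin with a block that also occurs in the star, so the cut is
  found by counting from the end: all but the last \<open>m\<close> main pieces belong to the star,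
  and each of them takes two letters there.\<close>

lemma unambiguous_star:
  assumes "\<And>v. v \<in> V \<Longrightarrow> length (main_pieces v) = m"
  shows "unambiguous (star {[Pillar, Crossing], [Pillar, Bubble]}) V"
proof (rule unambiguousI[where f = "\<lambda>w. 2 * (length (main_pieces w) - m)"])
  fix u v assume uv: "u \<in> star {[Pillar, Crossing], [Pillar, Bubble]}" "v \<in> V"
  have "length (inter xs) = 2 * length xs" for xs by (induction xs) auto
  moreover obtain xs where "u = inter xs" "xs \<in> lists {Crossing, Bubble}"
    using uv(1) unfolding star_inters by blast
  ultimately show "2 * (length (main_pieces (u @ v)) - m) = length u"
    using uv(2) assms main_pieces_inter by simp
qed

text \<open>The first crossing marks the cut. The pillar just before it already belongs to the
  second factor, hence \<open>- 1\<close>.\<close>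

lemma unambiguous_star_bubbles:
  assumes "\<And>v. v \<in> V \<Longrightarrow> \<exists>v'. v = Pillar # Crossing # v'"
  shows "unambiguous (star {[Pillar, Bubble]}) V"
proof (rule unambiguousI[where f = "\<lambda>w. length (takeWhile (\<lambda>X. X \<noteq> Crossing) w) - 1"])
  fix u v assume uv: "u \<in> star {[Pillar, Bubble]}" "v \<in> V"
  obtain v' where v: "v = Pillar # Crossing # v'" using assms uv(2) by blast
  have "\<forall>X\<in>set u. X \<noteq> Crossing" using uv(1) by (auto simp: star_inters set_inter split: if_splits)
  then show "length (takeWhile (\<lambda>X. X \<noteq> Crossing) (u @ v)) - 1 = length u"
    by (simp add: v)
qed

lemma hd_singleton_conc:
  "v \<in> {[x]} \<cdot> V \<Longrightarrow> x \<in> {Crossing, Bubble} \<Longrightarrow> v \<noteq> [] \<and> hd v \<in> {Crossing, Bubble}"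
  by (auto simp: conc_iff)

lemma main_pieces_tail: "v \<in> {[Pillar, x]} \<cdot> upper \<Longrightarrow> x \<in> {Crossing, Bubble} \<Longrightarrow> length (main_pieces v) = 1"
  by (auto simp: conc_iff main_pieces_ends)

lemma G_two_ends:
  assumes "x \<in> {Crossing, Bubble}" "y \<in> {Crossing, Bubble}"
  shows "G (lower \<cdot> {[x]} \<cdot> star {[Pillar, Crossing], [Pillar, Bubble]} \<cdot> {[Pillar, y]} \<cdot> upper) =
     U * (piece_gf x * (S * (gfP * piece_gf y * U)))"
proof -
  let ?T = "{[Pillar, y]} \<cdot> upper"
  have "G ?T = gfP * piece_gf y * U"
    by (simp add: G_conc[OF unambiguous_singleton] G_singleton G_ends)
  moreover have "G (star {[Pillar, Crossing], [Pillar, Bubble]} \<cdot> ?T) = S * G ?T"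
    by (rule G_conc[OF unambiguous_star]) (use main_pieces_tail assms(2) in blast)
  moreover have "G (lower \<cdot> {[x]} \<cdot> V) = U * (piece_gf x * G V)" for V
  proof -
    have "G (lower \<cdot> {[x]} \<cdot> V) = G lower * G ({[x]} \<cdot> V)"
      by (rule G_conc[OF unambiguous_lower], erule hd_singleton_conc, rule assms(1))
    then show ?thesis by (simp add: G_conc[OF unambiguous_singleton] G_singleton G_ends)
  qed
  ultimately show ?thesis by (simp only:)
qed

lemma G_form3: "G form3 = U * (\<Sigma> * (S' * (gfP * gfC b * (S * (gfP * \<Sigma> * U)))))"
proof -
  let ?T = "{[Pillar, Bubble]} \<cdot> upper"
  let ?R = "star {[Pillar, Crossing], [Pillar, Bubble]} \<cdot> ?T"
  have "G ?T = gfP * \<Sigma> * U"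
    by (simp add: G_conc[OF unambiguous_singleton] G_singleton G_ends)
  moreover have "G ?R = S * G ?T"
    by (rule G_conc[OF unambiguous_star]) (use main_pieces_tail in blast)
  moreover have "G ({[Pillar, Crossing]} \<cdot> ?R) = gfP * gfC b * G ?R"
    by (simp add: G_conc[OF unambiguous_singleton] G_singleton)
  moreover have "G (star {[Pillar, Bubble]} \<cdot> {[Pillar, Crossing]} \<cdot> ?R) = S' * G ({[Pillar, Crossing]} \<cdot> ?R)"
    by (rule G_conc[OF unambiguous_star_bubbles]) (auto simp: conc_iff)
  moreover have "G ({[Bubble]} \<cdot> V) = \<Sigma> * G V" for V
    by (simp add: G_conc[OF unambiguous_singleton] G_singleton)
  moreover have "G (lower \<cdot> {[Bubble]} \<cdot> V) = U * G ({[Bubble]} \<cdot> V)" for V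
    by (subst G_conc[OF unambiguous_lower]) (erule hd_singleton_conc, auto simp: G_ends)
  ultimately show ?thesis unfolding form3_def by (simp only:)
qed

lemma G_form4: "G form4 = U * (gfC b * U)"
proof -
  have "G form4 = G lower * G ({[Crossing]} \<cdot> upper)"
    unfolding form4_def by (rule G_conc[OF unambiguous_lower], erule hd_singleton_conc) simp
  then show ?thesis by (simp add: G_conc[OF unambiguous_singleton] G_singleton G_ends)
qed

lemma divide_by_unit:
  fixes f D R :: series
  assumes "R * D = 1" "fps_nth D 0 = 1"
  shows "f / D = f * R"
proof -
  have "f / D = f / D * D * R" using assms(1) by (simp add: mult.assoc mult.commute)
  then show ?thesis using series_divide[OF assms(2), of f] by simp
qed

lemma divide_S: "f / (1 - gfP * (gfC b + \<Sigma>)) = f * S" and divide_S': "f / (1 - gfP * \<Sigma>) = f * S'"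
  using divide_by_unit[OF G_stars(1)] divide_by_unit[OF G_stars(2)]
    piece_gf_0[of Pillar] by (simp_all add: fps_mult_nth)

end

section \<open>From listings to snakes\<close>

lemma int_rows:
  assumes "walk p"
  shows "int (rows p) = snd (last p) - snd (hd p) + 1"
proof -
  have "snd (hd p) \<le> snd (last p)"
    using rows_hd_last(1)[OF walkD(5)[OF assms], of "last p"] walkD(1)[OF assms] by simp
  then show ?thesis by (simp add: rows_def)
qed

text \<open>In a path only the two ends have fewer than two neighbours.\<close>

lemma listing_unique_of_rows:
  assumes L: "walk L" and M: "walk M" and eq: "set L = set M" and "rows L \<ge> 2"
  shows "L = M"
proof (rule listing_unique[OF L M eq])
  have ne: "L \<noteq> []" "M \<noteq> []" using L M walkD(1) by auto
  then have "hd M \<in> set L" using eq by simp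
  then obtain i where i: "i < length L" "L ! i = hd M" by (metis in_set_conv_nth)
  \<comment> \<open>Both walks begin in the lowest row, so with two rows the first cell of
    \<open>M\<close> cannot be the last cell of \<open>L\<close>.\<close>
  have "snd (hd M) = snd (hd L)"
    using Min_listing[OF walkD(5)[OF L] ne(1)] Min_listing[OF walkD(5)[OF M] ne(2)] eq
    by simp
  moreover have "snd (last L) \<noteq> snd (hd L)" using assms(4) int_rows[OF L] by auto
  ultimately have "L ! i \<noteq> last L" using i(2) by auto
  then have si: "Suc i < length L"
    using i(1) ne(1) by (metis Suc_lessI diff_Suc_1 last_conv_nth)
  have "i = 0"
  proof (rule ccontr)
    assume "i \<noteq> 0"
    obtain M' where M': "M = hd M # M'" using ne(2) by (cases M) auto
    have nb: "d = hd M'" if "d \<in> set L" "adj (hd M) d" for d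
    proof -
      have "d \<in> set M'" using that eq M' not_adj_self by (metis set_ConsD)
      then show ?thesis using walk_head(2)[of "hd M" M' d] M M' that(2) by simp
    qed
    have "adj (L ! i) (L ! Suc i)" "adj (L ! i) (L ! (i - 1))"
      using walkD(2)[OF L, of i] walkD(2)[OF L, of "i - 1"] si \<open>i \<noteq> 0\<close>
      by (auto intro: new_step_adj adj_sym)
    then have "L ! Suc i = L ! (i - 1)" using nb[of "L ! Suc i"] nb[of "L ! (i - 1)"] i si by simp
    then show False
      using walk_distinct[OF L] si \<open>i \<noteq> 0\<close> by (simp add: nth_eq_iff_index_eq)
  qed
  then show "hd L = hd M" using i ne by (simp add: hd_conv_nth)
qed

context strip begin

lemma stk_total_rows:
  "stk c w ps \<Longrightarrow> w \<noteq> [] \<Longrightarrow> snd (last (concat ps)) - snd c + 1 = int (total rows ps)"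
proof (induction w arbitrary: c ps)
  case (Cons X w)
  from Cons.prems(1) obtain p qs where p: "ps = p # qs" "is_piece b X p" "hd p = c"
      "stk (up (last p)) w qs"
    by (rule stk_ConsE)
  have r: "int (rows p) = snd (last p) - snd c + 1"
    using int_rows[OF piece_listing[OF p(2)]] p(3) by simp
  show ?case
  proof (cases "w = []")
    case True
    then show ?thesis using p r by simp
  next
    case False
    have "last (concat ps) = last (concat qs)"
      using stk_hd[OF p(4) False] p(1) by (metis concat.simps(2) last_appendR)
    then show ?thesis using Cons.IH[OF p(4) False] p r by simp
  qed
qed simp

text \<open>Every piece occupies at least one row. This bounds the words that a snake of given
  height can have, and leaves a single letter for one row.\<close>

lemma stk_length: "stk c w ps \<Longrightarrow> length w = length ps \<and> length ps \<le> total rows ps"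
proof (induction c w ps rule: stk.induct)
  case (2 c X w p ps)
  then have p: "walk p" using piece_listing[of X p] by simp
  have "snd (hd p) \<le> snd (last p)"
    using rows_hd_last(1)[OF walkD(5)[OF p], of "last p"] walkD(1)[OF p] by simp
  then have "rows p > 0" by (simp add: rows_def)
  then show ?case using 2 by auto
qed auto

definition listings :: "piece list \<Rightarrow> cell list set" where
  "listings w = concat ` stackings w"

lemma stackings_stk:
  "w \<in> all_words \<Longrightarrow> ps \<in> stackings w \<Longrightarrow> w \<noteq> [] \<and> stk (hd (concat ps)) w ps \<and> snd (hd (concat ps)) = 1"
proof -
  assume w: "w \<in> all_words" "ps \<in> stackings w"
  then have "w \<noteq> []" by (auto elim: all_words_structure)
  then show ?thesis using w(2) stacking_iff_stk[of w ps] by (simp add: stackings_def)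
qed

lemma rows_concat:
  assumes "w \<in> all_words" "ps \<in> stackings w"
  shows "rows (concat ps) = total rows ps"
proof -
  have s: "w \<noteq> []" "stk (hd (concat ps)) w ps" using stackings_stk[OF assms] by auto
  show ?thesis
    using stk_total_rows[OF s(2,1)] unfolding rows_def by simp
qed

text \<open>By \<open>stacking_unique\<close> different stackings of a word have different
  concatenations, and rows and lengths add up.\<close>

lemma listings_gf:
  assumes "w \<in> all_words"
  shows "has_gf rows length (listings w) (2 * weight piece_gf w)"
  using all_words_stackings_gf[OF assms]
proof (rule has_gf_bij)
  have "inj_on concat (stackings w)"
  proof (rule inj_onI)
    fix ps qs assume "ps \<in> stackings w" "qs \<in> stackings w" "concat ps = concat qs"
    then show "ps = qs"
      using stackings_stk[OF assms] stacking_unique[of _ w ps w qs] all_words_alternating[OF assms] by metis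
  qed
  then show "bij_betw concat (stackings w) (listings w)" by (simp add: bij_betw_def listings_def)
  show "rows (concat ps) = total rows ps" if "ps \<in> stackings w" for ps
    using rows_concat[OF assms that] .
qed (simp add: length_concat total_def)

lemma listings_disjoint:
  assumes "v \<in> all_words" "w \<in> all_words" "v \<noteq> w"
  shows "listings v \<inter> listings w = {}"
proof -
  have False if "ps \<in> stackings v" "qs \<in> stackings w" "concat ps = concat qs" for ps qs
  proof -
    have "stk (hd (concat ps)) v ps" "stk (hd (concat ps)) w qs"
      using stackings_stk[OF assms(1) that(1)] stackings_stk[OF assms(2) that(2)] that(3) by auto
    then show False
      using stacking_unique[of "hd (concat ps)" v ps w qs] all_words_alternating assms that(3) by blast
  qed
  then show ?thesis by (auto simp: listings_def)
qed

definition union_listings :: "piece list set \<Rightarrow> cell list set" where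
  "union_listings W = (\<Union>w\<in>W. listings w)"

lemma double_nth: "fps_nth (2 * f) k = 2 * fps_nth f k" for f :: series
  by (simp only: mult_2 fps_add_nth)

lemma union_listings_gf:
  assumes "W \<subseteq> all_words"
  shows "has_gf rows length (union_listings W) (2 * G W)"
proof -
  have "has_gf rows length (union_listings W)
      (Abs_fps (\<lambda>k. \<Sum>w | w \<in> W \<and> length w \<le> k. fps_nth (2 * weight piece_gf w) k))"
    unfolding union_listings_def
  proof (rule has_gf_UN)
    show "fps_nth (2 * weight piece_gf w) k = 0" if "w \<in> W" "w \<notin> {w. w \<in> W \<and> length w \<le> k}" for k w
      using that weight_low[where g = piece_gf, OF piece_gf_0, of k w] by (simp add: double_nth)
  qed (use assms listings_gf listings_disjoint finite_short_words in \<open>auto simp: subset_iff\<close>)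
  also have "Abs_fps (\<lambda>k. \<Sum>w | w \<in> W \<and> length w \<le> k. fps_nth (2 * weight piece_gf w) k) = 2 * G W"
    by (simp add: fps_eq_iff language_gf_def double_nth sum_distrib_left)
  finally show ?thesis .
qed

lemma listings_props:
  assumes "w \<in> all_words" "L \<in> listings w"
  shows "walk L" "in_strip L" "\<exists>c\<in>set L. fst c = 1" "\<exists>c\<in>set L. fst c = int b" "snd (hd L) = 1"
    "length w \<le> rows L"
proof -
  obtain ps where ps: "ps \<in> stackings w" "L = concat ps" using assms(2) by (auto simp: listings_def)
  have s: "w \<noteq> []" "stk (hd L) w ps" "snd (hd L) = 1" using stackings_stk[OF assms(1) ps(1)] ps(2) by auto
  show "walk L"
    using stacking_walk[OF s(2) all_words_alternating[OF assms(1)] s(1)] ps(2) by simp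
  show "in_strip L" using stk_in_strip[OF s(2)] ps(2) by simp
  have "Crossing \<in> set w" using assms(1) by (rule all_words_structure)
  then show "\<exists>c\<in>set L. fst c = 1" "\<exists>c\<in>set L. fst c = int b"
    using crossing_touches[OF s(2)] ps(2) by auto
  show "snd (hd L) = 1" by (rule s(3))
  show "length w \<le> rows L" using stk_length[OF s(2)] rows_concat[OF assms(1) ps(1)] ps(2) by simp
qed

lemma inscribed_listing:
  assumes "walk L"
  shows "inscribed b k (set L) \<longleftrightarrow> in_strip L \<and> (\<exists>c\<in>set L. fst c = 1) \<and> (\<exists>c\<in>set L. fst c = int b) \<and>
    snd (hd L) = 1 \<and> rows L = k"
proof
  have ne: "L \<noteq> []" using assms walkD(1) by blast
  note r = rows_hd_last[OF walkD(5)[OF assms]]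
  {
    assume i: "inscribed b k (set L)"
    have bd: "1 \<le> fst c" "fst c \<le> int b" "1 \<le> snd c" "snd c \<le> int k" if "c \<in> set L" for c
      using i that unfolding inscribed_def by force+
    obtain c d where c: "c \<in> set L" "snd c = 1" "d \<in> set L" "snd d = int k"
      using i unfolding inscribed_def by blast
    have "snd (hd L) = 1" "snd (last L) = int k"
      using bd(3)[of "hd L"] r(1)[OF c(1)] bd(4)[of "last L"] r(2)[OF c(3)] c ne by auto
    then show "in_strip L \<and> (\<exists>c\<in>set L. fst c = 1) \<and> (\<exists>c\<in>set L. fst c = int b) \<and>
        snd (hd L) = 1 \<and> rows L = k"
      using i bd int_rows[OF assms] unfolding inscribed_def in_strip_def by auto
  next
    assume a: "in_strip L \<and> (\<exists>c\<in>set L. fst c = 1) \<and> (\<exists>c\<in>set L. fst c = int b) \<and>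
        snd (hd L) = 1 \<and> rows L = k"
    then have l: "snd (last L) = int k" using int_rows[OF assms] by auto
    have "set L \<subseteq> {1..int b} \<times> {1..int k}"
    proof
      fix c assume c: "c \<in> set L"
      then show "c \<in> {1..int b} \<times> {1..int k}"
        using a l r[OF c] unfolding in_strip_def by (simp add: mem_Times_iff)
    qed
    moreover have "hd L \<in> set L" "last L \<in> set L" using ne by auto
    ultimately show "inscribed b k (set L)" unfolding inscribed_def using a l by blast
  }
qed

lemma snake_listing: "walk L \<Longrightarrow> snake (set L) \<and> card (set L) = length L"
  using pds_listing_iff_local[of L] by (auto simp: pds_listing_def distinct_card)

text \<open>Alternating words make the concatenation a walk, which provides the snake and turns
  being inscribed into a condition on its ends and columns.\<close>

theorem obtained_listings:
  assumes "W \<subseteq> all_words"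
  shows "obtained b W k n = set ` {L \<in> union_listings W. rows L = k \<and> length L = n}"
proof
  show "obtained b W k n \<subseteq> set ` {L \<in> union_listings W. rows L = k \<and> length L = n}"
  proof
    fix T assume "T \<in> obtained b W k n"
    then obtain w ps where T: "w \<in> W" "stacking b w ps" "T = set (concat ps)" "inscribed b k T" "card T = n"
      unfolding obtained_def by blast
    have w: "w \<in> all_words" using T(1) assms by blast
    then have wne: "w \<noteq> []" by (auto elim: all_words_structure)
    have loc: "walk (concat ps)"
      using stacking_walk[OF _ all_words_alternating[OF w] wne] stacking_iff_stk[OF wne] T(2) by blast
    have "snd (hd (concat ps)) = 1" "rows (concat ps) = k" "length (concat ps) = n"
      using inscribed_listing[OF loc, of k] snake_listing[OF loc] T(3-5) by simp_all
    moreover from this have "concat ps \<in> listings w"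
      using T(2) unfolding listings_def stackings_def by blast
    ultimately show "T \<in> set ` {L \<in> union_listings W. rows L = k \<and> length L = n}"
      using T(1,3) unfolding union_listings_def by blast
  qed
  show "set ` {L \<in> union_listings W. rows L = k \<and> length L = n} \<subseteq> obtained b W k n"
  proof
    fix T assume "T \<in> set ` {L \<in> union_listings W. rows L = k \<and> length L = n}"
    then obtain w L where L: "T = set L" "w \<in> W" "L \<in> listings w" "rows L = k" "length L = n"
      unfolding union_listings_def by blast
    have w: "w \<in> all_words" using L(2) assms by blast
    obtain ps where "stacking b w ps" "L = concat ps" using L(3) unfolding listings_def stackings_def by blast
    then show "T \<in> obtained b W k n"
      using listings_props[OF w L(3)] inscribed_listing[of L k] snake_listing[of L] L
      unfolding obtained_def by blast
  qed
qed

text \<open>The two directions meet here: stacking gives walks that touch both sides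
  (\<open>listings_props\<close>), and every such walk can be cut (\<open>cover\<close>).\<close>

lemma union_listings_all:
  "union_listings all_words = {L. walk L \<and> in_strip L \<and> (\<exists>c\<in>set L. fst c = 1) \<and>
     (\<exists>c\<in>set L. fst c = int b) \<and> snd (hd L) = 1}"
proof (intro set_eqI iffI)
  fix L assume "L \<in> union_listings all_words"
  then show "L \<in> {L. walk L \<and> in_strip L \<and> (\<exists>c\<in>set L. fst c = 1) \<and>
     (\<exists>c\<in>set L. fst c = int b) \<and> snd (hd L) = 1}"
    unfolding union_listings_def using listings_props by blast
next
  fix L assume L: "L \<in> {L. walk L \<and> in_strip L \<and> (\<exists>c\<in>set L. fst c = 1) \<and>
     (\<exists>c\<in>set L. fst c = int b) \<and> snd (hd L) = 1}"
  then obtain lo w ps where w: "lo \<in> lower" "w \<in> core" "Crossing \<in> set w" "stk (hd L) (lo @ w) ps"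
      "concat ps = L"
    using cover[of L] by blast
  then have lw: "lo @ w \<in> all_words" by (intro core_all_words)
  moreover have "lo @ w \<noteq> []" using w(3) by auto
  then have "stacking b (lo @ w) ps" using stacking_iff_stk w(4,5) by simp
  then have "ps \<in> stackings (lo @ w)" using L w(5) by (simp add: stackings_def)
  then have "L \<in> listings (lo @ w)" using w(5) unfolding listings_def by blast
  ultimately show "L \<in> union_listings all_words" unfolding union_listings_def by blast
qed

lemma pds_obtained: "pds b k n = card (obtained b all_words k n)"
proof -
  have "{T. is_pds T \<and> inscribed b k T \<and> card T = n} = obtained b all_words k n"
    unfolding obtained_listings[OF subset_refl] union_listings_all is_pds_def pds_listing_iff_local
    using inscribed_listing snake_listing by (auto simp: image_iff)
  then show ?thesis by (simp add: pds_def)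
qed

subsection \<open>Snakes with one row\<close>

definition row :: "cell list" where "row = map (\<lambda>i. (1 + int i, 1)) [0..<b]"

lemma row_listing: "walk row"
  by (auto simp: row_def walk_def successively_conv_nth new_step_def adj_def)
    (use width in auto)

lemma row_ends: "hd row = (1, 1)" "last row = (int b, 1)" "row \<noteq> []"
proof -
  show "row \<noteq> []" using width by (simp add: row_def)
  then show "hd row = (1, 1)" "last row = (int b, 1)"
    using width by (simp_all add: row_def hd_conv_nth last_conv_nth)
qed

text \<open>A walk within one row that starts in column 1 can only go east, since a step west would
  leave the strip or undo a step; column \<open>b\<close> fixes its length.\<close>

lemma row_unique:
  assumes L: "walk L" "in_strip L" "hd L = (1, 1)" "rows L = 1" "fst (last L) = int b"
    and last: "\<And>c. c \<in> set L \<Longrightarrow> fst c = int b \<Longrightarrow> c = last L"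
  shows "L = row"
proof -
  have ne: "L \<noteq> []" using L(1) walkD(1) by blast
  have one: "snd c = 1" if "c \<in> set L" for c
    using rows_hd_last[OF walkD(5)[OF L(1)] that] int_rows[OF L(1)] L(3,4) by simp
  have nth: "L ! i = (1 + int i, 1)" if "i < length L" for i
    using that
  proof (induction i rule: less_induct)
    case (less i)
    show ?case
    proof (cases i)
      case 0
      then show ?thesis using L(3) ne by (simp add: hd_conv_nth)
    next
      case (Suc j)
      have j: "L ! j = (1 + int j, 1)" using less Suc by simp
      have step: "new_step (L ! j) (L ! i)" using walkD(2)[OF L(1), of j] less.prems Suc by simp
      have row: "snd (L ! i) = 1" "1 \<le> fst (L ! i)"
        using one[of "L ! i"] L(2) less.prems by (auto simp: in_strip_def)
      have "fst (L ! i) \<noteq> int j"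
      proof (cases j)
        case 0
        then show ?thesis using row by simp
      next
        case (Suc m)
        then have "L ! m = (int j, 1)" using less \<open>i = Suc j\<close> by simp
        moreover have "L ! i \<noteq> L ! m"
          using walkD(3)[OF L(1), of m] less.prems Suc \<open>i = Suc j\<close> by simp
        ultimately show ?thesis using row by (auto simp: prod_eq_iff)
      qed
      then show ?thesis using step j row Suc by (auto simp: new_step_def prod_eq_iff)
    qed
  qed
  have "int (length L) = int b"
    using nth[of "length L - 1"] L(5) ne by (simp add: last_conv_nth of_nat_diff Suc_leI)
  then have len: "length L = b" by simp
  show ?thesis
  proof (rule nth_equalityI)
    show "length L = length row" by (simp add: len row_def)
    show "L ! i = row ! i" if "i < length L" for i using nth[OF that] that by (simp add: len row_def)
  qed
qed

lemma set_row: "set row = {1..int b} \<times> {1}"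
proof (intro set_eqI iffI)
  fix c :: cell assume "c \<in> {1..int b} \<times> {1}"
  then have "c = (1 + int (nat (fst c - 1)), 1)" "nat (fst c - 1) < b" by (auto simp: prod_eq_iff)
  then show "c \<in> set row"
    unfolding row_def set_map by (intro image_eqI[of _ _ "nat (fst c - 1)"]) simp_all
qed (auto simp: row_def)

text \<open>A single crossing confined to one row runs straight across, eastwards or westwards.
  These two listings have the same cells and cause the term \<open>t * q ^ b\<close> to be
  subtracted.\<close>

lemma one_row_listings:
  "{L \<in> listings [Crossing]. rows L = 1 \<and> length L = n} = (if n = b then {row, mirror b row} else {})"
proof -
  have crossing: "L \<in> listings [Crossing] \<longleftrightarrow> shape Crossing L \<and> snd (hd L) = 1" for L
  proof -
    have "ps \<in> stackings [Crossing] \<longleftrightarrow> (\<exists>p. ps = [p] \<and> is_piece b Crossing p \<and> snd (hd p) = 1)" for ps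
    proof
      assume "ps \<in> stackings [Crossing]"
      then have ps: "stk (hd (concat ps)) [Crossing] ps" "snd (hd (concat ps)) = 1"
        using stacking_iff_stk[of "[Crossing]" ps] by (auto simp: stackings_def)
      from ps(1) show "\<exists>p. ps = [p] \<and> is_piece b Crossing p \<and> snd (hd p) = 1"
      proof (rule stk_ConsE)
        fix p qs assume p: "ps = p # qs" "is_piece b Crossing p" "stk (up (last p)) [] qs"
        then have "ps = [p]" by simp
        then show ?thesis using p(2) ps(2) by simp
      qed
    next
      assume "\<exists>p. ps = [p] \<and> is_piece b Crossing p \<and> snd (hd p) = 1"
      then show "ps \<in> stackings [Crossing]"
        using stacking_iff_stk[of "[Crossing]" ps] by (auto simp: stackings_def)
    qed
    then have "stackings [Crossing] = (\<lambda>p. [p]) ` {p. is_piece b Crossing p \<and> snd (hd p) = 1}"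
      by (auto simp del: is_piece.simps)
    then have "L \<in> listings [Crossing] \<longleftrightarrow> is_piece b Crossing L \<and> snd (hd L) = 1"
      unfolding listings_def by (simp add: image_image del: is_piece.simps)
    then show ?thesis using is_piece_iff[of Crossing L] by blast
  qed
  have left: "L = row" if L: "shape Crossing L" "hd L = (1, 1)" "rows L = 1" for L
  proof (rule row_unique)
    have l: "left_crossing b L" using L left_crossing_iff by simp
    show "walk L" using L(1) by (simp add: shape_def)
    show "in_strip L" using l by (auto simp: left_crossing_def in_strip_def)
    show "c = last L" if "c \<in> set L" "fst c = int b" for c
      using l that unfolding left_crossing_def by blast
    show "fst (last L) = int b" using l unfolding left_crossing_def by blast
  qed (use L in auto)
  have row: "shape Crossing row" "snd (hd row) = 1" "rows row = 1" "length row = b"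
  proof -
    have "left_crossing b row"
      unfolding left_crossing_def pds_listing_iff_local row_ends
      using row_listing width by (auto simp: set_row)
    then show "shape Crossing row" using left_crossing_iff by blast
  qed (use width in \<open>auto simp: row_ends rows_def, simp add: row_def\<close>)
  have mirror_row: "shape Crossing (mirror b row)" "snd (hd (mirror b row)) = 1" "rows (mirror b row) = 1"
      "length (mirror b row) = b"
    using row shape_mirror rows_mirror[OF row_ends(3)] row_ends by (auto simp: mirror_def hd_map)
  have "L = row \<or> L = mirror b row" if L: "shape Crossing L" "snd (hd L) = 1" "rows L = 1" for L
  proof -
    have "side (fst (hd L))" using shape_hd_side L(1) by blast
    then consider "hd L = (1, 1)" | "hd L = (int b, 1)" using L(2) by (auto simp: side_def prod_eq_iff)
    then show ?thesis
    proof cases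
      case 1
      then show ?thesis using left L by blast
    next
      case 2
      have ne: "L \<noteq> []" using L(1) shape_nonempty by blast
      then have "hd (mirror b L) = (1, 1)" using 2 by (simp add: mirror_def hd_map)
      then have "mirror b L = row" using left[of "mirror b L"] L shape_mirror rows_mirror[OF ne] by simp
      then show ?thesis using mirror_mirror by metis
    qed
  qed
  then show ?thesis using row mirror_row crossing by auto
qed

lemma row_mirror: "row \<noteq> mirror b row" "set (mirror b row) = set row"
proof -
  have "hd (mirror b row) = (int b, 1)" using row_ends by (simp add: mirror_def hd_map)
  then show "row \<noteq> mirror b row" using row_ends width by auto
  show "set (mirror b row) = set row"
  proof -
    have "(\<lambda>c. (int b + 1 - fst c, snd c)) ` ({1..int b} \<times> {1}) = {1..int b} \<times> {1 :: int}"
    proof (intro set_eqI iffI)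
      fix c :: cell assume "c \<in> {1..int b} \<times> {1}"
      then show "c \<in> (\<lambda>c. (int b + 1 - fst c, snd c)) ` ({1..int b} \<times> {1})"
        by (intro image_eqI[of _ _ "(int b + 1 - fst c, snd c)"]) (auto simp: prod_eq_iff)
    qed auto
    then show ?thesis by (simp add: mirror_def set_row)
  qed
qed

lemma all_words_length: "w \<in> all_words \<Longrightarrow> w \<noteq> [Crossing] \<Longrightarrow> length w \<ge> 2"
proof (erule all_words_structure)
  fix lo x xs u
  assume "w = lo @ x # inter xs @ u" "Crossing \<in> set (x # xs)" "w \<noteq> [Crossing]"
  then show "length w \<ge> 2" by (cases lo; cases xs; cases u) auto
qed

text \<open>A row is the only snake with two listings, one from either end.\<close>

lemma obtained_gf:
  assumes "W \<subseteq> all_words"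
  shows "gf (\<lambda>k n. card (obtained b W k n)) = 2 * G W - (if [Crossing] \<in> W then t * q ^ b else 0)"
proof (intro fps_ext)
  fix k n
  let ?A = "{L \<in> union_listings W. rows L = k \<and> length L = n}"
  let ?c = "if [Crossing] \<in> W \<and> k = 1 \<and> n = b then 1 else 0 :: rat"
  have tq: "fps_nth (fps_nth (t * q ^ b) k) n = (if k = 1 \<and> n = b then 1 else 0)"
    by (cases k) (auto simp: t_def q_def fps_const_power)
  have tq': "fps_nth (fps_nth (if [Crossing] \<in> W then t * q ^ b else 0) k) n = ?c"
    by (cases "[Crossing] \<in> W") (simp_all only: tq if_True if_False simp_thms fps_zero_nth)
  have card: "of_nat (card ?A) = fps_nth (fps_nth (2 * G W) k) n"
    using has_gfD(2)[OF union_listings_gf[OF assms], of k n] .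
  have "of_nat (card (set ` ?A)) = of_nat (card ?A) - ?c"
  proof (cases "k = 1")
    case True
    \<comment> \<open>A word is no longer than the number of rows, and the only word of length one
      with a crossing is \<open>[Crossing]\<close>.\<close>
    have "w = [Crossing]" if "w \<in> W" "L \<in> listings w" "rows L = 1" for w L
      using all_words_length[of w] listings_props(6)[of w L] that assms by fastforce
    then have "?A = (if [Crossing] \<in> W then {L \<in> listings [Crossing]. rows L = 1 \<and> length L = n} else {})"
      unfolding True union_listings_def by auto
    then show ?thesis using True row_mirror one_row_listings[of n] by auto
  next
    case False
    have "inj_on set ?A"
    proof (rule inj_onI)
      fix L M assume a: "L \<in> ?A" "M \<in> ?A" "set L = set M"
      then obtain v w where v: "v \<in> W" "L \<in> listings v" "w \<in> W" "M \<in> listings w"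
        unfolding union_listings_def by blast
      then have vw: "v \<in> all_words" "w \<in> all_words" using assms by auto
      have "v \<noteq> []" using vw(1) by (auto elim: all_words_structure)
      then have "1 \<le> length v" by (simp add: Suc_le_eq)
      then have "rows L \<ge> 2"
        using listings_props(6)[OF vw(1) v(2)] a(1) False by simp
      then show "L = M"
        using listing_unique_of_rows[OF _ _ a(3)] listings_props(1)[OF vw(1) v(2)]
          listings_props(1)[OF vw(2) v(4)] by blast
    qed
    then show ?thesis using False by (simp add: card_image)
  qed
  then show "fps_nth (fps_nth (gf (\<lambda>k n. card (obtained b W k n))) k) n =
      fps_nth (fps_nth (2 * G W - (if [Crossing] \<in> W then t * q ^ b else 0)) k) n"
    using card unfolding gf_def fps_nth_Abs_fps fps_sub_nth obtained_listings[OF assms] tq' by simp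
qed

end

section \<open>Upside-down reflection\<close>

context strip begin

lemma reflect_reflect [simp]: "reflect k (reflect k T) = T"
  by (simp add: reflect_def image_image)

lemma is_piece_flip:
  assumes "is_piece b X p"
  shows "is_piece b (flip X) (rev (map (\<lambda>c. (fst c, r - snd c)) p))"
proof (cases "X = Pillar")
  case True
  then have p: "p \<noteq> []" "side (fst (hd p))" "vertical p" using assms by (auto simp: pillar_iff)
  have "vertical (rev (map (\<lambda>c. (fst c, r - snd c)) p))"
    using p(3) unfolding vertical_def successively_rev successively_map
    by (rule successively_mono) (auto simp: prod_eq_iff)
  moreover have "fst (last p) = fst (hd p)" using vertical_column[OF p(3), of "last p"] p(1) by simp
  ultimately show ?thesis
    using True p by (simp add: pillar_iff hd_rev last_map)
next
  case False
  then have "flip X \<noteq> Pillar" by (cases X) auto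
  then show ?thesis using shape_flip[of X p r] assms is_piece_iff[OF False, of p] is_piece_iff[of "flip X"] by blast
qed

lemma stacking_flip:
  assumes "stacking b w ps"
  shows "stacking b (rev (map flip w)) (rev (map (\<lambda>p. rev (map (\<lambda>c. (fst c, r - snd c)) p)) ps))"
proof -
  let ?f = "\<lambda>p. rev (map (\<lambda>c. (fst c, r - snd c)) p) :: cell list"
  have pieces: "list_all2 (is_piece b) w ps" and
    glue: "successively (\<lambda>p p'. hd p' = (fst (last p), snd (last p) + 1)) ps"
    using assms by (auto simp: stacking_def)
  have ne: "p \<noteq> []" if "p \<in> set ps" for p
    using pieces that piece_nonempty by (metis in_set_conv_nth list_all2_conv_all_nth)
  have "list_all2 (is_piece b) (rev (map flip w)) (rev (map ?f ps))"
    unfolding list_all2_rev list_all2_map1 list_all2_map2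
    using pieces by (rule list_all2_mono) (rule is_piece_flip)
  moreover have "successively (\<lambda>p p'. hd p' = (fst (last p), snd (last p) + 1)) (rev (map ?f ps))"
    unfolding successively_rev successively_map
    using glue by (rule successively_mono) (use ne in \<open>auto simp: hd_rev last_rev last_map hd_map\<close>)
  ultimately show ?thesis by (simp add: stacking_def)
qed

lemma reflect_obtained:
  assumes "W \<subseteq> all_words" "\<And>w. w \<in> W \<Longrightarrow> rev (map flip w) \<in> W'" "T \<in> obtained b W k n"
  shows "reflect k T \<in> obtained b W' k n"
proof -
  obtain w ps where T: "w \<in> W" "stacking b w ps" "T = set (concat ps)" "inscribed b k T" "card T = n"
    using assms(3) unfolding obtained_def by blast
  let ?f = "\<lambda>p. rev (map (\<lambda>c. (fst c, int k + 1 - snd c)) p) :: cell list"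
  have w: "w \<in> all_words" using T(1) assms(1) by blast
  then have wne: "w \<noteq> []" by (auto elim: all_words_structure)
  have loc: "walk (concat ps)"
    using stacking_walk[OF _ all_words_alternating[OF w] wne] stacking_iff_stk[OF wne] T(2) by blast
  have set: "reflect k T = set (?f (concat ps))" by (simp add: T(3) reflect_def)
  have "snake (reflect k T)" unfolding set using snake_listing[OF walk_flip[OF loc]] by blast
  moreover have "card (reflect k T) = n"
    using snake_listing[OF walk_flip[OF loc]] snake_listing[OF loc] T(3,5) unfolding set by simp
  moreover have "inscribed b k (reflect k T)"
  proof -
    let ?r = "\<lambda>c :: cell. (fst c, int k + 1 - snd c)"
    obtain c d e f where c: "c \<in> T" "fst c = 1" "d \<in> T" "fst d = int b" "e \<in> T" "snd e = 1"
        "f \<in> T" "snd f = int k" and box: "T \<subseteq> {1..int b} \<times> {1..int k}"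
      using T(4) unfolding inscribed_def by blast
    have "?r x \<in> {1..int b} \<times> {1..int k}" if "x \<in> T" for x
      using subsetD[OF box that] by (simp add: mem_Times_iff)
    then have "?r ` T \<subseteq> {1..int b} \<times> {1..int k}" by blast
    moreover have "fst (?r c) = 1" "fst (?r d) = int b" "snd (?r f) = 1" "snd (?r e) = int k"
      using c by simp_all
    moreover have "?r c \<in> ?r ` T" "?r d \<in> ?r ` T" "?r f \<in> ?r ` T" "?r e \<in> ?r ` T"
      using c by blast+
    ultimately show ?thesis unfolding inscribed_def reflect_def by blast
  qed
  moreover have "stacking b (rev (map flip w)) (rev (map ?f ps))" using stacking_flip[OF T(2)] .
  moreover have "reflect k T = set (concat (rev (map ?f ps)))"
    by (auto simp: T(3) reflect_def)
  ultimately show ?thesis using assms(2)[OF T(1)] unfolding obtained_def by blast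
qed

lemma rev_flip_ends: "u \<in> upper \<Longrightarrow> rev (map flip u) \<in> lower" "u \<in> lower \<Longrightarrow> rev (map flip u) \<in> upper"
  by (auto simp: upper_def lower_def)

text \<open>Reversal moves each pillar from before its piece to behind it; one extra pillar in front
  restores the pattern. In \<open>rev_flip_words\<close> it is the pillar that preceded
  \<open>y\<close>.\<close>

lemma rev_inter: "Pillar # rev (inter ys) = inter (rev ys) @ [Pillar]"
  by (induction ys) auto

lemma map_flip_inter: "ys \<in> lists {Crossing, Bubble} \<Longrightarrow> map flip (inter ys) = inter ys"
  by (induction ys) auto

lemma rev_flip_words:
  assumes "x \<in> {Crossing, Bubble}" "y \<in> {Crossing, Bubble}"
    and "w \<in> words {x # ys @ [y] | ys. ys \<in> lists {Crossing, Bubble}}"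
  shows "rev (map flip w) \<in> words {y # ys @ [x] | ys. ys \<in> lists {Crossing, Bubble}}"
proof -
  obtain lo x' xs u where w: "w = lo @ x' # inter xs @ u" "lo \<in> lower" "u \<in> upper"
      "x' # xs \<in> {x # ys @ [y] | ys. ys \<in> lists {Crossing, Bubble}}"
    using assms(3) by (rule wordsE)
  then obtain ys where ys: "x' = x" "xs = ys @ [y]" "ys \<in> lists {Crossing, Bubble}" by blast
  have "flip x = x" "flip y = y" using assms(1,2) by auto
  then have "rev (map flip w) = rev (map flip u) @ y # (Pillar # rev (inter ys)) @ x # rev (map flip lo)"
    by (simp add: w(1) ys(1,2) map_flip_inter[OF ys(3)])
  then have "rev (map flip w) = rev (map flip u) @ y # inter (rev ys @ [x]) @ rev (map flip lo)"
    unfolding rev_inter by simp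
  then show ?thesis
    by (rule wordsI) (use w(2,3) rev_flip_ends ys(3) in \<open>auto simp: in_lists_conv_set\<close>)
qed

text \<open>Reflection is an involution that carries each of the two languages into the other, so
  the inclusions are equalities. The factor 4 then comes from two starting sides and two
  orientations.\<close>

lemma family2_obtained: "family2 b k n = obtained b (form2 \<union> form2_reversed) k n"
proof -
  have sub: "form2 \<subseteq> all_words" "form2_reversed \<subseteq> all_words" using all_words_forms by auto
  have 1: "reflect k T \<in> obtained b form2_reversed k n" if "T \<in> obtained b form2 k n" for T
    using reflect_obtained[OF sub(1) _ that] rev_flip_words[of Crossing Bubble]
    unfolding form2_words form2_reversed_words by blast
  have 2: "reflect k T \<in> obtained b form2 k n" if "T \<in> obtained b form2_reversed k n" for T
    using reflect_obtained[OF sub(2) _ that] rev_flip_words[of Bubble Crossing]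
    unfolding form2_words form2_reversed_words by blast
  have "reflect k ` obtained b form2 k n = obtained b form2_reversed k n"
  proof (intro set_eqI iffI)
    fix T assume "T \<in> obtained b form2_reversed k n"
    from imageI[OF 2[OF this], of "reflect k"] show "T \<in> reflect k ` obtained b form2 k n" by simp
  qed (use 1 in blast)
  moreover have "obtained b (form2 \<union> form2_reversed) k n = obtained b form2 k n \<union> obtained b form2_reversed k n"
    unfolding obtained_def Collect_disj_eq[symmetric] by (rule Collect_cong) (auto simp only: bex_Un)
  ultimately show ?thesis by (simp only: family2_def)
qed

end

section \<open>Rational power series\<close>

lemma series_of_poly_simps:
  "series_of_poly 0 = 0" "series_of_poly 1 = 1" "series_of_poly (p + r) = series_of_poly p + series_of_poly r"
  "series_of_poly (p - r) = series_of_poly p - series_of_poly r"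
  "series_of_poly (p * r) = series_of_poly p * series_of_poly r"
proof -
  show "series_of_poly (p * r) = series_of_poly p * series_of_poly r"
    by (rule fps_ext)
      (simp add: series_of_poly_def fps_mult_nth coeff_mult fps_of_poly_sum fps_of_poly_mult atMost_atLeast0)
qed (simp_all add: series_of_poly_def fps_eq_iff fps_of_poly_add fps_of_poly_diff)

lemma const_coeff_mult: "fps_nth (fps_nth (f * g) 0) 0 = fps_nth (fps_nth f 0) 0 * fps_nth (fps_nth g 0) 0"
  for f g :: series
  by simp

lemma const_coeff_poly: "fps_nth (fps_nth (series_of_poly p) 0) 0 = coeff (coeff p 0) 0"
  by (simp add: series_of_poly_def)

lemma rationalI: "coeff (coeff d 0) 0 \<noteq> 0 \<Longrightarrow> f * series_of_poly d = series_of_poly p \<Longrightarrow> rational f"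
  unfolding rational_def by blast

lemma coeff00_mult: "coeff (coeff (p * r) 0) 0 = coeff (coeff p 0) 0 * coeff (coeff r 0) 0"
  for p r :: "rat poly poly"
  by (simp add: coeff_mult_0)

lemma rational_poly: "rational (series_of_poly p)"
  by (rule rationalI[of 1]) (simp_all add: series_of_poly_simps)

lemma rational_0: "rational 0" and rational_1: "rational 1"
  using rational_poly[of 0] rational_poly[of 1] by (simp_all add: series_of_poly_simps)

lemma rational_t: "rational t" and rational_q: "rational q"
proof -
  have "series_of_poly [:0, 1:] = t"
    by (rule fps_ext) (auto simp: series_of_poly_def t_def coeff_pCons split: nat.splits)
  then show "rational t" using rational_poly by metis
  have "series_of_poly [:[:0, 1:]:] = q"
    by (rule fps_ext) (auto simp: series_of_poly_def q_def coeff_pCons fps_of_poly_fps_X split: nat.splits)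
  then show "rational q" using rational_poly by metis
qed

lemma rational_add:
  assumes "rational f" "rational g"
  shows "rational (f + g)"
proof -
  obtain p d p' d' where "coeff (coeff d 0) 0 \<noteq> 0" "f * series_of_poly d = series_of_poly p"
      "coeff (coeff d' 0) 0 \<noteq> 0" "g * series_of_poly d' = series_of_poly p'"
    using assms unfolding rational_def by blast
  note h = this
  have "(f + g) * series_of_poly (d * d') = series_of_poly (p * d' + p' * d)"
    unfolding series_of_poly_simps h(2,4)[symmetric] by (simp add: algebra_simps)
  then show ?thesis by (rule rationalI[rotated]) (use h in \<open>simp add: coeff00_mult\<close>)
qed

lemma rational_mult:
  assumes "rational f" "rational g"
  shows "rational (f * g)"
proof -
  obtain p d p' d' where "coeff (coeff d 0) 0 \<noteq> 0" "f * series_of_poly d = series_of_poly p"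
      "coeff (coeff d' 0) 0 \<noteq> 0" "g * series_of_poly d' = series_of_poly p'"
    using assms unfolding rational_def by blast
  note h = this
  have "(f * g) * series_of_poly (d * d') = series_of_poly (p * p')"
    unfolding series_of_poly_simps h(2,4)[symmetric] by (simp add: algebra_simps)
  then show ?thesis by (rule rationalI[rotated]) (use h in \<open>simp add: coeff00_mult\<close>)
qed

lemma rational_diff:
  assumes "rational f" "rational g"
  shows "rational (f - g)"
proof -
  have "series_of_poly (0 - 1) = - 1" unfolding series_of_poly_simps by simp
  then have "rational (- 1)" using rational_poly by metis
  then have "rational (f + (- 1) * g)" using assms rational_add rational_mult by blast
  then show ?thesis by simp
qed

lemma rational_sum: "(\<And>i. i \<in> A \<Longrightarrow> rational (f i)) \<Longrightarrow> rational (\<Sum>i\<in>A. f i)"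
  by (induction A rule: infinite_finite_induct) (auto intro: rational_0 rational_add)

lemma rational_power: "rational f \<Longrightarrow> rational (f ^ n)"
  by (induction n) (auto intro: rational_1 rational_mult)

text \<open>If \<open>f = p / d\<close> vanishes at the origin, then
  \<open>1 / (1 - f) = d / (d - p)\<close>, and \<open>d - p\<close> has the same nonzero constant
  term as \<open>d\<close>. The inverse is built from that of the \<open>t ^ 0\<close> coefficient,
  a series in \<open>q\<close> with constant term 1.\<close>

lemma rational_quasi_inverse:
  assumes "rational f" "fps_nth (fps_nth f 0) 0 = 0"
  obtains r where "rational r" "r * (1 - f) = 1"
proof -
  let ?c = "fps_nth (1 - f) 0"
  have "inverse ?c * ?c = 1" by (rule inverse_mult_eq_1) (simp add: assms(2))
  then have inv: "fps_left_inverse (1 - f) (inverse ?c) * (1 - f) = 1" by (rule fps_left_inverse)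
  define r where "r = fps_left_inverse (1 - f) (inverse ?c)"
  obtain p d where h: "coeff (coeff d 0) 0 \<noteq> 0" "f * series_of_poly d = series_of_poly p"
    using assms(1) unfolding rational_def by blast
  have "r * series_of_poly (d - p) = (r * (1 - f)) * series_of_poly d"
    unfolding series_of_poly_simps h(2)[symmetric] by (simp add: algebra_simps)
  then have "r * series_of_poly (d - p) = series_of_poly d"
    unfolding inv[folded r_def] mult_1_left .
  moreover have "coeff (coeff p 0) 0 = 0"
    using const_coeff_mult[of f "series_of_poly d"] assms(2) unfolding h(2) const_coeff_poly by simp
  ultimately have "rational r" by (intro rationalI[of "d - p" r d]) (use h in auto)
  then show ?thesis using that inv r_def by blast
qed

text \<open>Gaussian elimination; all pivots are invertible because the matrix vanishes at the origin.\<close>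

lemma rational_system:
  fixes x v :: "'a \<Rightarrow> series" and M :: "'a \<Rightarrow> 'a \<Rightarrow> series"
  assumes "finite A"
    and "\<And>i. i \<in> A \<Longrightarrow> rational (v i)" "\<And>i j. i \<in> A \<Longrightarrow> j \<in> A \<Longrightarrow> rational (M i j)"
    and "\<And>i j. i \<in> A \<Longrightarrow> j \<in> A \<Longrightarrow> fps_nth (fps_nth (M i j) 0) 0 = 0"
    and "\<And>i. i \<in> A \<Longrightarrow> x i = v i + (\<Sum>j\<in>A. M i j * x j)"
    and "i \<in> A"
  shows "rational (x i)"
  using assms
proof (induction A arbitrary: v M i rule: finite_induct)
  case (insert a A)
  obtain r where r: "rational r" "r * (1 - M a a) = 1"
    by (rule rational_quasi_inverse[of "M a a"]) (use insert.prems in auto)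
  have xa: "x a = r * v a + (\<Sum>j\<in>A. r * M a j * x j)"
  proof -
    have "x a = v a + (M a a * x a + (\<Sum>j\<in>A. M a j * x j))"
      using insert.prems(4)[of a] insert.hyps by simp
    then have "x a - M a a * x a = v a + (\<Sum>j\<in>A. M a j * x j)"
      unfolding diff_eq_eq by (simp only: ac_simps)
    then have "(1 - M a a) * x a = v a + (\<Sum>j\<in>A. M a j * x j)" by (simp add: left_diff_distrib)
    then have "r * (1 - M a a) * x a = r * (v a + (\<Sum>j\<in>A. M a j * x j))" by (simp only: mult.assoc)
    then show ?thesis by (simp add: r(2) distrib_left sum_distrib_left mult.assoc)
  qed
  \<comment> \<open>Substituting \<open>x a\<close> yields the Schur complement; its entries again
    vanish at the origin, so the induction continues.\<close>
  have xi: "x i = (v i + M i a * r * v a) + (\<Sum>j\<in>A. (M i j + M i a * r * M a j) * x j)" if "i \<in> A" for i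
  proof -
    have "x i = v i + (M i a * x a + (\<Sum>j\<in>A. M i j * x j))"
      using insert.prems(4)[of i] insert.hyps that by simp
    also have "M i a * x a = M i a * r * v a + (\<Sum>j\<in>A. M i a * r * M a j * x j)"
      by (subst xa) (simp add: distrib_left sum_distrib_left mult.assoc)
    finally show ?thesis by (simp add: sum.distrib distrib_right algebra_simps)
  qed
  have IH: "rational (x i)" if "i \<in> A" for i
  proof (rule insert.IH[OF _ _ _ xi that])
    show "fps_nth (fps_nth (M i j + M i a * r * M a j) 0) 0 = 0" if "i \<in> A" "j \<in> A" for i j
      using insert.prems(3)[of i j] insert.prems(3)[of i a] that by simp
  qed (use insert.prems(1,2) r in \<open>auto intro!: rational_add rational_mult\<close>)
  show ?case
  proof (cases "i = a")
    case True
    have "rational (r * v a + (\<Sum>j\<in>A. r * M a j * x j))"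
      by (intro rational_add rational_mult rational_sum r(1) insert.prems(1,2) IH) auto
    then show ?thesis unfolding True xa[symmetric] .
  qed (use IH insert.prems(5) in auto)
qed simp

section \<open>A finite automaton for listings\<close>

text \<open>A cell put in front is constrained only by the next three, so remembering two steps is
  enough memory for an automaton.\<close>

lemma walk_Cons4:
  "walk (a # c # d # e # L) \<longleftrightarrow>
     new_step a c \<and> d \<noteq> a \<and> \<not> adj a e \<and> walk (c # d # e # L)"
proof
  assume L: "walk (a # c # d # e # L)"
  show "new_step a c \<and> d \<noteq> a \<and> \<not> adj a e \<and> walk (c # d # e # L)"
    using walkD(2)[OF L, of 0] walkD(3)[OF L, of 0] walkD(4)[OF L, of 0]
      walk_ConsD[OF L] by (simp add: eval_nat_numeral)
next
  assume a: "new_step a c \<and> d \<noteq> a \<and> \<not> adj a e \<and> walk (c # d # e # L)"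
  then have L: "walk (c # d # e # L)" by blast
  have "(a # c # d # e # L) ! (i + 2) \<noteq> (a # c # d # e # L) ! i" if "i + 2 < length (a # c # d # e # L)" for i
    using walkD(3)[OF L, of "i - 1"] a that by (cases i) auto
  moreover have "\<not> adj ((a # c # d # e # L) ! i) ((a # c # d # e # L) ! (i + 3))"
    if "i + 3 < length (a # c # d # e # L)" for i
    using walkD(4)[OF L, of "i - 1"] a that by (cases i) (auto simp: eval_nat_numeral)
  ultimately show "walk (a # c # d # e # L)"
    using a walkD(5)[OF L] by (auto simp: walk_def)
qed

lemma has_gf_translate:
  assumes "has_gf h s A F" "bij_betw f A B" "\<And>a. a \<in> A \<Longrightarrow> h' (f a) = i + h a"
    "\<And>a. a \<in> A \<Longrightarrow> s' (f a) = 1 + s a"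
  shows "has_gf h' s' B (t ^ i * q * F)"
proof -
  have "{u \<in> {()}. i = k \<and> (1::nat) = n} = (if k = i \<and> n = 1 then {()} else {})" for k n by auto
  moreover have "fps_nth (fps_nth (t ^ i * q) k) n = (if k = i \<and> n = 1 then 1 else 0)" for k n
    by (auto simp: t_def q_def fps_X_power_mult_nth)
  ultimately have "has_gf (\<lambda>_. i) (\<lambda>_. 1) {()} (t ^ i * q)" by (simp add: has_gf_def)
  then have "has_gf (\<lambda>x. i + h (snd x)) (\<lambda>x. 1 + s (snd x)) ({()} \<times> A) (t ^ i * q * F)"
    using has_gf_Sigma[of "\<lambda>_. i" "\<lambda>_. 1" "{()}" "t ^ i * q" h s "\<lambda>_. A" F] assms(1) by simp
  moreover have "bij_betw (\<lambda>x. f (snd x)) ({()} \<times> A) B"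
    using assms(2) by (auto simp: bij_betw_def inj_on_def image_iff)
  ultimately show ?thesis by (rule has_gf_bij) (use assms(3,4) in auto)
qed

context strip begin

abbreviation add :: "cell \<Rightarrow> cell \<Rightarrow> cell" where
  "add c d \<equiv> (fst c + fst d, snd c + snd d)"

abbreviation sub :: "cell \<Rightarrow> cell \<Rightarrow> cell" where
  "sub c d \<equiv> (fst c - fst d, snd c - snd d)"

definition steps :: "cell set" where "steps = {(0, 1), (1, 0), (-1, 0)}"

lemma new_step_iff: "new_step c d \<longleftrightarrow> (\<exists>e\<in>steps. d = add c e)"
  by (auto simp: new_step_def steps_def)

text \<open>
  A state records the last two steps, the current column and the set of columns still to be visited.
\<close>

fun suffixes :: "cell \<times> cell \<times> int \<times> int set \<Rightarrow> cell list set" where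
  "suffixes (d1, d2, x, R) = {L. walk (sub (sub (x, 0) d2) d1 # sub (x, 0) d2 # L) \<and>
     L \<noteq> [] \<and> hd L = (x, 0) \<and> in_strip L \<and> R \<subseteq> fst ` set L}"

fun follow :: "cell \<times> cell \<times> int \<times> int set \<Rightarrow> cell \<Rightarrow> cell \<times> cell \<times> int \<times> int set" where
  "follow (d1, d2, x, R) d = (d2, d, x + fst d, R - {x})"

text \<open>With the current cell at the origin, \<open>sub (sub (0, 0) d2) d1\<close> is the cell
  two steps back. The tests say that the last two steps do not cancel and that step \<open>d\<close>
  makes no contact at distance three.\<close>

fun allowed :: "cell \<times> cell \<times> int \<times> int set \<Rightarrow> cell \<Rightarrow> bool" where
  "allowed (d1, d2, x, R) d \<longleftrightarrow> (0, 0) \<noteq> sub (sub (0, 0) d2) d1 \<and> \<not> adj (sub (sub (0, 0) d2) d1) d"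

definition states :: "(cell \<times> cell \<times> int \<times> int set) set" where
  "states = steps \<times> steps \<times> {1..int b} \<times> Pow {1, int b}"

lemma finite_states: "finite states" "finite steps"
  by (simp_all add: states_def steps_def)

text \<open>The virtual cells in front of a suffix stand for the two remembered steps. Removing the
  current cell and shifting the rest back to row 0 gives a suffix of the next state, with
  \<open>walk_Cons4\<close> as the local test.\<close>

lemma suffixes_Cons:
  assumes "s = (d1, d2, x, R)" "s \<in> states" "d \<in> steps"
  shows "(x, 0) # shift (snd d) L \<in> suffixes s \<and> hd L = (x + fst d, 0) \<and> L \<noteq> [] \<longleftrightarrow>
    allowed s d \<and> follow s d \<in> states \<and> L \<in> suffixes (follow s d)"
proof (cases "L \<noteq> [] \<and> hd L = (x + fst d, 0)")
  case True
  then obtain L' where L: "L = (x + fst d, 0) # L'" by (cases L) auto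
  have st: "d1 \<in> steps" "d2 \<in> steps" "1 \<le> x" "x \<le> int b" "R \<subseteq> {1, int b}"
    using assms(1,2) by (auto simp: states_def)
  let ?p1 = "sub (x, 0) d2" and ?p2 = "sub (sub (x, 0) d2) d1"
  have sh: "shift (snd d) L = add (x, 0) d # shift (snd d) L'" by (simp add: L shift_def)
  \<comment> \<open>Seen from the next cell in row 0, the two preceding cells are those of the
    updated memory \<open>(d2, d)\<close>.\<close>
  have "?p1 # (x, 0) # shift (snd d) L = shift (snd d) (sub (sub (x + fst d, 0) d) d2 # sub (x + fst d, 0) d # L)"
    by (simp add: shift_def)
  then have loc: "walk (?p1 # (x, 0) # shift (snd d) L) \<longleftrightarrow>
      walk (sub (sub (x + fst d, 0) d) d2 # sub (x + fst d, 0) d # L)"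
    using walk_shift by presburger
  have "new_step ?p2 ?p1" unfolding new_step_iff using st(1) by (intro bexI[of _ d1]) auto
  moreover have "(x, 0) \<noteq> ?p2 \<longleftrightarrow> (0, 0) \<noteq> sub (sub (0, 0) d2) d1" by auto
  moreover have "adj ?p2 (add (x, 0) d) \<longleftrightarrow> adj (sub (sub (0, 0) d2) d1) d" by (auto simp: adj_def)
  ultimately have "walk (?p2 # ?p1 # (x, 0) # shift (snd d) L) \<longleftrightarrow>
      allowed s d \<and> walk (sub (sub (x + fst d, 0) d) d2 # sub (x + fst d, 0) d # L)"
    unfolding sh walk_Cons4 unfolding sh[symmetric] loc by (simp add: assms(1))
  moreover have "in_strip ((x, 0) # shift (snd d) L) \<longleftrightarrow> in_strip L"
    using st by (auto simp: in_strip_def shift_set)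
  moreover have "fst ` set ((x, 0) # shift (snd d) L) = insert x (fst ` set L)"
    by (auto simp: shift_set image_image)
  then have "R \<subseteq> fst ` set ((x, 0) # shift (snd d) L) \<longleftrightarrow> R - {x} \<subseteq> fst ` set L" by auto
  moreover have "in_strip L \<Longrightarrow> follow s d \<in> states"
    using L st assms(1,3) by (auto simp: states_def)
  ultimately show ?thesis using True by (auto simp: assms(1))
next
  case False
  then show ?thesis by (auto simp: assms(1))
qed

definition suffix_gf :: "cell \<times> cell \<times> int \<times> int set \<Rightarrow> series" where
  "suffix_gf s = gf (\<lambda>k n. card {L \<in> suffixes s. rows L = k \<and> length L = n})"

lemma suffixes_local: "L \<in> suffixes s \<Longrightarrow> walk L"
  using walk_appendD2[of "[_, _]" L] by (cases s) auto

lemma suffix_has_gf: "has_gf rows length (suffixes s) (suffix_gf s)"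
  unfolding has_gf_def
proof (intro allI)
  fix k n
  obtain d1 d2 x R where s: "s = (d1, d2, x, R)" by (cases s) auto
  have "{L \<in> suffixes s. rows L = k \<and> length L = n} \<subseteq> {L. walk L \<and> hd L = (x, 0) \<and> length L = n}"
  proof
    fix L assume L: "L \<in> {L \<in> suffixes s. rows L = k \<and> length L = n}"
    then have "L \<in> suffixes s" "hd L = (x, 0)" by (auto simp: s)
    then show "L \<in> {L. walk L \<and> hd L = (x, 0) \<and> length L = n}"
      using suffixes_local[of L s] L by blast
  qed
  then have "finite {L \<in> suffixes s. rows L = k \<and> length L = n}"
    by (rule finite_subset) (rule finite_listings)
  then show "finite {L \<in> suffixes s. rows L = k \<and> length L = n} \<and>
      of_nat (card {L \<in> suffixes s. rows L = k \<and> length L = n}) = fps_nth (fps_nth (suffix_gf s) k) n"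
    by (simp add: suffix_gf_def gf_def)
qed

definition transition :: "cell \<times> cell \<times> int \<times> int set \<Rightarrow> cell \<times> cell \<times> int \<times> int set \<Rightarrow> series" where
  "transition s s' = (\<Sum>d\<in>steps. if allowed s d \<and> s' = follow s d then t ^ nat (snd d) * q else 0)"

text \<open>Every cell contributes \<open>q\<close>; a row is paid for by the step that climbs out
  of it, and the last row by the final cell, hence the factor \<open>t\<close> here.\<close>

definition stop :: "cell \<times> cell \<times> int \<times> int set \<Rightarrow> series" where
  "stop s = (if [(fst (snd (snd s)), 0)] \<in> suffixes s then t * q else 0)"

text \<open>Split according to the first step. Steps that leave the strip lead outside
  \<open>states\<close> and have no suffixes, so the system closes up on a finite set.\<close>

lemma suffix_gf_equation:
  assumes "s \<in> states"
  shows "suffix_gf s = stop s + (\<Sum>s'\<in>states. transition s s' * suffix_gf s')"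
proof -
  obtain d1 d2 x R where s: "s = (d1, d2, x, R)" by (cases s) auto
  let ?c = "(x, 0 :: int)"
  define B where "B d = {L \<in> suffixes s. \<exists>L'. L = ?c # L' \<and> L' \<noteq> [] \<and> hd L' = add ?c d}" for d
  define Z where "Z = {L \<in> suffixes s. L = [?c]}"
  have Z: "has_gf rows length Z (stop s)"
  proof (cases "[?c] \<in> suffixes s")
    case True
    then have "Z = {[?c]}" by (auto simp: Z_def)
    moreover have "has_gf rows length {[?c]} (t ^ 1 * q * 1)"
      by (rule has_gf_translate[OF has_gf_singleton[of "\<lambda>_. 0" "()" "\<lambda>_. 0"], of "\<lambda>_. [?c]"])
        (auto simp: rows_def bij_betw_def)
    ultimately show ?thesis using True by (simp add: stop_def s)
  next
    case False
    then have "Z = {}" by (auto simp: Z_def)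
    moreover have "stop s = 0" using False unfolding stop_def by (simp add: s del: suffixes.simps)
    ultimately show ?thesis using has_gf_empty by simp
  qed
  have B: "has_gf rows length (B d)
      (if allowed s d \<and> follow s d \<in> states then t ^ nat (snd d) * q * suffix_gf (follow s d) else 0)"
    if d: "d \<in> steps" for d
  proof -
    have d0: "snd d \<ge> 0" using d by (auto simp: steps_def)
    have Bd: "L \<in> B d \<longleftrightarrow> (\<exists>M. L = ?c # shift (snd d) M \<and> allowed s d \<and> follow s d \<in> states \<and>
        M \<in> suffixes (follow s d))" for L
    proof
      assume "L \<in> B d"
      then obtain L' where L: "L \<in> suffixes s" "L = ?c # L'" "L' \<noteq> []" "hd L' = add ?c d"
        unfolding B_def by blast
      have "L' = shift (snd d) (shift (- snd d) L')" "shift (- snd d) L' \<noteq> []"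
        "hd (shift (- snd d) L') = (x + fst d, 0)"
        using L(3,4) by (simp_all add: shift_simps shift_hd)
      then show "\<exists>M. L = ?c # shift (snd d) M \<and> allowed s d \<and> follow s d \<in> states \<and>
          M \<in> suffixes (follow s d)"
        using suffixes_Cons[OF s assms d, of "shift (- snd d) L'"] L(1,2) by metis
    next
      assume "\<exists>M. L = ?c # shift (snd d) M \<and> allowed s d \<and> follow s d \<in> states \<and>
          M \<in> suffixes (follow s d)"
      then obtain M where M: "L = ?c # shift (snd d) M" "allowed s d" "follow s d \<in> states"
          "M \<in> suffixes (follow s d)" by blast
      then have "L \<in> suffixes s" "hd M = (x + fst d, 0)" "M \<noteq> []"
        using suffixes_Cons[OF s assms d, of M] by blast+
      then show "L \<in> B d" unfolding B_def using M(1) by (simp add: shift_simps shift_hd)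
    qed
    show ?thesis
    proof (cases "allowed s d \<and> follow s d \<in> states")
      case True
      have "has_gf rows length (B d) (t ^ nat (snd d) * q * suffix_gf (follow s d))"
      proof (rule has_gf_translate[OF suffix_has_gf])
        have inj: "inj_on (\<lambda>M. ?c # shift (snd d) M) (suffixes (follow s d))"
        proof (rule inj_onI)
          fix M N assume "?c # shift (snd d) M = ?c # shift (snd d) N"
          then have "shift (- snd d) (shift (snd d) M) = shift (- snd d) (shift (snd d) N)" by simp
          then show "M = N" by (simp add: shift_simps)
        qed
        moreover have "(\<lambda>M. ?c # shift (snd d) M) ` suffixes (follow s d) = B d"
          using Bd True by (auto simp: image_iff)
        ultimately show "bij_betw (\<lambda>M. ?c # shift (snd d) M) (suffixes (follow s d)) (B d)"
          by (simp add: bij_betw_def)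
        fix M assume M: "M \<in> suffixes (follow s d)"
        have loc: "walk M" using suffixes_local M .
        have "snd (hd M) = 0" "M \<noteq> []" using M by (auto simp: s)
        then have "rows (?c # shift (snd d) M) = nat (snd d + int (rows M))"
          using int_rows[OF loc] by (simp add: rows_def shift_simps shift_last algebra_simps)
        then show "rows (?c # shift (snd d) M) = nat (snd d) + rows M"
          using d0 by (simp add: nat_add_distrib)
        show "length (?c # shift (snd d) M) = 1 + length M" by (simp add: shift_simps)
      qed
      then show ?thesis using True by simp
    next
      case False
      then have "B d = {}" using Bd by blast
      then show ?thesis unfolding if_not_P[OF False] using has_gf_empty by simp
    qed
  qed
  have UN: "has_gf rows length (\<Union>d\<in>steps. B d) (\<Sum>d\<in>steps.
      if allowed s d \<and> follow s d \<in> states then t ^ nat (snd d) * q * suffix_gf (follow s d) else 0)"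
  proof (rule has_gf_UN_finite)
    show "B i \<inter> B j = {}" if "i \<noteq> j" for i j
      using that unfolding B_def by (auto simp: prod_eq_iff)
  qed (use finite_states B in auto)
  have split: "suffixes s = Z \<union> (\<Union>d\<in>steps. B d)"
  proof (intro set_eqI iffI)
    fix L assume L: "L \<in> suffixes s"
    then obtain L' where L': "L = ?c # L'" by (cases L) (auto simp: s)
    show "L \<in> Z \<union> (\<Union>d\<in>steps. B d)"
    proof (cases "L' = []")
      case False
      then have "new_step ?c (hd L')"
        using walkD(5)[OF suffixes_local[OF L]] L' by (simp add: successively_Cons)
      then show ?thesis using L L' False unfolding new_step_iff B_def by blast
    qed (use L L' in \<open>auto simp: Z_def\<close>)
  qed (auto simp: Z_def B_def)
  have "has_gf rows length (suffixes s) (stop s + (\<Sum>d\<in>steps.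
      if allowed s d \<and> follow s d \<in> states then t ^ nat (snd d) * q * suffix_gf (follow s d) else 0))"
    unfolding split by (rule has_gf_Un[OF Z UN]) (auto simp: Z_def B_def)
  then have "suffix_gf s = stop s + (\<Sum>d\<in>steps.
      if allowed s d \<and> follow s d \<in> states then t ^ nat (snd d) * q * suffix_gf (follow s d) else 0)"
    by (rule has_gf_unique[OF suffix_has_gf])
  also have "(\<Sum>d\<in>steps.
      if allowed s d \<and> follow s d \<in> states then t ^ nat (snd d) * q * suffix_gf (follow s d) else 0) =
      (\<Sum>d\<in>steps. \<Sum>s'\<in>states. (if allowed s d \<and> s' = follow s d then t ^ nat (snd d) * q else 0) * suffix_gf s')"
  proof (rule sum.cong[OF refl])
    fix d
    \<comment> \<open>Each step leads to just one state, so at most one summand survives.\<close>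
    have "(\<Sum>s'\<in>states. (if allowed s d \<and> s' = follow s d then t ^ nat (snd d) * q else 0) * suffix_gf s') =
        (\<Sum>s'\<in>states. if s' = follow s d then (if allowed s d then t ^ nat (snd d) * q * suffix_gf s' else 0) else 0)"
      by (rule sum.cong) auto
    then show "(if allowed s d \<and> follow s d \<in> states then t ^ nat (snd d) * q * suffix_gf (follow s d) else 0) =
        (\<Sum>s'\<in>states. (if allowed s d \<and> s' = follow s d then t ^ nat (snd d) * q else 0) * suffix_gf s')"
      using finite_states by simp
  qed
  also have "\<dots> = (\<Sum>s'\<in>states. transition s s' * suffix_gf s')"
    unfolding transition_def sum_distrib_right by (rule sum.swap)
  finally show ?thesis .
qed

lemma rational_suffix_gf: "s \<in> states \<Longrightarrow> rational (suffix_gf s)"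
proof (rule rational_system[OF finite_states(1) _ _ _ suffix_gf_equation])
  show "rational (stop s)" for s
    unfolding stop_def by (simp add: rational_0 rational_mult rational_t rational_q)
  show "rational (transition s s')" for s s'
    unfolding transition_def
    by (intro rational_sum) (simp add: rational_0 rational_mult rational_power rational_t rational_q)
  show "fps_nth (fps_nth (transition s s') 0) 0 = 0" for s s'
  proof -
    \<comment> \<open>Horizontal steps carry no \<open>t\<close>; it is the factor \<open>q\<close>
      that makes the matrix vanish at the origin.\<close>
    have "fps_nth (fps_nth (t ^ i * q) 0) 0 = 0" for i by (simp add: q_def)
    then show ?thesis unfolding transition_def fps_sum_nth by (intro sum.neutral) auto
  qed
qed

lemma rational_all_listings: "rational (2 * G all_words)"
proof -
  \<comment> \<open>A fresh walk gets two virtual steps up before its start, which constrain nothing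
    that follows; both side columns are still to be visited.\<close>
  let ?s = "\<lambda>x. ((0, 1), (0, 1), x, {1, int b})"
  have mem: "?s x \<in> states" if "x \<in> {1..int b}" for x
    using that by (auto simp: states_def steps_def)
  have suf: "L \<in> suffixes (?s x) \<longleftrightarrow> walk L \<and> hd L = (x, 0) \<and> in_strip L \<and> {1, int b} \<subseteq> fst ` set L"
    for L x
  proof -
    have "walk ((x, -2) # (x, -1) # L)" if "walk L" "hd L = (x, 0)"
    proof -
      have "walk [(x, -2), (x, -1)]"
        by (rule walk_vertical) (auto simp: vertical_def)
      then have "walk ([(x, -2), (x, -1)] @ L)"
        by (rule walk_append) (use that in auto)
      then show ?thesis by simp
    qed
    moreover have "walk L" if "walk ((x, -2) # (x, -1) # L)" "L \<noteq> []"
      using walk_appendD2[of "[(x, -2), (x, -1)]" L] that by simp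
    ultimately show ?thesis using walkD(1)[of L] by auto
  qed
  have gf: "has_gf rows length {L. shift (-1) L \<in> suffixes (?s x)} (suffix_gf (?s x))" for x
    using suffix_has_gf
  proof (rule has_gf_bij)
    show "bij_betw (shift 1) (suffixes (?s x)) {L. shift (-1) L \<in> suffixes (?s x)}"
      by (rule bij_betw_byWitness[where f' = "shift (-1)"]) (auto simp: shift_simps simp del: suffixes.simps)
    show "rows (shift 1 L) = rows L" if "L \<in> suffixes (?s x)" for L
      using walkD(1)[OF suffixes_local[OF that]] by (simp add: rows_def shift_hd shift_last)
  qed (simp add: shift_simps)
  have shifted: "shift (-1) L \<in> suffixes (?s x) \<longleftrightarrow>
      walk L \<and> hd L = (x, 1) \<and> in_strip L \<and> {1, int b} \<subseteq> fst ` set L" for L x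
  proof -
    have "in_strip (shift (-1) L) \<longleftrightarrow> in_strip L" by (auto simp: in_strip_def shift_set)
    moreover have "fst ` set (shift (-1) L) = fst ` set L" by (simp add: shift_set image_image)
    moreover have "walk L \<Longrightarrow> hd (shift (-1) L) = (x, 0) \<longleftrightarrow> hd L = (x, 1)"
      using shift_hd[OF walkD(1)] by (auto simp: prod_eq_iff)
    ultimately show ?thesis unfolding suf walk_shift by auto
  qed
  have "union_listings all_words = (\<Union>x\<in>{1..int b}. {L. shift (-1) L \<in> suffixes (?s x)})"
  proof (intro set_eqI iffI)
    fix L assume "L \<in> union_listings all_words"
    then have L: "walk L" "in_strip L" "\<exists>c\<in>set L. fst c = 1" "\<exists>c\<in>set L. fst c = int b" "snd (hd L) = 1"
      unfolding union_listings_all by auto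
    have "fst (hd L) \<in> {1..int b}"
      using L(2) walkD(1)[OF L(1)] by (simp add: in_strip_def)
    moreover have "shift (-1) L \<in> suffixes (?s (fst (hd L)))"
      unfolding shifted using L by (force simp: prod_eq_iff)
    ultimately show "L \<in> (\<Union>x\<in>{1..int b}. {L. shift (-1) L \<in> suffixes (?s x)})" by blast
  next
    fix L assume "L \<in> (\<Union>x\<in>{1..int b}. {L. shift (-1) L \<in> suffixes (?s x)})"
    then show "L \<in> union_listings all_words"
      unfolding union_listings_all shifted by force
  qed
  then have all: "has_gf rows length (\<Union>x\<in>{1..int b}. {L. shift (-1) L \<in> suffixes (?s x)}) (2 * G all_words)"
    using union_listings_gf[OF subset_refl] by (simp only:)
  have "has_gf rows length (\<Union>x\<in>{1..int b}. {L. shift (-1) L \<in> suffixes (?s x)})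
      (\<Sum>x\<in>{1..int b}. suffix_gf (?s x))"
    by (rule has_gf_UN_finite) (use gf shifted in \<open>auto simp del: suffixes.simps\<close>)
  then have "2 * G all_words = (\<Sum>x\<in>{1..int b}. suffix_gf (?s x))"
    by (rule has_gf_unique[OF all])
  moreover have "rational (\<Sum>x\<in>{1..int b}. suffix_gf (?s x))"
    by (intro rational_sum rational_suffix_gf mem)
  ultimately show ?thesis by (simp only:)
qed

section \<open>The generating functions of the families\<close>

lemma crossing_not_in_forms:
  "[Crossing] \<notin> form1" "[Crossing] \<notin> form2 \<union> form2_reversed" "[Crossing] \<notin> form3" "[Crossing] \<in> form4"
proof -
  show "[Crossing] \<in> form4"
    unfolding form4_words by (rule wordsI[of _ "[]" Crossing "[]" "[]"]) (auto simp: lower_def upper_def)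
  then show "[Crossing] \<notin> form1" "[Crossing] \<notin> form2 \<union> form2_reversed" "[Crossing] \<notin> form3"
    using forms_disjoint(4) by auto
qed

lemma forms_all_words:
  "form1 \<subseteq> all_words" "form2 \<union> form2_reversed \<subseteq> all_words" "form3 \<subseteq> all_words" "form4 \<subseteq> all_words"
  using all_words_forms by auto

lemma gf_families:
  "gfF1 b = 2 * G form1" "gfF2 b = 2 * (G form2 + G form2_reversed)" "gfF3 b = 2 * G form3"
  "gfF4 b = 2 * G form4 - t * q ^ b" "gf (pds b) = 2 * G all_words - t * q ^ b"
proof -
  note o = obtained_gf[OF forms_all_words(1)] obtained_gf[OF forms_all_words(2)]
    obtained_gf[OF forms_all_words(3)] obtained_gf[OF forms_all_words(4)] obtained_gf[OF subset_refl]
  show "gfF1 b = 2 * G form1"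
    using o(1) crossing_not_in_forms by (simp add: gfF1_def family1_def)
  show "gfF2 b = 2 * (G form2 + G form2_reversed)"
    using o(2) crossing_not_in_forms G_Un[OF forms_disjoint(2)] by (simp add: gfF2_def family2_obtained)
  show "gfF3 b = 2 * G form3"
    using o(3) crossing_not_in_forms by (simp add: gfF3_def family3_def)
  show "gfF4 b = 2 * G form4 - t * q ^ b"
    using o(4) crossing_not_in_forms by (simp add: gfF4_def family4_def)
  have "[Crossing] \<in> all_words" using crossing_not_in_forms(4) forms_all_words(4) by blast
  moreover have "pds b = (\<lambda>k n. card (obtained b all_words k n))" using pds_obtained by blast
  ultimately show "gf (pds b) = 2 * G all_words - t * q ^ b"
    using o(5) by simp
qed

lemma G_form1: "G form1 = U * (gfC b * (S * (gfP * gfC b * U)))"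
  and G_form2: "G form2 = U * (gfC b * (S * (gfP * \<Sigma> * U)))"
  and G_form2_reversed: "G form2_reversed = U * (\<Sigma> * (S * (gfP * gfC b * U)))"
  unfolding form1_def form2_def form2_reversed_def by (simp_all add: G_two_ends)

lemma G_all_words: "G all_words = G form1 + (G form2 + G form2_reversed) + G form3 + G form4"
  unfolding all_words_forms
  by (simp only: G_Un[OF forms_disjoint(1)] G_Un[OF forms_disjoint(2)] G_Un[OF forms_disjoint(3)]
      G_Un[OF forms_disjoint(4)])

end

theorem mainTheorem5:
  fixes b :: nat and P C E \<Sigma> :: series and B :: "nat \<Rightarrow> series"
  assumes "b \<ge> 2"
  defines "P \<equiv> gfP" and "C \<equiv> gfC b" and "B \<equiv> gfB" and "E \<equiv> gfE b"
  defines "\<Sigma> \<equiv> (\<Sum>i = 2..b - 1. B i)"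
  shows "gfF1 b = 2 * (1 + P * (1 + E))\<^sup>2 * (P * C\<^sup>2 / (1 - P * (C + \<Sigma>)))
    \<and> gfF2 b = 4 * (1 + P * (1 + E))\<^sup>2 * (P * C * \<Sigma> / (1 - P * (C + \<Sigma>)))
    \<and> gfF3 b = 2 * (1 + P * (1 + E))\<^sup>2 * (P * \<Sigma> / (1 - P * \<Sigma>))
                 * (P * C * \<Sigma> / (1 - P * (C + \<Sigma>)))
    \<and> gfF4 b = 2 * (1 + P * (1 + E))\<^sup>2 * C - t * q ^ b
    \<and> gf (pds b) = gfF1 b + gfF2 b + gfF3 b + gfF4 b
    \<and> rational (gf (pds b))"
proof -
  interpret strip b by standard (fact assms(1))
  have rat: "rational (gf (pds b))"
    unfolding gf_families
    by (intro rational_diff rational_all_listings rational_mult rational_power rational_t rational_q)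
  have total: "gf (pds b) = gfF1 b + gfF2 b + gfF3 b + gfF4 b"
    unfolding gf_families G_all_words by (simp only: distrib_left add_diff_eq)
  \<comment> \<open>The commutative identities behind the closed forms, with \<open>u\<close> for an
    end factor, \<open>c\<close> for crossings, \<open>z\<close> for bubbles and \<open>s\<close>,
    \<open>s'\<close> for the star series that replace the two quotients.\<close>
  have ring:
    "2 * (u * (c * (s * (p * c * u)))) = 2 * u\<^sup>2 * (p * c\<^sup>2 * s)"
    "2 * (u * (c * (s * (p * z * u))) + u * (z * (s * (p * c * u)))) = 4 * u\<^sup>2 * (p * c * z * s)"
    "2 * (u * (z * (s' * (p * c * (s * (p * z * u)))))) = 2 * u\<^sup>2 * (p * z * s') * (p * c * z * s)"
    "2 * (u * (c * u)) = 2 * u\<^sup>2 * c"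
    for u c s s' p z :: series
    by (simp_all add: power2_eq_square algebra_simps)
  show ?thesis
    unfolding P_def C_def \<Sigma>_def B_def E_def divide_S divide_S'
    using rat total
    by (simp only: gf_families(1-4) G_form1 G_form2 G_form2_reversed G_form3 G_form4 ring simp_thms)
qed

end
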